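(* Let $k$ be an algebraically closed field of characteristic $p\ge3$ and let $\mathfrak g=\mathfrak{sp}_4$ (type $C_2$) over $k$. For each $r\ge1$, $$\dim C_r(\mathfrak u_1)=\begin{cases}2r+2 & \text{if } r=1 \text{ and } p\ne3,\\ 3r & \text{otherwise},\end{cases} \qquad\text{and}\qquad \dim C_r(\mathcal N_1)=\begin{cases}2r+6 & \text{if } r\le2 \text{ and } p\neq3,\\ 3r+3 & \text{otherwise}.\end{cases}$$
   Context: $\mathfrak{sp}_4\subseteq\mathfrak{gl}_4$ is the set of matrices $X$ with $X^tS+SX=0$, $S=\begin{pmatrix}0&J_2\\-J_2&0\end{pmatrix}$, $J_2=\begin{pmatrix}0&1\\1&0\end{pmatrix}$. $\mathcal N_1=\{x\in\mathfrak g:x^{[p]}=0\}$, where $x^{[p]}$ is the $p$-th matrix power; $\mathfrak u$ is the space of strictly upper triangular matrices in $\mathfrak g$ and $\mathfrak u_1=\mathcal N_1\cap\mathfrak u$. For a closed subvariety $V\subseteq\mathfrak g$, $C_r(V)=\{(x_1,\dots,x_r)\in V^r:[x_i,x_j]=0,\ 1\le i\le j\le r\}$. *)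

theory Defs
  imports
    "HOL-Analysis.Abstract_Topology"
    "HOL-Library.FuncSet"
    "HOL-Library.Extended_Nat"
    "HOL-Computational_Algebra.Polynomial"
    "Jordan_Normal_Form.Matrix"
begin

section \<open>Zariski topology and dimension\<close>

text \<open>
  Polynomial functions on a space \<^term>\<open>X\<close> with a given set \<^term>\<open>C\<close> of coordinate functions:
  the \<^typ>\<open>'k\<close>-algebra of functions generated by \<^term>\<open>C\<close>.
\<close>

inductive_set polynomial_functions :: "('a \<Rightarrow> 'k::comm_ring_1) set \<Rightarrow> ('a \<Rightarrow> 'k) set"
  for C :: "('a \<Rightarrow> 'k) set" where
  const: "(\<lambda>_. c) \<in> polynomial_functions C"
| coord: "f \<in> C \<Longrightarrow> f \<in> polynomial_functions C"
| add: "f \<in> polynomial_functions C \<Longrightarrow> g \<in> polynomial_functions C \<Longrightarrow>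
    (\<lambda>x. f x + g x) \<in> polynomial_functions C"
| mult: "f \<in> polynomial_functions C \<Longrightarrow> g \<in> polynomial_functions C \<Longrightarrow>
    (\<lambda>x. f x * g x) \<in> polynomial_functions C"

definition zero_locus :: "'a set \<Rightarrow> ('a \<Rightarrow> 'k::zero) set \<Rightarrow> 'a set" where
  "zero_locus X F = {x \<in> X. \<forall>f\<in>F. f x = 0}"

definition zariski_topology :: "'a set \<Rightarrow> ('a \<Rightarrow> 'k::idom) set \<Rightarrow> 'a topology" where
  "zariski_topology X C =
     topology (\<lambda>U. \<exists>F \<subseteq> polynomial_functions C. U = X - zero_locus X F)"

lemma istopology_zariski:
  fixes C :: "('a \<Rightarrow> 'k::idom) set"
  shows "istopology (\<lambda>U. \<exists>F \<subseteq> polynomial_functions C. U = X - zero_locus X F)"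
  unfolding istopology_def
proof (intro conjI allI impI)
  fix S T
  assume "\<exists>F \<subseteq> polynomial_functions C. S = X - zero_locus X F"
    and "\<exists>F \<subseteq> polynomial_functions C. T = X - zero_locus X F"
  then obtain F G where F: "F \<subseteq> polynomial_functions C" "S = X - zero_locus X F"
    and G: "G \<subseteq> polynomial_functions C" "T = X - zero_locus X G"
    by blast
  define H where "H = {\<lambda>x. f x * g x | f g. f \<in> F \<and> g \<in> G}"
  have "H \<subseteq> polynomial_functions C"
    using F(1) G(1) by (auto simp: H_def intro!: polynomial_functions.mult)
  moreover have "(\<exists>h\<in>H. h x \<noteq> 0) \<longleftrightarrow> (\<exists>f\<in>F. f x \<noteq> 0) \<and> (\<exists>g\<in>G. g x \<noteq> 0)" for x
    unfolding H_def by fastforce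
  then have "S \<inter> T = X - zero_locus X H"
    unfolding F(2) G(2) zero_locus_def by blast
  ultimately show "\<exists>F \<subseteq> polynomial_functions C. S \<inter> T = X - zero_locus X F"
    by blast
next
  fix \<K>
  assume "\<forall>K\<in>\<K>. \<exists>F \<subseteq> polynomial_functions C. K = X - zero_locus X F"
  then obtain F where F: "\<And>K. K \<in> \<K> \<Longrightarrow> F K \<subseteq> polynomial_functions C \<and> K = X - zero_locus X (F K)"
    by metis
  have "x \<in> \<Union>\<K> \<longleftrightarrow> x \<in> X - zero_locus X (\<Union>(F ` \<K>))" for x
  proof -
    have "x \<in> \<Union>\<K> \<longleftrightarrow> (\<exists>K\<in>\<K>. x \<in> X - zero_locus X (F K))"
      using F by blast
    then show ?thesis
      by (auto simp: zero_locus_def)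
  qed
  then have "\<Union>\<K> = X - zero_locus X (\<Union>(F ` \<K>))"
    by blast
  moreover have "\<Union>(F ` \<K>) \<subseteq> polynomial_functions C"
    using F by blast
  ultimately show "\<exists>F \<subseteq> polynomial_functions C. \<Union>\<K> = X - zero_locus X F"
    by blast
qed

lemma openin_zariski:
  "openin (zariski_topology X C) U \<longleftrightarrow>
     (\<exists>F \<subseteq> polynomial_functions C. U = X - zero_locus X F)"
  unfolding zariski_topology_def by (simp add: topology_inverse'[OF istopology_zariski])

lemma topspace_zariski [simp]:
  fixes C :: "('a \<Rightarrow> 'k::idom) set"
  shows "topspace (zariski_topology X C) = X"
proof
  show "topspace (zariski_topology X C) \<subseteq> X"
    by (auto simp: topspace_def openin_zariski)
  have "X = X - zero_locus X {\<lambda>_. 1 :: 'k}"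
    by (simp add: zero_locus_def)
  moreover have "{\<lambda>_. 1 :: 'k} \<subseteq> polynomial_functions C"
    by (simp add: polynomial_functions.const)
  ultimately have "openin (zariski_topology X C) X"
    unfolding openin_zariski by blast
  then show "X \<subseteq> topspace (zariski_topology X C)"
    by (rule openin_subset)
qed

lemma closedin_zariski:
  "closedin (zariski_topology X C) Z \<longleftrightarrow> (\<exists>F \<subseteq> polynomial_functions C. Z = zero_locus X F)"
proof -
  have sub: "zero_locus X F \<subseteq> X" for F :: "('a \<Rightarrow> 'b) set"
    by (auto simp: zero_locus_def)
  show ?thesis
    unfolding closedin_def openin_zariski topspace_zariski
    by (metis sub double_diff subset_refl)
qed

definition irreducible_closedin :: "'a topology \<Rightarrow> 'a set \<Rightarrow> bool" where
  "irreducible_closedin T Z \<longleftrightarrow>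
     closedin T Z \<and> Z \<noteq> {} \<and>
     (\<forall>A B. closedin T A \<longrightarrow> closedin T B \<longrightarrow> Z = A \<union> B \<longrightarrow> Z = A \<or> Z = B)"

text \<open>The empty space gets dimension \<open>0\<close> (there is no \<open>-\<infinity>\<close> in \<^typ>\<open>enat\<close>).\<close>

definition krull_dimension :: "'a topology \<Rightarrow> enat" where
  "krull_dimension T =
     Sup {enat n | n. \<exists>Z :: nat \<Rightarrow> 'a set.
            (\<forall>i\<le>n. irreducible_closedin T (Z i)) \<and> (\<forall>i<n. Z i \<subset> Z (Suc i))}"


section \<open>The symplectic Lie algebra\<close>

definition lie_bracket :: "'k::ring mat \<Rightarrow> 'k mat \<Rightarrow> 'k mat" where
  "lie_bracket x y = x * y - y * x"

definition J2 :: "'k::ring_1 mat" where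
  "J2 = mat_of_rows_list 2 [[0, 1], [1, 0]]"

definition sp4_form :: "'k::ring_1 mat" where
  "sp4_form = four_block_mat (0\<^sub>m 2 2) J2 (- J2) (0\<^sub>m 2 2)"

definition sp4 :: "'k::comm_ring_1 mat set" where
  "sp4 = {x \<in> carrier_mat 4 4. x\<^sup>T * sp4_form + sp4_form * x = 0\<^sub>m 4 4}"

definition restricted_nullcone :: "nat \<Rightarrow> 'k::comm_ring_1 mat set" where
  "restricted_nullcone p = {x \<in> sp4. x ^\<^sub>m p = 0\<^sub>m 4 4}"

definition strictly_upper_sp4 :: "'k::comm_ring_1 mat set" where
  "strictly_upper_sp4 = {x \<in> sp4. \<forall>i<4. \<forall>j\<le>i. x $$ (i, j) = 0}"

definition restricted_upper :: "nat \<Rightarrow> 'k::comm_ring_1 mat set" where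
  "restricted_upper p = restricted_nullcone p \<inter> strictly_upper_sp4"


section \<open>Commuting varieties\<close>

text \<open>An \<open>r\<close>-tuple is an extensional function on \<^term>\<open>{..<r}\<close>.\<close>

definition commuting_variety :: "nat \<Rightarrow> 'k::comm_ring_1 mat set \<Rightarrow> (nat \<Rightarrow> 'k mat) set" where
  "commuting_variety r V =
     {x \<in> {..<r} \<rightarrow>\<^sub>E V. \<forall>j<r. \<forall>i\<le>j. lie_bracket (x i) (x j) = 0\<^sub>m 4 4}"

definition matrix_tuples_zariski :: "nat \<Rightarrow> (nat \<Rightarrow> 'k::idom mat) topology" where
  "matrix_tuples_zariski r =
     zariski_topology ({..<r} \<rightarrow>\<^sub>E carrier_mat 4 4)
       {\<lambda>x. x l $$ (i, j) | l i j. l < r \<and> i < 4 \<and> j < 4}"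

definition variety_dimension :: "nat \<Rightarrow> (nat \<Rightarrow> 'k::idom mat) set \<Rightarrow> enat" where
  "variety_dimension r V = krull_dimension (subtopology (matrix_tuples_zariski r) V)"

lemma sp4_form_eq:
  "(sp4_form :: 'k::ring_1 mat) =
     mat_of_rows_list 4 [[0, 0, 0, 1], [0, 0, 1, 0], [0, -1, 0, 0], [-1, 0, 0, 0]]"
  unfolding sp4_form_def J2_def
  by (rule eq_matI)
    (auto simp: mat_of_rows_list_def four_block_mat_def numeral_eq_Suc less_Suc_eq)

end

theory Submission
  imports Defs "Jordan_Normal_Form.Determinant"
begin

text \<open>
  Both equations are a stratification by rational parametrizations, together with two elementary
  criteria for Krull dimension.

  \<^emph>\<open>Dimension.\<close> If a variety contains the image of a polynomial map from affine \<open>d\<close>-space and the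
  parameters can be switched on one after the other, each step being detected by a polynomial
  function, then the closures of the images of the coordinate subspaces form a chain of length \<open>d\<close>
  (\<open>krull_dimension_lower_bound\<close>). If a variety is covered by finitely many images of polynomial maps
  from affine \<open>d\<close>-space, then no chain is longer than \<open>d\<close> (\<open>krull_dimension_upper_bound\<close>): functions
  that separate consecutive members of a chain of length \<open>d + 1\<close> are algebraically independent on the top
  member, whereas \<open>d + 1\<close> polynomials in \<open>d\<close> variables are always dependent, by counting monomials.

  \<^emph>\<open>Strictly upper triangular tuples.\<close> Such a matrix has four coordinates \<open>a, b, c, d\<close>, and two of them
  commute iff \<open>a b' = a' b\<close> and \<open>a c' = a' c\<close>. So either all \<open>a\<close>-coordinates of
  a commuting tuple vanish (\<open>3r\<close> free parameters), or the \<open>b\<close>- and \<open>c\<close>-coordinates are fixed multiples of the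
  \<open>a\<close>-coordinates (\<open>2r + 2\<close> parameters). The cube of the element has the single entry \<open>- a\<^sup>2 b\<close>; for
  \<open>p = 3\<close> this forces the first multiple to be \<open>0\<close>, and only \<open>2r + 1 \<le> 3r\<close> parameters are left.

  \<^emph>\<open>Nilpotent tuples.\<close> A nilpotent element of \<open>sp4\<close> with \<open>x\<^sup>3 = 0\<close> already has \<open>x\<^sup>2 = 0\<close>, because the partition
  \<open>(3, 1)\<close> does not occur in type C. By polarization, a commuting tuple of nilpotent elements therefore is of
  one of two kinds: some member is regular (\<open>x\<^sup>3 \<noteq> 0\<close>), or all products of two members vanish.
  In the first case the other members lie in the centralizer of \<open>x\<close> in \<open>sp4\<close>, which is spanned by \<open>x\<close> and \<open>x\<^sup>3\<close>;
  as the nilpotent cone is \<open>8\<close>-dimensional, this gives \<open>8 + 2 (r - 1) = 2r + 6\<close> parameters. In the second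
  case all images lie in one Lagrangian plane (\<open>3\<close> parameters), and each member is a quadratic
  form on it (\<open>3\<close> parameters), altogether \<open>3r + 3\<close>. For \<open>p = 3\<close> the condition \<open>x\<^sup>p = 0\<close> excludes the first
  kind; for \<open>p > 3\<close> it says \<open>x\<^sup>4 = 0\<close>, and both kinds occur.
\<close>

section \<open>Polynomial functions\<close>

lemma polynomial_functions_sum:
  assumes "\<And>i. i \<in> I \<Longrightarrow> f i \<in> polynomial_functions C"
  shows "(\<lambda>x. \<Sum>i\<in>I. f i x) \<in> polynomial_functions C"
  using assms
proof (induction I rule: infinite_finite_induct)
  case (insert i I)
  then show ?case by (simp add: polynomial_functions.add)
qed (simp_all add: polynomial_functions.const)

lemma polynomial_functions_prod:
  assumes "\<And>i. i \<in> I \<Longrightarrow> f i \<in> polynomial_functions C"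
  shows "(\<lambda>x. \<Prod>i\<in>I. f i x) \<in> polynomial_functions C"
  using assms
proof (induction I rule: infinite_finite_induct)
  case (insert i I)
  then show ?case by (simp add: polynomial_functions.mult)
qed (simp_all add: polynomial_functions.const)

lemma polynomial_functions_uminus:
  assumes "f \<in> polynomial_functions C"
  shows "(\<lambda>x. - f x) \<in> polynomial_functions C"
  using polynomial_functions.mult[OF polynomial_functions.const[of "-1"] assms] by simp

lemma polynomial_functions_diff:
  assumes "f \<in> polynomial_functions C" "g \<in> polynomial_functions C"
  shows "(\<lambda>x. f x - g x) \<in> polynomial_functions C"
  using polynomial_functions.add[OF assms(1) polynomial_functions_uminus[OF assms(2)]] by simp

lemma polynomial_functions_power:
  assumes "f \<in> polynomial_functions C"
  shows "(\<lambda>x. f x ^ n) \<in> polynomial_functions C"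
  using polynomial_functions_prod[of "{..<n}" "\<lambda>_. f"] assms by simp

lemmas polynomial_functions_intros =
  polynomial_functions.const polynomial_functions.add polynomial_functions.mult
  polynomial_functions_uminus polynomial_functions_diff polynomial_functions_power
  polynomial_functions_sum polynomial_functions_prod

lemma polynomial_functions_pullback:
  assumes "f \<in> polynomial_functions C"
    and "\<And>g. g \<in> C \<Longrightarrow> (\<lambda>t. g (\<phi> t)) \<in> polynomial_functions D"
  shows "(\<lambda>t. f (\<phi> t)) \<in> polynomial_functions D"
  using assms(1) by induction (use assms(2) in \<open>auto intro: polynomial_functions.intros\<close>)

definition affine_coords :: "nat \<Rightarrow> ((nat \<Rightarrow> 'k) \<Rightarrow> 'k) set" where
  "affine_coords d = (\<lambda>i t. t i) ` {..<d}"

lemma affine_coord: "i < d \<Longrightarrow> (\<lambda>t. t i) \<in> polynomial_functions (affine_coords d)"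
  by (rule polynomial_functions.coord) (auto simp: affine_coords_def)


section \<open>Lower bounds for the dimension\<close>

lemma infinite_alg_closed_field: "infinite (UNIV :: 'k::alg_closed_field set)"
proof
  assume fin: "finite (UNIV :: 'k set)"
  define q :: "'k poly" where "q = (\<Prod>a\<in>UNIV. [:-a, 1:])"
  have "degree q = card (UNIV :: 'k set)"
    unfolding q_def by (subst degree_prod_eq_sum_degree) auto
  then have "degree (q + 1) > 0"
    using fin by (simp add: degree_add_eq_left card_gt_0_iff)
  then obtain x where "poly (q + 1) x = 0"
    using alg_closed_imp_poly_has_root by blast
  moreover have "poly q x = 0"
    using fin by (auto simp: q_def poly_prod)
  ultimately show False by simp
qed

lemma polynomial_function_on_line:
  fixes s t :: "nat \<Rightarrow> 'k::comm_ring_1"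
  assumes "f \<in> polynomial_functions (affine_coords d)"
  shows "\<exists>q. \<forall>z. f (\<lambda>i. s i + z * (t i - s i)) = poly q z"
  using assms
proof induction
  case (const c)
  show ?case by (rule exI[of _ "[:c:]"]) simp
next
  case (coord f)
  then obtain i where "f = (\<lambda>t. t i)" by (auto simp: affine_coords_def)
  then show ?case by (intro exI[of _ "[:s i, t i - s i:]"]) simp
next
  case (add f g)
  then obtain p q where "\<forall>z. f (\<lambda>i. s i + z * (t i - s i)) = poly p z"
    "\<forall>z. g (\<lambda>i. s i + z * (t i - s i)) = poly q z" by blast
  then show ?case by (intro exI[of _ "p + q"]) simp
next
  case (mult f g)
  then obtain p q where "\<forall>z. f (\<lambda>i. s i + z * (t i - s i)) = poly p z"
    "\<forall>z. g (\<lambda>i. s i + z * (t i - s i)) = poly q z" by blast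
  then show ?case by (intro exI[of _ "p * q"]) simp
qed

text \<open>
  Restricted to the line through \<open>s\<close> and \<open>t\<close>, both functions are nonzero polynomials in one variable; over an
  infinite field some point of the line avoids the roots of both. This is the irreducibility
  of the coordinate subspaces of affine space.
\<close>

lemma coordinate_subspace_irreducible:
  fixes f g :: "(nat \<Rightarrow> 'k::alg_closed_field) \<Rightarrow> 'k"
  assumes f: "f \<in> polynomial_functions (affine_coords d)"
    and g: "g \<in> polynomial_functions (affine_coords d)"
    and s: "\<forall>j\<ge>n. s j = 0" "f s \<noteq> 0" and t: "\<forall>j\<ge>n. t j = 0" "g t \<noteq> 0"
  shows "\<exists>u. (\<forall>j\<ge>n. u j = 0) \<and> f u * g u \<noteq> 0"
proof -
  obtain p where p: "\<And>z. f (\<lambda>i. s i + z * (t i - s i)) = poly p z"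
    using polynomial_function_on_line[OF f] by blast
  obtain q where q: "\<And>z. g (\<lambda>i. s i + z * (t i - s i)) = poly q z"
    using polynomial_function_on_line[OF g] by blast
  have "poly p 0 \<noteq> 0" "poly q 1 \<noteq> 0"
    using p[of 0] q[of 1] s t by simp_all
  then have "p * q \<noteq> 0" by auto
  then have "finite {z. poly (p * q) z = 0}"
    by (rule poly_roots_finite)
  then obtain z where "poly (p * q) z \<noteq> 0"
    using infinite_alg_closed_field[where 'k = 'k] by (metis (mono_tags, lifting) UNIV_eq_I mem_Collect_eq)
  then show ?thesis
    using s t p q by (intro exI[of _ "\<lambda>i. s i + z * (t i - s i)"]) simp
qed

lemma closedin_subvariety:
  assumes "V \<subseteq> X"
  shows "closedin (subtopology (zariski_topology X C) V) Z \<longleftrightarrow>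
    (\<exists>F \<subseteq> polynomial_functions C. Z = {x \<in> V. \<forall>f\<in>F. f x = 0})"
proof -
  have "zero_locus X F \<inter> V = {x \<in> V. \<forall>f\<in>F. f x = 0}" for F :: "('a \<Rightarrow> 'b) set"
    using assms by (auto simp: zero_locus_def)
  then show ?thesis
    unfolding closedin_subtopology closedin_zariski by metis
qed

text \<open>
  The chain consists of the closures in \<open>V\<close> of the images of the coordinate subspaces
  \<open>t\<^sub>n = t\<^sub>n\<^sub>+\<^sub>1 = \<dots> = 0\<close>. They are irreducible as closures of images of irreducible sets, and the
  hypothesis \<open>sep\<close> makes consecutive members different.
\<close>

lemma krull_dimension_lower_bound:
  fixes \<phi> :: "(nat \<Rightarrow> 'k::alg_closed_field) \<Rightarrow> 'a"
  assumes VX: "V \<subseteq> X" and V: "\<And>t. \<phi> t \<in> V"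
    and poly: "\<And>f. f \<in> C \<Longrightarrow> (\<lambda>t. f (\<phi> t)) \<in> polynomial_functions (affine_coords d)"
    and sep: "\<And>n. n < d \<Longrightarrow> \<exists>F\<in>polynomial_functions C.
      (\<forall>t. (\<forall>j\<ge>n. t j = 0) \<longrightarrow> F (\<phi> t) = 0) \<and> (\<exists>t. (\<forall>j>n. t j = 0) \<and> F (\<phi> t) \<noteq> 0)"
  shows "enat d \<le> krull_dimension (subtopology (zariski_topology X C) V)"
proof -
  define A where "A n = {t :: nat \<Rightarrow> 'k. \<forall>j\<ge>n. t j = 0}" for n
  define I where "I n = {F \<in> polynomial_functions C. \<forall>t\<in>A n. F (\<phi> t) = 0}" for n
  define Z where "Z n = {x \<in> V. \<forall>F\<in>I n. F x = 0}" for n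
  let ?T = "subtopology (zariski_topology X C) V"
  note pull = polynomial_functions_pullback[where \<phi> = \<phi>, OF _ poly]
  have image: "\<phi> t \<in> Z n" if "t \<in> A n" for t n
    using that V by (auto simp: Z_def I_def)
  have irr: "irreducible_closedin ?T (Z n)" for n
    unfolding irreducible_closedin_def
  proof (intro conjI allI impI)
    show "closedin ?T (Z n)"
      unfolding closedin_subvariety[OF VX] Z_def by (rule exI[of _ "I n"]) (auto simp: I_def)
    show "Z n \<noteq> {}"
      using image[of "\<lambda>_. 0" n] by (auto simp: A_def)
    fix P Q assume "closedin ?T P" "closedin ?T Q" and PQ: "Z n = P \<union> Q"
    then obtain F G where F: "F \<subseteq> polynomial_functions C" "P = {x \<in> V. \<forall>f\<in>F. f x = 0}"
      and G: "G \<subseteq> polynomial_functions C" "Q = {x \<in> V. \<forall>f\<in>G. f x = 0}"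
      unfolding closedin_subvariety[OF VX] by blast
    show "Z n = P \<or> Z n = Q"
    proof (rule ccontr)
      assume "\<not> (Z n = P \<or> Z n = Q)"
      then obtain x y where x: "x \<in> Z n" "x \<notin> P" and y: "y \<in> Z n" "y \<notin> Q"
        using PQ by blast
      have "x \<in> V" "y \<in> V" using x y by (auto simp: Z_def)
      then obtain f g where f: "f \<in> F" "f x \<noteq> 0" and g: "g \<in> G" "g y \<noteq> 0"
        using x y F G by auto
      have fC: "f \<in> polynomial_functions C" and gC: "g \<in> polynomial_functions C"
        using f g F G by auto
      have "f \<notin> I n" "g \<notin> I n" using x y f g by (auto simp: Z_def)
      then obtain s t where st: "s \<in> A n" "f (\<phi> s) \<noteq> 0" "t \<in> A n" "g (\<phi> t) \<noteq> 0"
        using fC gC by (auto simp: I_def)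
      then obtain u where u: "u \<in> A n" "f (\<phi> u) * g (\<phi> u) \<noteq> 0"
        using coordinate_subspace_irreducible[OF pull[OF fC] pull[OF gC], of n s t]
        by (auto simp: A_def)
      then have "\<phi> u \<in> P \<union> Q" using image PQ by blast
      then show False using u f g F G by auto
    qed
  qed
  have strict: "Z n \<subset> Z (Suc n)" if n: "n < d" for n
  proof -
    have "A n \<subseteq> A (Suc n)" by (auto simp: A_def)
    then have "Z n \<subseteq> Z (Suc n)" by (auto simp: Z_def I_def)
    moreover obtain F t where F: "F \<in> polynomial_functions C"
      "\<forall>t. (\<forall>j\<ge>n. t j = 0) \<longrightarrow> F (\<phi> t) = 0" "\<forall>j>n. t j = 0" "F (\<phi> t) \<noteq> 0"
      using sep[OF n] by blast
    then have "F \<in> I n" by (auto simp: I_def A_def)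
    then have "\<phi> t \<notin> Z n" using F by (auto simp: Z_def)
    moreover have "\<phi> t \<in> Z (Suc n)"
      by (rule image) (use F in \<open>auto simp: A_def\<close>)
    ultimately show ?thesis by blast
  qed
  show ?thesis
    unfolding krull_dimension_def
    by (rule Sup_upper) (use irr strict in blast)
qed


section \<open>Upper bounds for the dimension\<close>

text \<open>
  Gaussian elimination: the last equation is used to eliminate one unknown \<open>m\<close> whose coefficient is nonzero.
\<close>

lemma homogeneous_system_nontrivial_solution:
  fixes a :: "'i \<Rightarrow> nat \<Rightarrow> 'k::field"
  assumes "finite I" "D < card I"
  shows "\<exists>c. (\<exists>i\<in>I. c i \<noteq> 0) \<and> (\<forall>j<D. (\<Sum>i\<in>I. c i * a i j) = 0)"
  using assms
proof (induction D arbitrary: I a)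
  case 0
  then obtain i where "i \<in> I" by fastforce
  then show ?case by (intro exI[of _ "\<lambda>_. 1"]) auto
next
  case (Suc D)
  show ?case
  proof (cases "\<forall>i\<in>I. a i D = 0")
    case True
    obtain c where "\<exists>i\<in>I. c i \<noteq> 0" "\<forall>j<D. (\<Sum>i\<in>I. c i * a i j) = 0"
      using Suc.IH[of I a] Suc.prems by auto
    then show ?thesis using True by (intro exI[of _ c]) (auto simp: less_Suc_eq)
  next
    case False
    then obtain m where m: "m \<in> I" "a m D \<noteq> 0" by blast
    define I' where "I' = I - {m}"
    define b where "b i j = a i j - a i D / a m D * a m j" for i j
    have fin: "finite I'" and I: "I = insert m I'" "m \<notin> I'"
      using Suc.prems m by (auto simp: I'_def)
    have "D < card I'" using Suc.prems fin I by simp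
    then obtain c where c: "\<exists>i\<in>I'. c i \<noteq> 0" "\<forall>j<D. (\<Sum>i\<in>I'. c i * b i j) = 0"
      using Suc.IH[OF fin] by metis
    define w where "w = - (\<Sum>i\<in>I'. c i * (a i D / a m D))"
    define c' where "c' = c(m := w)"
    have eq: "(\<Sum>i\<in>I. c' i * a i j) = (\<Sum>i\<in>I'. c i * b i j)" for j
    proof -
      have "(\<Sum>i\<in>I. c' i * a i j) = w * a m j + (\<Sum>i\<in>I'. c' i * a i j)"
        using fin I by (simp add: c'_def)
      also have "(\<Sum>i\<in>I'. c' i * a i j) = (\<Sum>i\<in>I'. c i * a i j)"
        using I by (intro sum.cong) (auto simp: c'_def)
      also have "w * a m j = - (\<Sum>i\<in>I'. c i * (a i D / a m D) * a m j)"
        by (simp add: w_def sum_distrib_right)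
      finally show ?thesis
        by (simp add: b_def right_diff_distrib sum_subtractf mult.assoc)
    qed
    have "b i D = 0" for i using m by (simp add: b_def)
    then have "\<forall>j<Suc D. (\<Sum>i\<in>I. c' i * a i j) = 0"
      using c(2) unfolding eq by (auto simp: less_Suc_eq)
    moreover have "\<exists>i\<in>I. c' i \<noteq> 0" using c(1) I by (auto simp: c'_def)
    ultimately show ?thesis by blast
  qed
qed

definition function_span :: "('a \<Rightarrow> 'k::comm_ring_1) set \<Rightarrow> ('a \<Rightarrow> 'k) set" where
  "function_span B = {\<lambda>x. \<Sum>b\<in>B. u b * b x | u. True}"

lemma function_span_base:
  assumes "finite B" "b \<in> B"
  shows "b \<in> function_span B"
proof -
  have "(\<Sum>b'\<in>B. (if b' = b then 1 else 0) * b' x) = (\<Sum>b'\<in>B. if b' = b then b' x else 0)" for x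
    by (rule sum.cong) auto
  then have "b = (\<lambda>x. \<Sum>b'\<in>B. (if b' = b then 1 else 0) * b' x)"
    using assms by (simp only: sum.delta' sum.delta) (simp only: if_True)
  then show ?thesis unfolding function_span_def by (intro CollectI exI conjI TrueI)
qed

lemma function_span_sum:
  assumes "\<And>i. i \<in> I \<Longrightarrow> h i \<in> function_span B"
  shows "(\<lambda>x. \<Sum>i\<in>I. c i * h i x) \<in> function_span B"
proof -
  have "\<forall>i\<in>I. \<exists>u. h i = (\<lambda>x. \<Sum>b\<in>B. u b * b x)"
    using assms by (auto simp: function_span_def)
  then obtain U where U: "\<And>i. i \<in> I \<Longrightarrow> h i = (\<lambda>x. \<Sum>b\<in>B. U i b * b x)" by metis
  have "(\<Sum>i\<in>I. c i * h i x) = (\<Sum>b\<in>B. (\<Sum>i\<in>I. c i * U i b) * b x)" for x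
  proof -
    have "(\<Sum>i\<in>I. c i * h i x) = (\<Sum>i\<in>I. \<Sum>b\<in>B. c i * U i b * b x)"
      by (intro sum.cong) (simp_all add: U sum_distrib_left mult.assoc)
    then show ?thesis by (subst (asm) sum.swap) (simp add: sum_distrib_right)
  qed
  then have "(\<lambda>x. \<Sum>i\<in>I. c i * h i x) = (\<lambda>x. \<Sum>b\<in>B. (\<Sum>i\<in>I. c i * U i b) * b x)"
    by (rule ext)
  then show ?thesis unfolding function_span_def by (intro CollectI exI conjI TrueI)
qed

lemma function_span_add:
  assumes "f \<in> function_span B" "g \<in> function_span B"
  shows "(\<lambda>x. f x + g x) \<in> function_span B"
  using function_span_sum[of "{True, False}" "\<lambda>b. if b then f else g" B "\<lambda>_. 1"] assms by simp

lemma function_span_mult: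
  assumes "f \<in> function_span B1" "g \<in> function_span B2"
    and prod: "\<And>b b'. b \<in> B1 \<Longrightarrow> b' \<in> B2 \<Longrightarrow> (\<lambda>x. b x * b' x) \<in> function_span B"
  shows "(\<lambda>x. f x * g x) \<in> function_span B"
proof -
  obtain u v where u: "f = (\<lambda>x. \<Sum>b\<in>B1. u b * b x)" and v: "g = (\<lambda>x. \<Sum>b\<in>B2. v b * b x)"
    using assms(1,2) by (auto simp: function_span_def)
  have "(\<lambda>x. b x * g x) \<in> function_span B" if "b \<in> B1" for b
    using function_span_sum[of B2 "\<lambda>b' x. b x * b' x" B v] prod[OF that]
    by (simp add: v sum_distrib_left mult.left_commute)
  then have "(\<lambda>x. \<Sum>b\<in>B1. u b * (b x * g x)) \<in> function_span B"
    by (rule function_span_sum)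
  then show ?thesis by (simp add: u sum_distrib_right mult.assoc)
qed

text \<open>
  Bounding each exponent separately, instead of the total degree, makes the number of monomials a plain power.
\<close>

definition monomial_box :: "nat \<Rightarrow> nat \<Rightarrow> ((nat \<Rightarrow> 'k::comm_ring_1) \<Rightarrow> 'k) set" where
  "monomial_box d D = (\<lambda>e t. \<Prod>i<d. t i ^ e i) ` ({..<d} \<rightarrow>\<^sub>E {..D})"

lemma monomial_boxI:
  assumes "\<And>i. i < d \<Longrightarrow> e i \<le> D"
  shows "(\<lambda>t. \<Prod>i<d. t i ^ e i) \<in> monomial_box d D"
  unfolding monomial_box_def
  by (rule image_eqI[of _ _ "restrict e {..<d}"]) (use assms in auto)

lemma finite_monomial_box: "finite (monomial_box d D)"
  unfolding monomial_box_def by (intro finite_imageI finite_PiE) auto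

lemma card_monomial_box: "card (monomial_box d D) \<le> (D + 1) ^ d"
  unfolding monomial_box_def
  by (rule order.trans[OF card_image_le]) (auto simp: card_PiE intro: finite_PiE)

lemma monomial_box_span_mult:
  assumes "f \<in> function_span (monomial_box d D)" "g \<in> function_span (monomial_box d E)"
    and "D + E \<le> M"
  shows "(\<lambda>t. f t * g t) \<in> function_span (monomial_box d M)"
proof (rule function_span_mult[OF assms(1,2)])
  fix b b' :: "(nat \<Rightarrow> 'a) \<Rightarrow> 'a"
  assume "b \<in> monomial_box d D" "b' \<in> monomial_box d E"
  then obtain e e' where b: "b = (\<lambda>t. \<Prod>i<d. t i ^ e i)" "e \<in> {..<d} \<rightarrow>\<^sub>E {..D}"
    and b': "b' = (\<lambda>t. \<Prod>i<d. t i ^ e' i)" "e' \<in> {..<d} \<rightarrow>\<^sub>E {..E}"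
    by (auto simp: monomial_box_def)
  have "(\<lambda>t. b t * b' t) = (\<lambda>t. \<Prod>i<d. t i ^ (e i + e' i))"
    by (simp add: b b' power_add prod.distrib)
  also have "\<dots> \<in> monomial_box d M"
  proof (rule monomial_boxI)
    fix i assume "i < d"
    then have "e i \<le> D" "e' i \<le> E" using b b' by auto
    then show "e i + e' i \<le> M" using assms(3) by simp
  qed
  finally show "(\<lambda>t. b t * b' t) \<in> function_span (monomial_box d M)"
    by (rule function_span_base[OF finite_monomial_box])
qed

lemma monomial_box_span_const: "(\<lambda>_. c) \<in> function_span (monomial_box d D)"
proof -
  have "(\<lambda>t. \<Prod>i<d. t i ^ 0) \<in> function_span (monomial_box d D)"
    by (rule function_span_base[OF finite_monomial_box monomial_boxI]) simp
  then have "(\<lambda>_. 1) \<in> function_span (monomial_box d D)" by simp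
  from function_span_sum[of "{()}" "\<lambda>_ _. 1", OF this, of "\<lambda>_. c"] show ?thesis by simp
qed

lemma monomial_box_span_mono:
  assumes "f \<in> function_span (monomial_box d D)" "D \<le> M"
  shows "f \<in> function_span (monomial_box d M)"
  using monomial_box_span_mult[OF assms(1) monomial_box_span_const[of 1 d 0], of M] assms(2) by simp

lemma polynomial_function_in_monomial_box_span:
  assumes "f \<in> polynomial_functions (affine_coords d)"
  shows "\<exists>D. f \<in> function_span (monomial_box d D)"
  using assms
proof induction
  case (const c)
  show ?case using monomial_box_span_const by blast
next
  case (coord f)
  then obtain i where i: "f = (\<lambda>t. t i)" "i < d" by (auto simp: affine_coords_def)
  have "(\<lambda>t. \<Prod>j<d. t j ^ (if j = i then 1 else 0)) \<in> monomial_box d 1"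
    by (rule monomial_boxI) simp
  also have "(\<lambda>t. \<Prod>j<d. t j ^ (if j = i then 1 else 0)) = f"
    using i(2) by (simp add: i(1) if_distrib[of "\<lambda>n. _ ^ n"] prod.delta cong: if_cong)
  finally show ?case using function_span_base[OF finite_monomial_box] by blast
next
  case (add f g)
  then obtain D E where "f \<in> function_span (monomial_box d D)" "g \<in> function_span (monomial_box d E)"
    by blast
  then have "f \<in> function_span (monomial_box d (max D E))" "g \<in> function_span (monomial_box d (max D E))"
    by (auto elim: monomial_box_span_mono)
  then show ?case by (blast intro: function_span_add)
next
  case (mult f g)
  then show ?case using monomial_box_span_mult by blast
qed

lemma monomial_box_span_power:
  assumes "f \<in> function_span (monomial_box d D)"
  shows "(\<lambda>t. f t ^ n) \<in> function_span (monomial_box d (n * D))"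
proof (induction n)
  case 0
  show ?case using monomial_box_span_const[of 1] by simp
next
  case (Suc n)
  show ?case using monomial_box_span_mult[OF assms Suc.IH, of "Suc n * D"] by simp
qed

lemma monomial_box_span_prod:
  assumes "\<And>i. i < n \<Longrightarrow> f i \<in> function_span (monomial_box d D)"
  shows "(\<lambda>t. \<Prod>i<n. f i t) \<in> function_span (monomial_box d (n * D))"
  using assms
proof (induction n)
  case 0
  show ?case using monomial_box_span_const[of 1] by simp
next
  case (Suc n)
  then have "(\<lambda>t. (\<Prod>i<n. f i t) * f n t) \<in> function_span (monomial_box d (Suc n * D))"
    by (intro monomial_box_span_mult[of _ d "n * D" _ D]) auto
  then show ?case by simp
qed

text \<open>
  The \<open>N\<^bsup>d+1\<^esup>\<close> products of powers with exponents below \<open>N\<close> lie in a space spanned by at most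
  \<open>(c N)\<^sup>d\<close> monomials, where \<open>c\<close> does not depend on \<open>N\<close>. For \<open>N > c\<^sup>d\<close> there are more products than monomials.
\<close>

lemma polynomials_algebraically_dependent:
  fixes f :: "nat \<Rightarrow> (nat \<Rightarrow> 'k::field) \<Rightarrow> 'k"
  assumes "\<And>i. i \<le> d \<Longrightarrow> f i \<in> polynomial_functions (affine_coords d)"
  shows "\<exists>N c. (\<exists>e \<in> {..<Suc d} \<rightarrow>\<^sub>E {..<N}. c e \<noteq> 0) \<and>
    (\<forall>t. (\<Sum>e \<in> {..<Suc d} \<rightarrow>\<^sub>E {..<N}. c e * (\<Prod>i<Suc d. f i t ^ e i)) = 0)"
proof -
  have "\<forall>i\<in>{..d}. \<exists>D. f i \<in> function_span (monomial_box d D)"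
    using assms polynomial_function_in_monomial_box_span by blast
  then obtain Ds where Ds: "\<And>i. i \<le> d \<Longrightarrow> f i \<in> function_span (monomial_box d (Ds i))"
    by (metis atMost_iff)
  define D where "D = Max (Ds ` {..d})"
  have D: "f i \<in> function_span (monomial_box d D)" if "i \<le> d" for i
    using monomial_box_span_mono[OF Ds[OF that], of D] that by (simp add: D_def)
  \<comment> \<open>the constant \<open>c\<close> is \<open>Suc d * D + 1\<close>, and \<open>N\<close> is chosen just above \<open>c ^ d\<close>\<close>
  define N where "N = (Suc d * D + 1) ^ d + 1"
  define M where "M = Suc d * (N * D)"
  let ?E = "{..<Suc d} \<rightarrow>\<^sub>E {..<N}"
  have span: "(\<lambda>t. \<Prod>i<Suc d. f i t ^ e i) \<in> function_span (monomial_box d M)" if "e \<in> ?E" for e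
    unfolding M_def
  proof (rule monomial_box_span_prod)
    fix i assume "i < Suc d"
    then have "e i \<le> N" using PiE_mem[OF that, of i] by simp
    then show "(\<lambda>t. f i t ^ e i) \<in> function_span (monomial_box d (N * D))"
      using monomial_box_span_mono[OF monomial_box_span_power[OF D]] \<open>i < Suc d\<close> by simp
  qed
  define B :: "((nat \<Rightarrow> 'k) \<Rightarrow> 'k) set" where "B = monomial_box d M"
  have "\<forall>e\<in>?E. \<exists>u. \<forall>t. (\<Prod>i<Suc d. f i t ^ e i) = (\<Sum>b\<in>B. u b * b t)"
  proof
    fix e assume "e \<in> ?E"
    from span[OF this] obtain u where "(\<lambda>t. \<Prod>i<Suc d. f i t ^ e i) = (\<lambda>t. \<Sum>b\<in>B. u b * b t)"
      unfolding function_span_def B_def by blast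
    then show "\<exists>u. \<forall>t. (\<Prod>i<Suc d. f i t ^ e i) = (\<Sum>b\<in>B. u b * b t)" 
      by (intro exI[of _ u] allI) (erule fun_cong)
  qed
  then obtain U where U: "\<And>e t. e \<in> ?E \<Longrightarrow> (\<Prod>i<Suc d. f i t ^ e i) = (\<Sum>b\<in>B. U e b * b t)"
    unfolding bchoice_iff by blast
  have fB: "finite B" by (simp add: B_def finite_monomial_box)
  then obtain h where h: "bij_betw h {..<card B} B"
    using ex_bij_betw_nat_finite[OF fB] by (auto simp: atLeast0LessThan)
  have N1: "N \<ge> 1" by (simp add: N_def)
  have "card B \<le> (M + 1) ^ d" unfolding B_def by (rule card_monomial_box)
  also have "\<dots> \<le> (N * (Suc d * D + 1)) ^ d"
    using N1 by (intro power_mono) (auto simp: M_def algebra_simps)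
  also have "\<dots> = N ^ d * (Suc d * D + 1) ^ d" by (rule power_mult_distrib)
  also have "\<dots> < N ^ d * N" using N1 by (simp add: N_def)
  also have "\<dots> = card ?E" by (simp add: card_PiE)
  finally have "card B < card ?E" .
  moreover have "finite ?E" by (intro finite_PiE) auto
  ultimately have "\<exists>c. (\<exists>e\<in>?E. c e \<noteq> 0) \<and> (\<forall>j<card B. (\<Sum>e\<in>?E. c e * U e (h j)) = 0)"
    by (intro homogeneous_system_nontrivial_solution)
  then obtain c where c: "\<exists>e\<in>?E. c e \<noteq> 0" "\<forall>j<card B. (\<Sum>e\<in>?E. c e * U e (h j)) = 0"
    by (elim exE conjE)
  have c0: "(\<Sum>e\<in>?E. c e * U e b) = 0" if "b \<in> B" for b
  proof -
    obtain j where "j < card B" "b = h j" using h \<open>b \<in> B\<close> by (auto simp: bij_betw_def)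
    then show ?thesis using c(2) by (simp del: PiE_iff)
  qed
  have "(\<Sum>e\<in>?E. c e * (\<Prod>i<Suc d. f i t ^ e i)) = 0" for t
  proof -
    have "(\<Sum>e\<in>?E. c e * (\<Prod>i<Suc d. f i t ^ e i)) = (\<Sum>e\<in>?E. \<Sum>b\<in>B. c e * U e b * b t)"
      by (intro sum.cong) (simp_all add: U sum_distrib_left mult.assoc del: prod.lessThan_Suc)
    also have "\<dots> = (\<Sum>b\<in>B. (\<Sum>e\<in>?E. c e * U e b) * b t)"
      by (subst sum.swap) (simp add: sum_distrib_right)
    also have "\<dots> = 0" using c0 by simp
    finally show ?thesis .
  qed
  with c(1) show ?thesis by (intro exI[of _ N] exI[of _ c] conjI allI)
qed

lemma sum_PiE_lessThan_Suc:
  "(\<Sum>e \<in> {..<Suc n} \<rightarrow>\<^sub>E S. h e) = (\<Sum>k\<in>S. \<Sum>e \<in> {..<n} \<rightarrow>\<^sub>E S. h (e(n := k)))"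
proof -
  have "(\<Sum>e \<in> {..<Suc n} \<rightarrow>\<^sub>E S. h e) = (\<Sum>z \<in> S \<times> ({..<n} \<rightarrow>\<^sub>E S). h ((\<lambda>(y, g). g(n := y)) z))"
    unfolding lessThan_Suc PiE_insert_eq
    by (subst sum.reindex[OF inj_combinator]) (auto simp: o_def)
  then show ?thesis by (simp add: sum.cartesian_product case_prod_unfold)
qed

text \<open>
  A relation on \<open>Z (Suc n)\<close> is a polynomial in \<open>f n\<close> whose coefficients \<open>G k\<close> are polynomials in the
  other functions. Since \<open>f n\<close> is not identically zero on the irreducible set \<open>Z (Suc n)\<close>, the lowest power of \<open>f n\<close>
  can be divided out; restricting to \<open>Z n\<close>, where \<open>f n\<close> vanishes, leaves a relation in fewer functions.
\<close>

lemma monomials_independent_on_chain: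
  fixes Z :: "nat \<Rightarrow> 'a set" and f :: "nat \<Rightarrow> 'a \<Rightarrow> 'k::idom"
  assumes prime: "\<And>i g h. i \<le> n \<Longrightarrow> g \<in> polynomial_functions C \<Longrightarrow> h \<in> polynomial_functions C \<Longrightarrow>
      (\<forall>x\<in>Z i. g x * h x = 0) \<Longrightarrow> (\<forall>x\<in>Z i. g x = 0) \<or> (\<forall>x\<in>Z i. h x = 0)"
    and "Z 0 \<noteq> {}" and mono: "\<And>i. i < n \<Longrightarrow> Z i \<subseteq> Z (Suc i)"
    and f: "\<And>i. i < n \<Longrightarrow> f i \<in> polynomial_functions C"
    and f0: "\<And>i x. i < n \<Longrightarrow> x \<in> Z i \<Longrightarrow> f i x = 0"
    and f1: "\<And>i. i < n \<Longrightarrow> \<exists>x\<in>Z (Suc i). f i x \<noteq> 0"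
    and rel: "\<And>x. x \<in> Z n \<Longrightarrow> (\<Sum>e \<in> {..<n} \<rightarrow>\<^sub>E {..<N}. c e * (\<Prod>i<n. f i x ^ e i)) = 0"
    and e: "e \<in> {..<n} \<rightarrow>\<^sub>E {..<N}"
  shows "c e = 0"
  using assms
proof (induction n arbitrary: c e)
  case 0
  then obtain x where "x \<in> Z 0" by blast
  with 0(7)[of x] 0(8) show ?case by simp
next
  case (Suc n)
  note prime = Suc.prems(1) and f = Suc.prems(4) and f0 = Suc.prems(5) and f1 = Suc.prems(6)
  let ?E = "{..<n} \<rightarrow>\<^sub>E {..<N}"
  define G where "G k x = (\<Sum>e\<in>?E. c (e(n := k)) * (\<Prod>i<n. f i x ^ e i))" for k x
  have GC: "G k \<in> polynomial_functions C" for k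
    unfolding G_def by (intro polynomial_functions_intros) (use f in auto)
  have upd: "(\<Prod>i<n. f i x ^ (e(n := k)) i) = (\<Prod>i<n. f i x ^ e i)" for x e k
    by (intro prod.cong) auto
  have rel: "(\<Sum>k<N. G k x * f n x ^ k) = 0" if "x \<in> Z (Suc n)" for x
    using Suc.prems(7)[OF that] unfolding sum_PiE_lessThan_Suc G_def
    by (simp add: sum_distrib_right sum_distrib_left mult.assoc upd)
  have pow: "\<exists>x\<in>Z (Suc n). f n x ^ k \<noteq> 0" for k
    using f1[of n] by auto
  have zero: "\<forall>e\<in>?E. c (e(n := k)) = 0" if "k < N" for k
    using that
  proof (induction k rule: less_induct)
    case (less k)
    define H where "H x = (\<Sum>j\<in>{k..<N}. G j x * f n x ^ (j - k))" for x
    have HC: "H \<in> polynomial_functions C"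
      unfolding H_def using GC f by (intro polynomial_functions_intros) auto
    have G0: "G j x = 0" if "j < k" for j x
      unfolding G_def
    proof (rule sum.neutral, rule ballI)
      fix e assume "e \<in> ?E"
      then have "c (e(n := j)) = 0" using less.IH[OF that] that less.prems by (meson less_trans)
      then show "c (e(n := j)) * (\<Prod>i<n. f i x ^ e i) = 0" by (simp only: mult_zero_left)
    qed
    \<comment> \<open>the powers below \<open>k\<close> have zero coefficients by the inner induction hypothesis, so \<open>f n ^ k\<close> can be divided out\<close>
    have "f n x ^ k * H x = 0" if "x \<in> Z (Suc n)" for x
    proof -
      have "(\<Sum>j<N. G j x * f n x ^ j) = (\<Sum>j\<in>{k..<N}. G j x * f n x ^ j)"
        by (intro sum.mono_neutral_right) (use G0 in auto)
      also have "\<dots> = f n x ^ k * H x"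
        unfolding H_def sum_distrib_left
        by (intro sum.cong) (auto simp: mult.left_commute simp flip: power_add)
      finally show ?thesis using rel[OF that] by simp
    qed
    then have "(\<forall>x\<in>Z (Suc n). f n x ^ k = 0) \<or> (\<forall>x\<in>Z (Suc n). H x = 0)"
      by (intro prime[of "Suc n" "\<lambda>x. f n x ^ k" H] polynomial_functions_power f HC ballI) auto
    then have "\<forall>x\<in>Z (Suc n). H x = 0" using pow[of k] by blast
    then have "H x = 0" "f n x = 0" if "x \<in> Z n" for x
      using that Suc.prems(3)[of n] f0[of n] by auto
    moreover have "H x = G k x" if "f n x = 0" for x
    proof -
      have "H x = (\<Sum>j\<in>{k}. G j x * f n x ^ (j - k))"
        unfolding H_def by (rule sum.mono_neutral_right) (use less.prems that in auto)
      then show ?thesis by simp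
    qed
    ultimately have "G k x = 0" if "x \<in> Z n" for x using that by metis
    then show ?case
      unfolding G_def by (intro ballI Suc.IH[of "\<lambda>e. c (e(n := k))"]) (use Suc.prems in auto)
  qed
  have "e = (restrict e {..<n})(n := e n)" "restrict e {..<n} \<in> ?E" "e n < N"
    using Suc.prems(8) by (auto simp: fun_eq_iff PiE_def extensional_def)
  then show ?case using zero by metis
qed

lemma irreducible_closedin_prime:
  fixes C :: "('a \<Rightarrow> 'k::idom) set"
  assumes VX: "V \<subseteq> X" and irr: "irreducible_closedin (subtopology (zariski_topology X C) V) Z"
    and g: "g \<in> polynomial_functions C" and h: "h \<in> polynomial_functions C"
    and gh: "\<forall>x\<in>Z. g x * h x = 0"
  shows "(\<forall>x\<in>Z. g x = 0) \<or> (\<forall>x\<in>Z. h x = 0)"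
proof -
  let ?T = "subtopology (zariski_topology X C) V"
  obtain F where F: "F \<subseteq> polynomial_functions C" "Z = {x \<in> V. \<forall>f\<in>F. f x = 0}"
    using irr unfolding irreducible_closedin_def closedin_subvariety[OF VX] by blast
  have cl: "closedin ?T {x \<in> V. \<forall>f\<in>insert u F. f x = 0}" if "u \<in> polynomial_functions C" for u
    unfolding closedin_subvariety[OF VX] by (rule exI[of _ "insert u F"]) (use F that in auto)
  have "\<forall>A B. closedin ?T A \<longrightarrow> closedin ?T B \<longrightarrow> Z = A \<union> B \<longrightarrow> Z = A \<or> Z = B"
    using irr unfolding irreducible_closedin_def by (elim conjE)
  note split = this[rule_format]
  have "Z = {x \<in> V. \<forall>f\<in>insert g F. f x = 0} \<union> {x \<in> V. \<forall>f\<in>insert h F. f x = 0}"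
    using gh F by auto
  from split[OF cl[OF g] cl[OF h] this]
  show ?thesis by blast
qed

text \<open>
  If every piece had a function that vanishes on it but not on \<open>Z\<close>, the product of these functions
  would vanish on \<open>Z\<close>. So one piece is dense, and a polynomial identity on it extends to \<open>Z\<close>.
\<close>

lemma irreducible_closedin_dense_piece:
  fixes C :: "('a \<Rightarrow> 'k::idom) set"
  assumes VX: "V \<subseteq> X" and irr: "irreducible_closedin (subtopology (zariski_topology X C) V) Z"
    and "finite J" and cover: "Z \<subseteq> (\<Union>j\<in>J. W j)"
  shows "\<exists>j\<in>J. \<forall>F\<in>polynomial_functions C. (\<forall>x\<in>Z \<inter> W j. F x = 0) \<longrightarrow> (\<forall>x\<in>Z. F x = 0)"
proof (rule ccontr)
  assume "\<not> ?thesis"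
  then obtain F where F: "\<And>j. j \<in> J \<Longrightarrow> F j \<in> polynomial_functions C"
    "\<And>j x. j \<in> J \<Longrightarrow> x \<in> Z \<inter> W j \<Longrightarrow> F j x = 0" "\<And>j. j \<in> J \<Longrightarrow> \<exists>x\<in>Z. F j x \<noteq> 0"
    by metis
  have ne: "Z \<noteq> {}" using irr by (simp add: irreducible_closedin_def)
  have "\<exists>x\<in>Z. (\<Prod>j\<in>J. F j x) \<noteq> 0"
    using \<open>finite J\<close> F(1,3)
  proof (induction J)
    case empty
    then show ?case using ne by auto
  next
    case (insert j J)
    then have "\<exists>x\<in>Z. F j x \<noteq> 0" "\<exists>x\<in>Z. (\<Prod>j\<in>J. F j x) \<noteq> 0"
      "F j \<in> polynomial_functions C" "(\<lambda>x. \<Prod>j\<in>J. F j x) \<in> polynomial_functions C"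
      by (auto intro: polynomial_functions_prod)
    from irreducible_closedin_prime[OF VX irr this(3,4)] this(1,2) insert.hyps
    show ?case by auto
  qed
  then obtain x where x: "x \<in> Z" "(\<Prod>j\<in>J. F j x) \<noteq> 0" by blast
  then obtain j where "j \<in> J" "x \<in> W j" using cover by blast
  then show False using F(2)[of j x] x \<open>finite J\<close> by (auto simp: prod_zero_iff)
qed

text \<open>
  A chain of length \<open>d + 1\<close> would yield \<open>d + 1\<close> functions on its top member that are algebraically independent.
  On the piece of the cover that is dense in the top member these functions are polynomials in \<open>d\<close>
  parameters, hence dependent.
\<close>

lemma krull_dimension_upper_bound:
  fixes \<phi> :: "'j \<Rightarrow> (nat \<Rightarrow> 'k::field) \<Rightarrow> 'a"
  assumes VX: "V \<subseteq> X" and "finite J" and cover: "V \<subseteq> (\<Union>j\<in>J. range (\<phi> j))"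
    and poly: "\<And>j f. j \<in> J \<Longrightarrow> f \<in> C \<Longrightarrow> (\<lambda>t. f (\<phi> j t)) \<in> polynomial_functions (affine_coords d)"
  shows "krull_dimension (subtopology (zariski_topology X C) V) \<le> enat d"
  unfolding krull_dimension_def
proof (rule Sup_least, clarify)
  let ?T = "subtopology (zariski_topology X C) V"
  fix n and Z :: "nat \<Rightarrow> 'a set"
  assume irr: "\<forall>i\<le>n. irreducible_closedin ?T (Z i)" and strict: "\<forall>i<n. Z i \<subset> Z (Suc i)"
  show "enat n \<le> enat d"
  proof (rule ccontr)
    assume "\<not> enat n \<le> enat d"
    then have n: "Suc d \<le> n" by simp
    have ZV: "\<exists>F \<subseteq> polynomial_functions C. Z i = {x \<in> V. \<forall>f\<in>F. f x = 0}" if "i \<le> n" for i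
      using irr that unfolding irreducible_closedin_def closedin_subvariety[OF VX] by blast
    have "\<exists>f\<in>polynomial_functions C. (\<forall>x\<in>Z i. f x = 0) \<and> (\<exists>x\<in>Z (Suc i). f x \<noteq> 0)" if i: "i < n" for i
    proof -
      obtain F where F: "F \<subseteq> polynomial_functions C" "Z i = {x \<in> V. \<forall>f\<in>F. f x = 0}"
        using ZV[of i] i by auto
      obtain x where "x \<in> Z (Suc i)" "x \<notin> Z i" using strict i by blast
      moreover have "x \<in> V" using ZV[of "Suc i"] i \<open>x \<in> Z (Suc i)\<close> by auto
      ultimately show ?thesis using F by blast
    qed
    then obtain f where f: "\<And>i. i < n \<Longrightarrow> f i \<in> polynomial_functions C"
      "\<And>i x. i < n \<Longrightarrow> x \<in> Z i \<Longrightarrow> f i x = 0" "\<And>i. i < n \<Longrightarrow> \<exists>x\<in>Z (Suc i). f i x \<noteq> 0"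
      by metis
    have irrd: "irreducible_closedin ?T (Z (Suc d))" using irr n by simp
    have "Z (Suc d) \<subseteq> V" using ZV[OF n] by auto
    then have "Z (Suc d) \<subseteq> (\<Union>j\<in>J. range (\<phi> j))" using cover by blast
    from irreducible_closedin_dense_piece[OF VX irrd \<open>finite J\<close> this]
    obtain j where j: "j \<in> J" and dense: "\<And>F. F \<in> polynomial_functions C \<Longrightarrow>
      (\<And>x. x \<in> Z (Suc d) \<inter> range (\<phi> j) \<Longrightarrow> F x = 0) \<Longrightarrow> (\<forall>x\<in>Z (Suc d). F x = 0)"
      by blast
    have "(\<lambda>t. f i (\<phi> j t)) \<in> polynomial_functions (affine_coords d)" if "i \<le> d" for i
      by (rule polynomial_functions_pullback[OF f(1)]) (use poly[OF j] n that in auto)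
    from polynomials_algebraically_dependent[of d "\<lambda>i t. f i (\<phi> j t)", OF this]
    obtain N c e where c: "e \<in> {..<Suc d} \<rightarrow>\<^sub>E {..<N}" "c e \<noteq> 0"
      "\<And>t. (\<Sum>e \<in> {..<Suc d} \<rightarrow>\<^sub>E {..<N}. c e * (\<Prod>i<Suc d. f i (\<phi> j t) ^ e i)) = 0"
      by blast
    define R where "R x = (\<Sum>e \<in> {..<Suc d} \<rightarrow>\<^sub>E {..<N}. c e * (\<Prod>i<Suc d. f i x ^ e i))" for x
    have "R \<in> polynomial_functions C"
      unfolding R_def using f(1) n by (intro polynomial_functions_intros) auto
    moreover have "R x = 0" if "x \<in> Z (Suc d) \<inter> range (\<phi> j)" for x
      using that c(3) unfolding R_def by auto
    ultimately have R0: "\<forall>x\<in>Z (Suc d). R x = 0" by (rule dense)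
    have Z0: "Z 0 \<noteq> {}" using irr by (auto simp: irreducible_closedin_def)
    have prime: "(\<forall>x\<in>Z i. g x = 0) \<or> (\<forall>x\<in>Z i. h x = 0)"
      if "i \<le> Suc d" "g \<in> polynomial_functions C" "h \<in> polynomial_functions C"
        "\<forall>x\<in>Z i. g x * h x = 0" for i g h
      using irreducible_closedin_prime[OF VX, of C "Z i" g h] irr n that by auto
    have mono: "Z i \<subseteq> Z (Suc i)" if "i < Suc d" for i using strict n that by (meson less_le_trans psubsetE)
    have rel: "(\<Sum>e \<in> {..<Suc d} \<rightarrow>\<^sub>E {..<N}. c e * (\<Prod>i<Suc d. f i x ^ e i)) = 0" if "x \<in> Z (Suc d)" for x
      using R0 that unfolding R_def by (rule bspec)
    have less: "i < n" if "i < Suc d" for i using that n by (rule less_le_trans)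
    have "c e = 0"
      by (rule monomials_independent_on_chain[where n = "Suc d" and C = C and Z = Z and f = f and N = N and c = c and e = e,
            OF prime Z0 mono f(1)[OF less] f(2)[OF less] f(3)[OF less] rel c(1)])
    then show False using c(2) by simp
  qed
qed

section \<open>The symplectic form on four-space\<close>

lemma all_less_4_iff: "(\<forall>i<4. P i) \<longleftrightarrow> P 0 \<and> P 1 \<and> P 2 \<and> P (3::nat)"
  by (auto simp: less_Suc_eq numeral_eq_Suc)

lemma less_4_cases:
  assumes "(i::nat) < 4"
  obtains "i = 0" | "i = 1" | "i = 2" | "i = 3"
  using assms by linarith

lemma less_4_simps: "(0::nat) < 4" "(1::nat) < 4" "(2::nat) < 4" "(3::nat) < 4"
  by simp_all

lemma sum_less_4: "(\<Sum>i<4. f i) = f 0 + f 1 + f 2 + f (3::nat)"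
  by (simp add: numeral_eq_Suc)

lemma index_mult_mat4:
  fixes A B :: "'k::comm_ring_1 mat"
  assumes "A \<in> carrier_mat 4 4" "B \<in> carrier_mat 4 4" "i < 4" "j < 4"
  shows "(A * B) $$ (i, j) =
    A $$ (i, 0) * B $$ (0, j) + A $$ (i, 1) * B $$ (1, j) + A $$ (i, 2) * B $$ (2, j) + A $$ (i, 3) * B $$ (3, j)"
proof -
  have "(A * B) $$ (i, j) = (\<Sum>m<4. A $$ (i, m) * B $$ (m, j))"
    using assms by (auto simp: scalar_prod_def atLeast0LessThan intro!: sum.cong)
  then show ?thesis by (simp add: sum_less_4)
qed

lemma mat4_eqI:
  assumes "A \<in> carrier_mat 4 4" "B \<in> carrier_mat 4 4"
    and "\<And>i m. i < 4 \<Longrightarrow> m < 4 \<Longrightarrow> A $$ (i, m) = B $$ (i, m)"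
  shows "A = B"
  by (rule eq_matI) (use assms in auto)

lemma mat4_eq_0_iff:
  assumes "A \<in> carrier_mat 4 4"
  shows "A = 0\<^sub>m 4 4 \<longleftrightarrow> (\<forall>i<4. \<forall>m<4. A $$ (i, m) = 0)"
  using assms mat4_eqI[of A "0\<^sub>m 4 4"] by auto

lemma mat4_nonzero_entry:
  assumes "A \<in> carrier_mat 4 4" "A \<noteq> 0\<^sub>m 4 4"
  obtains i j where "i < 4" "j < 4" "A $$ (i, j) \<noteq> 0"
  using assms mat4_eqI[of A "0\<^sub>m 4 4"] by fastforce

text \<open>
  Vectors of four-space are functions on \<^typ>\<open>nat\<close> of which only the values below \<open>4\<close> matter; this avoids
  carrier conditions in linear combinations. The form is \<open>omega u v = u\<^sup>T S v\<close> for the matrix \<open>S\<close> defining \<open>sp4\<close>.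
\<close>

definition omega :: "(nat \<Rightarrow> 'k::comm_ring_1) \<Rightarrow> (nat \<Rightarrow> 'k) \<Rightarrow> 'k" where
  "omega u v = u 0 * v 3 + u 1 * v 2 - u 2 * v 1 - u 3 * v 0"

text \<open>
  The coordinates of the linear form \<open>omega u\<close>; so the matrix with entries \<open>u i * flat v m\<close> is the
  endomorphism that maps \<open>z\<close> to \<open>omega v z\<close> times \<open>u\<close>.
\<close>

definition flat :: "(nat \<Rightarrow> 'k::comm_ring_1) \<Rightarrow> nat \<Rightarrow> 'k" where
  "flat u m = (if m = 0 then - u 3 else if m = 1 then - u 2 else if m = 2 then u 1 else u 0)"

lemma flat_simps [simp]: "flat u 0 = - u 3" "flat u 1 = - u 2" "flat u (Suc 0) = - u 2"
  "flat u 2 = u 1" "flat u 3 = u 0"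
  by (simp_all add: flat_def)

definition linear_comb :: "'k::comm_ring_1 \<Rightarrow> (nat \<Rightarrow> 'k) \<Rightarrow> 'k \<Rightarrow> (nat \<Rightarrow> 'k) \<Rightarrow> nat \<Rightarrow> 'k" where
  "linear_comb s u t v i = s * u i + t * v i"

lemma omega_linear_comb: "omega (linear_comb s u t v) w = s * omega u w + t * omega v w"
  by (simp add: omega_def linear_comb_def algebra_simps)

lemma flat_linear_comb: "flat (linear_comb s u t v) m = s * flat u m + t * flat v m"
  by (simp add: flat_def linear_comb_def)

definition column :: "'k mat \<Rightarrow> nat \<Rightarrow> nat \<Rightarrow> 'k" where
  "column A j i = A $$ (i, j)"

lemma omega_skew: "omega v u = - omega u v"
  by (simp add: omega_def algebra_simps)

lemma omega_self [simp]: "omega u u = 0"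
  by (simp add: omega_def algebra_simps)

lemma sp4_form_carrier [simp]: "sp4_form \<in> carrier_mat 4 4"
  by (rule carrier_matI) (simp_all add: sp4_form_eq mat_of_rows_list_def)

lemma sp4_form_entry:
  assumes "i < 4" "j < 4"
  shows "sp4_form $$ (i, j) = (if i + j = 3 then if i < 2 then 1 else - 1 else 0)"
  using assms by (elim less_4_cases) (simp_all add: sp4_form_eq mat_of_rows_list_def)

lemma sp4_iff:
  "(x :: 'k::comm_ring_1 mat) \<in> sp4 \<longleftrightarrow> x \<in> carrier_mat 4 4 \<and>
    x $$ (3, 1) = x $$ (2, 0) \<and> x $$ (3, 2) = - x $$ (1, 0) \<and> x $$ (3, 3) = - x $$ (0, 0) \<and>
    x $$ (2, 2) = - x $$ (1, 1) \<and> x $$ (2, 3) = - x $$ (0, 1) \<and> x $$ (1, 3) = x $$ (0, 2)"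
proof (cases "x \<in> carrier_mat 4 4")
  case True
  let ?L = "x\<^sup>T * sp4_form + sp4_form * x"
  have "?L = 0\<^sub>m 4 4 \<longleftrightarrow> (\<forall>i<4. \<forall>m<4. ?L $$ (i, m) = 0)"
    using True by (intro mat4_eq_0_iff add_carrier_mat mult_carrier_mat[of _ 4 4]) auto
  also have "\<dots> \<longleftrightarrow> x $$ (3, 1) = x $$ (2, 0) \<and> x $$ (3, 2) = - x $$ (1, 0) \<and> x $$ (3, 3) = - x $$ (0, 0) \<and>
    x $$ (2, 2) = - x $$ (1, 1) \<and> x $$ (2, 3) = - x $$ (0, 1) \<and> x $$ (1, 3) = x $$ (0, 2)"
    using True carrier_matD[OF True] carrier_matD[OF sp4_form_carrier[where 'a = 'k]]
    by (simp add: all_less_4_iff index_mult_mat4 sp4_form_entry del: index_mult_mat(1)) auto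
  finally show ?thesis using True by (simp add: sp4_def)
qed (simp add: sp4_def)

lemma sp4_carrier: "x \<in> sp4 \<Longrightarrow> x \<in> carrier_mat 4 4"
  by (simp add: sp4_iff)

text \<open>
  Elements of \<open>sp4\<close> are skew for the form. The vectors are written as columns of matrices, so that powers of \<open>x\<close> can be
  moved across by matrix multiplication.
\<close>

lemma omega_sp4:
  fixes x A B :: "'k::comm_ring_1 mat"
  assumes "x \<in> sp4" "A \<in> carrier_mat 4 4" "B \<in> carrier_mat 4 4" "a < 4" "b < 4"
  shows "omega (column (x * A) a) (column B b) = - omega (column A a) (column (x * B) b)"
  using assms unfolding sp4_iff omega_def column_def
  by (simp add: index_mult_mat4 del: index_mult_mat(1)) (simp add: algebra_simps)

lemma flat_eq_omega:
  assumes "m < 4"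
  shows "omega u (column (1\<^sub>m 4) m) = flat u m"
  using assms by (elim less_4_cases) (simp_all add: omega_def column_def)

lemma sum_flat: "flat u 0 * v 0 + flat u 1 * v 1 + flat u 2 * v 2 + flat u 3 * v 3 = omega u v"
  by (simp add: omega_def algebra_simps)

text \<open>
  The hypothesis says that the matrix with rows \<open>flat (b' a)\<close> is a left inverse of the matrix with columns
  \<open>b c\<close>; the conclusion is that it is also a right inverse. This replaces every argument about bases: four vectors with
  a known dual family span the space, with explicit coordinates.
\<close>

lemma dual_frame:
  fixes b b' :: "nat \<Rightarrow> nat \<Rightarrow> 'k::field"
  assumes "\<And>a c. a < 4 \<Longrightarrow> c < 4 \<Longrightarrow> omega (b' a) (b c) = (if a = c then 1 else 0)"
    and "i < 4" "m < 4"
  shows "b 0 i * flat (b' 0) m + b 1 i * flat (b' 1) m + b 2 i * flat (b' 2) m + b 3 i * flat (b' 3) m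
    = (if i = m then 1 else 0)"
proof -
  define P where "P = mat 4 4 (\<lambda>(i, a). b a i)"
  define Q where "Q = mat 4 4 (\<lambda>(a, m). flat (b' a) m)"
  have PQ: "P \<in> carrier_mat 4 4" "Q \<in> carrier_mat 4 4" by (auto simp: P_def Q_def)
  have "Q * P = 1\<^sub>m 4"
  proof (rule mat4_eqI)
    fix a c :: nat assume "a < 4" "c < 4"
    then have "(Q * P) $$ (a, c) = omega (b' a) (b c)"
      using PQ by (simp add: index_mult_mat4 del: index_mult_mat(1)) (simp add: P_def Q_def omega_def algebra_simps)
    then show "(Q * P) $$ (a, c) = 1\<^sub>m 4 $$ (a, c)"
      using assms(1) \<open>a < 4\<close> \<open>c < 4\<close> by simp
  qed (use PQ in auto)
  then have "P * Q = 1\<^sub>m 4"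
    using mat_mult_left_right_inverse PQ by blast
  then have "(P * Q) $$ (i, m) = (if i = m then 1 else 0)"
    using assms by simp
  moreover have "P $$ (i, a) = b a i" "Q $$ (a, m) = flat (b' a) m" if "a < 4" for a
    using assms that by (simp_all add: P_def Q_def)
  ultimately show ?thesis
    by (simp only: index_mult_mat4[OF PQ assms(2,3)] less_4_simps)
qed

lemma vector_in_dual_frame:
  fixes b b' :: "nat \<Rightarrow> nat \<Rightarrow> 'k::field"
  assumes dual: "\<And>a c. a < 4 \<Longrightarrow> c < 4 \<Longrightarrow> omega (b' a) (b c) = (if a = c then 1 else 0)"
    and i: "i < 4"
  shows "z i = b 0 i * omega (b' 0) z + b 1 i * omega (b' 1) z + b 2 i * omega (b' 2) z + b 3 i * omega (b' 3) z"
proof -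
  let ?E = "\<lambda>m. b 0 i * flat (b' 0) m + b 1 i * flat (b' 1) m + b 2 i * flat (b' 2) m + b 3 i * flat (b' 3) m"
  have "b 0 i * omega (b' 0) z + b 1 i * omega (b' 1) z + b 2 i * omega (b' 2) z + b 3 i * omega (b' 3) z
    = ?E 0 * z 0 + ?E 1 * z 1 + ?E 2 * z 2 + ?E 3 * z 3"
    unfolding sum_flat[symmetric] by (simp only: algebra_simps)
  also have "\<dots> = z i"
    using i by (simp only: dual_frame[of b' b i, OF dual i] less_4_simps) (elim less_4_cases, simp_all)
  finally show ?thesis by simp
qed

lemma matrix_in_dual_frame:
  fixes b b' :: "nat \<Rightarrow> nat \<Rightarrow> 'k::field"
  assumes dual: "\<And>a c. a < 4 \<Longrightarrow> c < 4 \<Longrightarrow> omega (b' a) (b c) = (if a = c then 1 else 0)"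
    and x: "x \<in> carrier_mat 4 4"
    and B: "\<And>a. a < 4 \<Longrightarrow> B a \<in> carrier_mat 4 4 \<and> col_ix a < 4 \<and> b a = column (B a) (col_ix a)"
    and i: "i < 4" "m < 4"
  shows "x $$ (i, m) = column (x * B 0) (col_ix 0) i * flat (b' 0) m + column (x * B 1) (col_ix 1) i * flat (b' 1) m
    + column (x * B 2) (col_ix 2) i * flat (b' 2) m + column (x * B 3) (col_ix 3) i * flat (b' 3) m"
proof -
  have xb: "column (x * B a) (col_ix a) i = x $$ (i, 0) * b a 0 + x $$ (i, 1) * b a 1 + x $$ (i, 2) * b a 2 + x $$ (i, 3) * b a 3"
    if "a < 4" for a
    using B[OF that] x i by (simp add: column_def index_mult_mat4 del: index_mult_mat(1))
  let ?E = "\<lambda>i. b 0 i * flat (b' 0) m + b 1 i * flat (b' 1) m + b 2 i * flat (b' 2) m + b 3 i * flat (b' 3) m"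
  have "column (x * B 0) (col_ix 0) i * flat (b' 0) m + column (x * B 1) (col_ix 1) i * flat (b' 1) m
    + column (x * B 2) (col_ix 2) i * flat (b' 2) m + column (x * B 3) (col_ix 3) i * flat (b' 3) m
    = x $$ (i, 0) * ?E 0 + x $$ (i, 1) * ?E 1 + x $$ (i, 2) * ?E 2 + x $$ (i, 3) * ?E 3"
    by (simp add: xb) (simp only: algebra_simps)
  also have "\<dots> = x $$ (i, m)"
    using i(2) by (simp only: dual_frame[of b' b _ m, OF dual _ i(2)] less_4_simps) (elim less_4_cases, simp_all)
  finally show ?thesis by simp
qed

section \<open>Nilpotent elements of the symplectic Lie algebra\<close>

text \<open>
  For \<open>y = x\<^sup>2\<close> the form \<open>omega (y u) v\<close> is alternating. An alternating form in dimension four has a Pfaffian, and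
  accordingly \<open>y\<close> is a root of a polynomial of degree two instead of four.
\<close>

lemma square_of_sp4_quadratic:
  fixes x :: "'k::comm_ring_1 mat"
  assumes x: "x \<in> sp4"
  shows "\<exists>t f. (x * x) * (x * x) = t \<cdot>\<^sub>m (x * x) + f \<cdot>\<^sub>m 1\<^sub>m 4"
proof -
  define y where "y = x * x"
  have c: "x \<in> carrier_mat 4 4" "y \<in> carrier_mat 4 4" using x by (auto simp: y_def sp4_iff)
  have y: "y $$ (3, 0) = 0 \<and> y $$ (2, 1) = 0 \<and> y $$ (1, 2) = 0 \<and> y $$ (0, 3) = 0 \<and>
    y $$ (3, 1) = - y $$ (2, 0) \<and> y $$ (3, 2) = y $$ (1, 0) \<and> y $$ (3, 3) = y $$ (0, 0) \<and>
    y $$ (2, 2) = y $$ (1, 1) \<and> y $$ (2, 3) = y $$ (0, 1) \<and> y $$ (1, 3) = - y $$ (0, 2)"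
    using x unfolding y_def sp4_iff by (simp add: index_mult_mat4 algebra_simps del: index_mult_mat(1))
  define t where "t = y $$ (0, 0) + y $$ (1, 1)"
  define f where "f = y $$ (0, 1) * y $$ (1, 0) + y $$ (0, 2) * y $$ (2, 0) - y $$ (0, 0) * y $$ (1, 1)"
  have "y * y = t \<cdot>\<^sub>m y + f \<cdot>\<^sub>m 1\<^sub>m 4"
  proof (rule mat4_eqI)
    fix i m :: nat assume "i < 4" "m < 4"
    then show "(y * y) $$ (i, m) = (t \<cdot>\<^sub>m y + f \<cdot>\<^sub>m 1\<^sub>m 4) $$ (i, m)"
      using c y by (elim less_4_cases) (simp_all add: index_mult_mat4 t_def f_def algebra_simps del: index_mult_mat(1))
  qed (use c in auto)
  then show ?thesis unfolding y_def by blast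
qed

lemma quadratic_nilpotent_square_zero:
  fixes y :: "'k::field mat"
  assumes y: "y \<in> carrier_mat 4 4" and quad: "y * y = t \<cdot>\<^sub>m y + f \<cdot>\<^sub>m 1\<^sub>m 4"
    and nil: "y ^\<^sub>m n = 0\<^sub>m 4 4"
  shows "y * y = 0\<^sub>m 4 4"
proof -
  have pc: "y ^\<^sub>m k \<in> carrier_mat 4 4" for k using y by simp
  have rec: "y ^\<^sub>m Suc (Suc k) = t \<cdot>\<^sub>m y ^\<^sub>m Suc k + f \<cdot>\<^sub>m y ^\<^sub>m k" for k
  proof -
    have "y ^\<^sub>m Suc (Suc k) = y ^\<^sub>m k * (y * y)" using y pc[of k] by (simp add: assoc_mult_mat[of "y ^\<^sub>m k" 4 4 y 4 y 4])
    also have "\<dots> = t \<cdot>\<^sub>m (y ^\<^sub>m k * y) + f \<cdot>\<^sub>m y ^\<^sub>m k"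
      unfolding quad using y pc[of k]
      by (simp add: mult_add_distrib_mat[of _ 4 4 _ 4] mult_smult_distrib[of "y ^\<^sub>m k" 4 4 _ 4])
    finally show ?thesis by simp
  qed
  have f0: "f = 0"
  proof (rule ccontr)
    assume f: "f \<noteq> 0"
    have "y ^\<^sub>m k = 0\<^sub>m 4 4 \<Longrightarrow> False" for k
    proof (induction k)
      case 0
      then have "(1\<^sub>m 4 :: 'k mat) $$ (0, 0) = 0" using y by simp
      then show ?case by simp
    next
      case (Suc k)
      have "y ^\<^sub>m Suc (Suc k) = 0\<^sub>m 4 4" using Suc.prems y by simp
      then have "(t \<cdot>\<^sub>m y ^\<^sub>m Suc k + f \<cdot>\<^sub>m y ^\<^sub>m k) = 0\<^sub>m 4 4" unfolding rec .
      then have e: "f \<cdot>\<^sub>m y ^\<^sub>m k = 0\<^sub>m 4 4" unfolding Suc.prems using pc[of k] by simp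
      have "y ^\<^sub>m k = 0\<^sub>m 4 4"
      proof (rule mat4_eqI)
        fix i m :: nat assume im: "i < 4" "m < 4"
        have "(f \<cdot>\<^sub>m y ^\<^sub>m k) $$ (i, m) = 0" unfolding e using im by simp
        then show "(y ^\<^sub>m k) $$ (i, m) = 0\<^sub>m 4 4 $$ (i, m)" using im carrier_matD[OF pc[of k]] f by simp
      qed (use pc in auto)
      then show ?case by (rule Suc.IH)
    qed
    then show False using nil by blast
  qed
  have yy: "y * y = t \<cdot>\<^sub>m y" unfolding quad f0 using y by auto
  show ?thesis
  proof (cases "t = 0")
    case True
    then show ?thesis unfolding yy using y by auto
  next
    case False
    have "y ^\<^sub>m Suc k = (t ^ k) \<cdot>\<^sub>m y" for k
    proof (induction k)
      case 0
      show ?case using y by auto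
    next
      case (Suc k)
      have "y ^\<^sub>m Suc (Suc k) = (t ^ k \<cdot>\<^sub>m y) * y" using Suc.IH by simp
      also have "\<dots> = t ^ k \<cdot>\<^sub>m (t \<cdot>\<^sub>m y)" unfolding yy[symmetric] using y by (simp add: mult_smult_assoc_mat[OF y y])
      finally show ?case by (intro eq_matI) (simp_all add: mult.commute mult.left_commute)
    qed
    moreover have "n \<noteq> 0"
    proof
      assume "n = 0"
      then have "(1\<^sub>m 4 :: 'k mat) $$ (0, 0) = 0" using nil y by simp
      then show False by simp
    qed
    ultimately have e: "(t ^ (n - 1)) \<cdot>\<^sub>m y = 0\<^sub>m 4 4" using nil by (cases n) auto
    have "y = 0\<^sub>m 4 4"
    proof (rule mat4_eqI)
      fix i m :: nat assume im: "i < 4" "m < 4"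
      have "(t ^ (n - 1) \<cdot>\<^sub>m y) $$ (i, m) = 0" unfolding e using im by simp
      then show "y $$ (i, m) = 0\<^sub>m 4 4 $$ (i, m)" using im y False by simp
    qed (use y in auto)
    then show ?thesis by simp
  qed
qed

text \<open>
  The square of \<open>x\<close> is nilpotent and satisfies a quadratic equation, so its square vanishes.
\<close>

lemma sp4_nilpotent_fourth_power:
  fixes x :: "'k::field mat"
  assumes x: "x \<in> sp4" and nil: "x ^\<^sub>m p = 0\<^sub>m 4 4"
  shows "(x * x) * (x * x) = 0\<^sub>m 4 4"
proof -
  have c: "x \<in> carrier_mat 4 4" using x by (rule sp4_carrier)
  have comm: "x * x ^\<^sub>m n = x ^\<^sub>m n * x" for n
  proof (induction n)
    case (Suc n)
    have "x * (x ^\<^sub>m n * x) = x * x ^\<^sub>m n * x"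
      using c by (simp add: assoc_mult_mat[of x 4 4 "x ^\<^sub>m n" 4 x 4])
    then show ?case using Suc.IH by simp
  qed (use c in simp)
  have pow: "(x * x) ^\<^sub>m n = x ^\<^sub>m n * x ^\<^sub>m n" for n
  proof (induction n)
    case (Suc n)
    let ?z = "x ^\<^sub>m n"
    have z: "?z \<in> carrier_mat 4 4" using c by simp
    have "?z * ?z * (x * x) = ?z * (?z * x * x)"
      using c z by (simp add: assoc_mult_mat[of _ 4 4 _ 4 _ 4])
    also have "\<dots> = ?z * (x * ?z * x)" by (simp add: comm)
    also have "\<dots> = ?z * x * (?z * x)"
      using c z mult_carrier_mat[OF z c]
      by (simp add: assoc_mult_mat[of x 4 4 ?z 4 x 4] assoc_mult_mat[of ?z 4 4 x 4 "?z * x" 4])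
    finally show ?case using Suc.IH by simp
  qed (use c in simp)
  obtain t f where "(x * x) * (x * x) = t \<cdot>\<^sub>m (x * x) + f \<cdot>\<^sub>m 1\<^sub>m 4"
    using square_of_sp4_quadratic[OF x] by blast
  moreover have "(x * x) ^\<^sub>m p = 0\<^sub>m 4 4" unfolding pow nil by simp
  ultimately show ?thesis using quadratic_nilpotent_square_zero[of "x * x" t f p] c by auto
qed

text \<open>
  Suppose \<open>y = x\<^sup>2 \<noteq> 0\<close>, say \<open>omega e\<^sub>a (y e\<^sub>b) = \<tau> \<noteq> 0\<close>. Since \<open>omega u (y u) = - omega (x u) (x u) = 0\<close> and
  \<open>x\<^sup>3 = 0\<close>, the Gram matrix of \<open>e\<^sub>a, e\<^sub>b, y e\<^sub>a, y e\<^sub>b\<close> is known and invertible, so these vectors are a basis.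
  As \<open>x\<close> kills the last two, expanding \<open>x\<close> in this basis shows that \<open>x z\<close> depends only on the pairings of \<open>z\<close> with
  \<open>y e\<^sub>a\<close> and \<open>y e\<^sub>b\<close>. These pairings vanish on the image of \<open>x\<close>, so \<open>x\<^sup>2 = 0\<close> after all.
\<close>

lemma sp4_cube_zero_square_zero:
  fixes x :: "'k::field mat"
  assumes x: "x \<in> sp4" and cube: "x * (x * x) = 0\<^sub>m 4 4"
  shows "x * x = 0\<^sub>m 4 4"
proof (rule ccontr)
  let ?y = "x * x" and ?I = "1\<^sub>m 4 :: 'k mat"
  assume "?y \<noteq> 0\<^sub>m 4 4"
  have c [simp]: "x \<in> carrier_mat 4 4" using x by (rule sp4_carrier)
  then obtain i b where ib: "i < 4" "b < 4" "?y $$ (i, b) \<noteq> 0"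
    using \<open>?y \<noteq> 0\<^sub>m 4 4\<close> mat4_nonzero_entry[of ?y] mult_carrier_mat[OF c c] by blast
  define a where "a = 3 - i"
  have a: "a < 4" by (simp add: a_def)
  define b0 b1 b2 b3 where "b0 = column ?I a" and "b1 = column ?I b" and "b2 = column ?y a" and "b3 = column ?y b"
  note bd = b0_def b1_def b2_def b3_def
  define \<tau> \<sigma> where "\<tau> = omega b0 b3" and "\<sigma> = omega b0 b1"
  have xy: "omega (column ?I u) (column ?y v) = - omega (column x u) (column x v)" if "u < 4" "v < 4" for u v
    using omega_sp4[OF x, of ?I x u v] that by (simp add: right_mult_one_mat[OF c])
  have yI: "omega (column ?I u) (column ?y v) = - omega (column ?I v) (column ?y u)" if "u < 4" "v < 4" for u v
    using xy[OF that] xy[OF that(2,1)] omega_skew by metis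
  have yy: "omega (column ?y u) (column ?y v) = 0" if "u < 4" "v < 4" for u v
    using omega_sp4[OF x, of x ?y u v] that cube mult_carrier_mat[OF c c] by (simp add: omega_def column_def)
  have "flat (column ?y b) a \<noteq> 0"
    using ib by (elim less_4_cases) (simp_all add: a_def column_def)
  then have \<tau>0: "\<tau> \<noteq> 0"
    unfolding \<tau>_def bd using flat_eq_omega[OF a, of "column ?y b"] omega_skew by (metis neg_equal_0_iff_equal)
  have g: "omega b0 b0 = 0" "omega b0 b1 = \<sigma>" "omega b0 b2 = 0" "omega b0 b3 = \<tau>"
    "omega b1 b0 = -\<sigma>" "omega b1 b1 = 0" "omega b1 b2 = -\<tau>" "omega b1 b3 = 0"
    "omega b2 b0 = 0" "omega b2 b1 = \<tau>" "omega b2 b2 = 0" "omega b2 b3 = 0"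
    "omega b3 b0 = -\<tau>" "omega b3 b1 = 0" "omega b3 b2 = 0" "omega b3 b3 = 0"
  proof -
    show "omega b0 b1 = \<sigma>" "omega b0 b3 = \<tau>" by (simp_all add: \<sigma>_def \<tau>_def)
    show t: "omega b1 b2 = -\<tau>" using yI[of b a] a ib by (simp add: bd \<tau>_def)
    show s: "omega b0 b2 = 0" "omega b1 b3 = 0" using xy[of a a] xy[of b b] a ib by (simp_all add: bd)
    show "omega b2 b3 = 0" "omega b3 b2 = 0" using yy a ib by (simp_all add: bd)
    show "omega b2 b1 = \<tau>" "omega b1 b0 = -\<sigma>" "omega b3 b0 = -\<tau>" "omega b2 b0 = 0" "omega b3 b1 = 0"
      using t s omega_skew[of b2 b1] omega_skew[of b1 b0] omega_skew[of b3 b0] omega_skew[of b2 b0] omega_skew[of b3 b1]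
      by (simp_all add: \<sigma>_def \<tau>_def)
  qed simp_all
  define bb where "bb = (\<lambda>n::nat. if n = 0 then b0 else if n = 1 then b1 else if n = 2 then b2 else b3)"
  define dd where "dd = (\<lambda>n::nat. if n = 0 then linear_comb (- 1 / \<tau>) b3 0 b3 else if n = 1 then linear_comb (1 / \<tau>) b2 0 b2
     else if n = 2 then linear_comb (- 1 / \<tau>) b1 (\<sigma> / \<tau>\<^sup>2) b3 else linear_comb (1 / \<tau>) b0 (- \<sigma> / \<tau>\<^sup>2) b2)"
  have dual: "omega (dd n) (bb m) = (if n = m then 1 else 0)" if "n < 4" "m < 4" for n m
    using that by (elim less_4_cases) (simp_all add: dd_def bb_def omega_linear_comb g \<tau>0 power2_eq_square)
  define BB where "BB = (\<lambda>n::nat. if n = 0 \<or> n = 1 then ?I else ?y)"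
  define cc where "cc = (\<lambda>n::nat. if n = 0 \<or> n = 2 then a else b)"
  have BB: "BB n \<in> carrier_mat 4 4 \<and> cc n < 4 \<and> bb n = column (BB n) (cc n)" if "n < 4" for n
    using that a ib(2) mult_carrier_mat[OF c c] by (elim less_4_cases) (auto simp: BB_def cc_def bb_def bd)
  have x_eq: "x $$ (j, m) = column x a j * (- flat b3 m / \<tau>) + column x b j * (flat b2 m / \<tau>)" if "j < 4" "m < 4" for j m
    using matrix_in_dual_frame[of dd bb x BB cc j m, OF dual c BB that]
    by (simp add: BB_def cc_def cube right_mult_one_mat[OF c]) (use a ib(2) that in \<open>simp add: dd_def flat_linear_comb column_def\<close>)
  have kill: "omega b3 (column x m) = 0" "omega b2 (column x m) = 0" if "m < 4" for m
  proof -
    have z: "omega (column (x * ?y) u) v = 0" if "u < 4" for u v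
      unfolding cube using that by (simp add: omega_def column_def)
    have "omega (column ?y u) (column x m) = 0" if "u < 4" for u
      using omega_sp4[OF x, of ?y ?I u m] that \<open>m < 4\<close> mult_carrier_mat[OF c c] z[OF that]
      by (simp add: right_mult_one_mat[OF c])
    then show "omega b3 (column x m) = 0" "omega b2 (column x m) = 0"
      using a ib(2) by (simp_all add: bd)
  qed
  have "?y $$ (j, m) = 0" if "j < 4" "m < 4" for j m
  proof -
    have "?y $$ (j, m) = column x a j * (- omega b3 (column x m) / \<tau>) + column x b j * (omega b2 (column x m) / \<tau>)"
      unfolding sum_flat[symmetric]
      unfolding index_mult_mat4[OF c c that] x_eq[OF that(1) less_4_simps(1)] x_eq[OF that(1) less_4_simps(2)]
        x_eq[OF that(1) less_4_simps(3)] x_eq[OF that(1) less_4_simps(4)] column_def[of x m]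
      using \<tau>0 by (simp add: field_simps)
    then show ?thesis using kill[OF that(2)] by simp
  qed
  then show False using ib by blast
qed

text \<open>
  Polarization: \<open>x + y\<close> has cube zero as well, so its square \<open>2 x y\<close> vanishes.
\<close>

lemma sp4_commuting_cubes_zero_products_zero:
  fixes x y :: "'k::field mat"
  assumes x: "x \<in> sp4" and y: "y \<in> sp4" and comm: "x * y = y * x" and two: "(2::'k) \<noteq> 0"
    and x3: "x * (x * x) = 0\<^sub>m 4 4" and y3: "y * (y * y) = 0\<^sub>m 4 4"
  shows "x * y = 0\<^sub>m 4 4"
proof -
  have c [simp]: "x \<in> carrier_mat 4 4" "y \<in> carrier_mat 4 4" using x y by (auto intro: sp4_carrier)
  have x2: "x * x = 0\<^sub>m 4 4" and y2: "y * y = 0\<^sub>m 4 4"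
    using sp4_cube_zero_square_zero x y x3 y3 by auto
  have s: "x + y \<in> sp4" using x y c[THEN carrier_matD(1)] c[THEN carrier_matD(2)] by (simp add: sp4_iff)
  have sq: "(x + y) * (x + y) = x * y + x * y"
    using x2 y2 comm mult_carrier_mat[OF c(2) c(1)] by (simp add: add_mult_distrib_mat[of _ 4 4 _ _ 4] mult_add_distrib_mat[of _ 4 4 _ 4])
  have xxy: "x * (x * y) = 0\<^sub>m 4 4" using x2 by (simp add: left_mult_zero_mat[OF c(2)] flip: assoc_mult_mat[of x 4 4 x 4 y 4])
  have yxy: "y * (x * y) = 0\<^sub>m 4 4" using y2 by (simp add: comm left_mult_zero_mat[OF c(1)] flip: assoc_mult_mat[of y 4 4 y 4 x 4])
  have "(x + y) * ((x + y) * (x + y)) = 0\<^sub>m 4 4"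
    unfolding sq using mult_carrier_mat[OF c] add_carrier_mat[OF c(2), of x]
    by (simp add: mult_add_distrib_mat[of "x + y" 4 4 "x * y" 4 "x * y"]
        add_mult_distrib_mat[of x 4 4 y "x * y" 4] xxy yxy)
  then have z: "x * y + x * y = 0\<^sub>m 4 4" using sp4_cube_zero_square_zero[OF s] sq by simp
  show ?thesis
  proof (rule mat4_eqI)
    fix i m :: nat assume im: "i < 4" "m < 4"
    have "(x * y + x * y) $$ (i, m) = 0" unfolding z using im by simp
    then have "2 * (x * y) $$ (i, m) = 0" using im c by (simp del: index_mult_mat(1))
    then show "(x * y) $$ (i, m) = 0\<^sub>m 4 4 $$ (i, m)" using two im by simp
  qed (use mult_carrier_mat[OF c] in auto)
qed

section \<open>Regular nilpotent elements\<close>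

lemma column_mult_linear_comb:
  assumes "x \<in> carrier_mat 4 4" "A \<in> carrier_mat 4 4" "B \<in> carrier_mat 4 4" "C \<in> carrier_mat 4 4"
    and "a < 4" "b < 4" "c < 4"
    and "\<And>j. j < 4 \<Longrightarrow> column A a j = linear_comb s (column B b) t (column C c) j" and "i < 4"
  shows "column (x * A) a i = linear_comb s (column (x * B) b) t (column (x * C) c) i"
proof -
  have A: "A $$ (j, a) = s * B $$ (j, b) + t * C $$ (j, c)" if "j < 4" for j
    using assms(8)[OF that] by (simp add: column_def linear_comb_def)
  show ?thesis
    unfolding column_def linear_comb_def index_mult_mat4[OF assms(1,2,9,5)] index_mult_mat4[OF assms(1,3,9,6)]
      index_mult_mat4[OF assms(1,4,9,7)] A[OF less_4_simps(1)] A[OF less_4_simps(2)] A[OF less_4_simps(3)] A[OF less_4_simps(4)]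
    by (simp add: algebra_simps)
qed

text \<open>
  Under the identification of \<open>sp4\<close> with the symmetric square of four-space this is \<open>2 f \<cdot> g + h \<cdot> h\<close>. If \<open>g\<close> and \<open>h\<close>
  are orthogonal to \<open>f\<close>, it is nilpotent, and it maps \<open>g\<close> to the span of \<open>h\<close>, \<open>h\<close> to the span of \<open>f\<close>, and \<open>f\<close> to \<open>0\<close>.
\<close>

definition sym_nilpotent :: "(nat \<Rightarrow> 'k::comm_ring_1) \<Rightarrow> (nat \<Rightarrow> 'k) \<Rightarrow> (nat \<Rightarrow> 'k) \<Rightarrow> 'k mat" where
  "sym_nilpotent f g h = mat 4 4 (\<lambda>(i, m). f i * flat g m + g i * flat f m + h i * flat h m)"

lemma sym_nilpotent_carrier [simp]: "sym_nilpotent f g h \<in> carrier_mat 4 4"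
  by (simp add: sym_nilpotent_def)

lemma sym_nilpotent_entry:
  "i < 4 \<Longrightarrow> m < 4 \<Longrightarrow> sym_nilpotent f g h $$ (i, m) = f i * flat g m + g i * flat f m + h i * flat h m"
  by (simp add: sym_nilpotent_def)

text \<open>
  The cyclic vector is column \<open>0\<close> of the matrix \<open>B\<close>. Carrying a
  matrix instead of a vector allows the iterates \<open>x\<^sup>n v\<close> to be written with matrix products only.
\<close>

locale cyclic_vector =
  fixes x B :: "'k::field mat"
  assumes x: "x \<in> sp4" and B: "B \<in> carrier_mat 4 4"
    and x4: "x * (x * (x * (x * B))) = 0\<^sub>m 4 4"
    and q0: "omega (column B 0) (column (x * (x * (x * B))) 0) \<noteq> 0"
begin

definition W :: "nat \<Rightarrow> 'k mat" where
  "W n = (if n = 0 then B else if n = 1 then x * B else if n = 2 then x * (x * B) else x * (x * (x * B)))"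

definition w :: "nat \<Rightarrow> nat \<Rightarrow> 'k" where "w n = column (W n) 0"

definition "pp = omega (w 0) (w 1)"
definition "qq = omega (w 0) (w 3)"

lemma xc: "x \<in> carrier_mat 4 4" using x by (rule sp4_carrier)

lemma Wc: "W n \<in> carrier_mat 4 4"
  using B xc by (simp add: W_def)

lemma xW: "x * W 0 = W 1" "x * W 1 = W 2" "x * W 2 = W 3" "x * W 3 = 0\<^sub>m 4 4"
  using x4 by (simp_all add: W_def)

lemma qq0: "qq \<noteq> 0" using q0 by (simp add: qq_def w_def W_def)

lemma column_zero: "i < 4 \<Longrightarrow> column (0\<^sub>m 4 4) 0 i = (0 :: 'k)"
  by (simp add: column_def)

lemma omega_column_zero: "omega u (column (0\<^sub>m 4 4) 0) = (0 :: 'k)"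
  by (simp add: omega_def column_def)

lemma gram:
  "omega (w 0) (w 0) = 0" "omega (w 0) (w 1) = pp" "omega (w 0) (w 2) = 0" "omega (w 0) (w 3) = qq"
  "omega (w 1) (w 0) = - pp" "omega (w 1) (w 1) = 0" "omega (w 1) (w 2) = - qq" "omega (w 1) (w 3) = 0"
  "omega (w 2) (w 0) = 0" "omega (w 2) (w 1) = qq" "omega (w 2) (w 2) = 0" "omega (w 2) (w 3) = 0"
  "omega (w 3) (w 0) = - qq" "omega (w 3) (w 1) = 0" "omega (w 3) (w 2) = 0" "omega (w 3) (w 3) = 0"
proof -
  note sk = omega_sp4[OF x Wc Wc, of 0 0]
  show 1: "omega (w 0) (w 1) = pp" "omega (w 0) (w 3) = qq" by (simp_all add: pp_def qq_def)
  show 2: "omega (w 0) (w 2) = 0" using sk[of 0 1] unfolding xW w_def by simp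
  show 3: "omega (w 1) (w 2) = - qq" using sk[of 0 2] unfolding xW qq_def w_def by simp
  show 4: "omega (w 1) (w 3) = 0" using sk[of 0 3] unfolding xW w_def by (simp add: omega_column_zero)
  show 5: "omega (w 2) (w 3) = 0" using sk[of 1 3] unfolding xW w_def by (simp add: omega_column_zero)
  show "omega (w 1) (w 0) = - pp" "omega (w 2) (w 0) = 0" "omega (w 2) (w 1) = qq"
    "omega (w 3) (w 0) = - qq" "omega (w 3) (w 1) = 0" "omega (w 3) (w 2) = 0"
    using 1 2 3 4 5 omega_skew[of "w 1" "w 0"] omega_skew[of "w 2" "w 0"] omega_skew[of "w 2" "w 1"]
      omega_skew[of "w 3" "w 0"] omega_skew[of "w 3" "w 1"] omega_skew[of "w 3" "w 2"] by simp_all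
qed simp_all

text \<open>
  The family dual to \<open>w\<close>, obtained by inverting the Gram matrix of \<open>gram\<close>.
\<close>

definition d :: "nat \<Rightarrow> nat \<Rightarrow> 'k" where
  "d n = (if n = 0 then linear_comb (- 1 / qq) (w 3) 0 (w 3) else if n = 1 then linear_comb (1 / qq) (w 2) 0 (w 2)
    else if n = 2 then linear_comb (- 1 / qq) (w 1) (pp / qq\<^sup>2) (w 3) else linear_comb (1 / qq) (w 0) (- pp / qq\<^sup>2) (w 2))"

lemma d_eqs: "d 0 = linear_comb (- 1 / qq) (w 3) 0 (w 3)" "d 1 = linear_comb (1 / qq) (w 2) 0 (w 2)"
  "d 2 = linear_comb (- 1 / qq) (w 1) (pp / qq\<^sup>2) (w 3)" "d 3 = linear_comb (1 / qq) (w 0) (- pp / qq\<^sup>2) (w 2)"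
  by (simp_all add: d_def)

lemma dual: "n < 4 \<Longrightarrow> m < 4 \<Longrightarrow> omega (d n) (w m) = (if n = m then 1 else 0)"
  using qq0 by (elim less_4_cases; simp only: d_eqs omega_linear_comb gram; simp add: power2_eq_square)

lemma expand:
  assumes "y \<in> carrier_mat 4 4" "i < 4" "m < 4"
  shows "y $$ (i, m) = column (y * W 0) 0 i * flat (d 0) m + column (y * W 1) 0 i * flat (d 1) m
    + column (y * W 2) 0 i * flat (d 2) m + column (y * W 3) 0 i * flat (d 3) m"
  by (rule matrix_in_dual_frame[where b = w and b' = d and col_ix = "\<lambda>_. 0", OF dual assms(1) _ assms(2,3)])
    (simp_all add: Wc w_def)

lemma x_expand:
  assumes "i < 4" "m < 4"
  shows "x $$ (i, m) = w 1 i * flat (d 0) m + w 2 i * flat (d 1) m + w 3 i * flat (d 2) m"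
  unfolding expand[OF xc assms] xW column_zero[OF assms(1)] w_def by simp

lemma cube_expand:
  assumes "i < 4" "m < 4"
  shows "(x * (x * x)) $$ (i, m) = w 3 i * flat (d 0) m"
proof -
  have a: "x * (x * x) * W n = x * (x * (x * W n))" for n
    using xc Wc[of n] by (simp add: assoc_mult_mat[of _ 4 4 _ 4 _ 4])
  have c3: "x * (x * x) \<in> carrier_mat 4 4" using xc by simp
  have "x * (x * x) * W 0 = W 3" "x * (x * x) * W 1 = 0\<^sub>m 4 4"
    "x * (x * x) * W 2 = 0\<^sub>m 4 4" "x * (x * x) * W 3 = 0\<^sub>m 4 4"
    unfolding a xW by (simp_all add: right_mult_zero_mat[OF xc])
  then show ?thesis
    unfolding expand[OF c3 assms] w_def using column_zero[OF assms(1)] by simp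
qed

text \<open>
  Since \<open>v, x v, x\<^sup>2 v, x\<^sup>3 v\<close> is a basis, \<open>y\<close> is determined by \<open>u = y v\<close>, and it is a polynomial in \<open>x\<close>. Being skew,
  it is an odd polynomial: the coefficients of \<open>1\<close> and \<open>x\<^sup>2\<close> are expressed by \<open>omega (x\<^sup>3 v) u\<close> and \<open>omega (x v) u\<close>,
  and each of these equals its own negative.
\<close>

lemma centralizer:
  assumes y: "y \<in> sp4" and comm: "x * y = y * x" and two: "(2 :: 'k) \<noteq> 0"
  shows "\<exists>s t. y = s \<cdot>\<^sub>m x + t \<cdot>\<^sub>m (x * (x * x))"
proof -
  have yc: "y \<in> carrier_mat 4 4" using y by (rule sp4_carrier)
  define Y where "Y = y * B"
  have Yc: "Y \<in> carrier_mat 4 4" using yc B by (simp add: Y_def)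
  have yx: "y * (x * A) = x * (y * A)" if "A \<in> carrier_mat 4 4" for A
    using assoc_mult_mat[OF yc xc that] assoc_mult_mat[OF xc yc that] comm by simp
  have yW0: "y * W 0 = Y" by (simp add: Y_def W_def)
  have yW1: "y * W 1 = x * Y" using yx[OF Wc[of 0]] unfolding xW yW0 .
  have yW2: "y * W 2 = x * (x * Y)" using yx[OF Wc[of 1]] unfolding xW yW1 .
  have yW3: "y * W 3 = x * (x * (x * Y))" using yx[OF Wc[of 2]] unfolding xW yW2 .
  define u where "u = column Y 0"
  have double_zero: "z = 0" if "z = - z" for z :: 'k
    using that two by (metis add.right_inverse mult_2 mult_eq_0_iff)
  have xYc: "x * Y \<in> carrier_mat 4 4" "x * (x * Y) \<in> carrier_mat 4 4" using xc Yc by auto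
  have "omega (w 3) u = - omega (column (W 0) 0) (column (y * W 3) 0)"
    using omega_sp4[OF x Wc Yc, of 0 0 2] omega_sp4[OF x Wc xYc(1), of 0 0 1] omega_sp4[OF x Wc xYc(2), of 0 0 0]
    unfolding xW u_def w_def yW3 by simp
  also have "\<dots> = omega u (w 3)"
    using omega_sp4[OF y Wc[of 0] Wc[of 3], of 0 0] unfolding yW0 u_def w_def by simp
  finally have w3u: "omega (w 3) u = 0" using double_zero omega_skew by metis
  have "omega (w 1) u = - omega (column (W 0) 0) (column (x * Y) 0)"
    using omega_sp4[OF x Wc Yc, of 0 0 0] unfolding xW u_def w_def by simp
  also have "\<dots> = omega u (w 1)"
    using omega_sp4[OF y Wc[of 0] Wc[of 1], of 0 0] unfolding yW0 yW1 u_def w_def by simp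
  finally have w1u: "omega (w 1) u = 0" using double_zero omega_skew by metis
  define s t where "s = omega (d 1) u" and "t = omega (d 3) u"
  have z: "omega (d 0) u = 0" "omega (d 2) u = 0"
    unfolding d_eqs omega_linear_comb w3u w1u by simp_all
  have Y: "column Y 0 i = linear_comb s (column (W 1) 0) t (column (W 3) 0) i" if "i < 4" for i
    using vector_in_dual_frame[of d w i u, OF dual that] unfolding z
    by (simp add: u_def s_def t_def linear_comb_def w_def)
  have Y1: "column (x * Y) 0 i = linear_comb s (column (W 2) 0) t (column (0\<^sub>m 4 4) 0) i" if "i < 4" for i
    using column_mult_linear_comb[OF xc Yc Wc Wc _ _ _ Y that] unfolding xW by simp
  have Y2: "column (x * (x * Y)) 0 i = linear_comb s (column (W 3) 0) t (column (0\<^sub>m 4 4) 0) i" if "i < 4" for i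
    using column_mult_linear_comb[OF xc xYc(1) Wc zero_carrier_mat _ _ _ Y1 that]
    unfolding xW right_mult_zero_mat[OF xc] by simp
  have Y3: "column (x * (x * (x * Y))) 0 i = linear_comb s (column (0\<^sub>m 4 4) 0) t (column (0\<^sub>m 4 4) 0) i" if "i < 4" for i
    using column_mult_linear_comb[OF xc xYc(2) Wc zero_carrier_mat _ _ _ Y2 that]
    unfolding xW right_mult_zero_mat[OF xc] by simp
  have "y = s \<cdot>\<^sub>m x + t \<cdot>\<^sub>m (x * (x * x))"
  proof (rule mat4_eqI)
    fix i m :: nat assume im: "i < 4" "m < 4"
    have "(s \<cdot>\<^sub>m x + t \<cdot>\<^sub>m (x * (x * x))) $$ (i, m) = s * x $$ (i, m) + t * (x * (x * x)) $$ (i, m)"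
      using im carrier_matD[OF xc] by (simp del: index_mult_mat(1))
    then show "y $$ (i, m) = (s \<cdot>\<^sub>m x + t \<cdot>\<^sub>m (x * (x * x))) $$ (i, m)"
      unfolding expand[OF yc im] yW0 yW1 yW2 yW3 Y[OF im(1)] Y1[OF im(1)] Y2[OF im(1)] Y3[OF im(1)]
        x_expand[OF im] cube_expand[OF im] linear_comb_def column_zero[OF im(1)] w_def
      by (simp add: algebra_simps)
  qed (use xc yc in auto)
  then show ?thesis by blast
qed

end

text \<open>
  In the dual frame \<open>x\<close> becomes a combination of \<open>w 1 \<cdot> w 3\<close>, \<open>w 2 \<cdot> w 2\<close> and \<open>w 3 \<cdot> w 3\<close>. The last term is absorbed
  into the first, and a square root \<open>\<rho>\<close> makes the coefficient of the middle term \<open>1\<close>.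
\<close>

lemma (in cyclic_vector) symmetric_form:
  assumes two: "(2 :: 'k) \<noteq> 0" and root: "\<exists>\<rho> :: 'k. \<rho> ^ 2 = 1 / qq"
  shows "\<exists>f g h. x = sym_nilpotent f g h \<and> omega f g = 0 \<and> omega f h = 0 \<and> (\<exists>k<4. f k \<noteq> 0)"
proof -
  obtain \<rho> where \<rho>: "\<rho> ^ 2 = 1 / qq" using root by blast
  define g where "g = linear_comb (- 1 / qq) (w 1) (pp / (2 * qq\<^sup>2)) (w 3)"
  define h where "h = linear_comb \<rho> (w 2) 0 (w 2)"
  have "x = sym_nilpotent (w 3) g h"
  proof (rule mat4_eqI)
    fix i m :: nat assume im: "i < 4" "m < 4"
    have hh: "h i * flat h m = w 2 i * (1 / qq * flat (w 2) m)"
      unfolding \<rho>[symmetric] by (simp add: h_def flat_linear_comb power2_eq_square) (simp add: linear_comb_def)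
    have half: "pp / (2 * qq\<^sup>2) + pp / (2 * qq\<^sup>2) = pp / qq\<^sup>2"
      using two qq0 by (simp add: field_simps)
    have gg: "w 3 i * flat g m + g i * flat (w 3) m
      = w 3 i * (- 1 / qq * flat (w 1) m) + w 1 i * (- 1 / qq * flat (w 3) m)
        + w 3 i * ((pp / (2 * qq\<^sup>2) + pp / (2 * qq\<^sup>2)) * flat (w 3) m)"
      unfolding g_def flat_linear_comb linear_comb_def by (simp add: algebra_simps)
    show "x $$ (i, m) = sym_nilpotent (w 3) g h $$ (i, m)"
      unfolding sym_nilpotent_entry[OF im] gg hh half x_expand[OF im] d_eqs flat_linear_comb
      by (simp only: mult_zero_left add_0_right add_0_left distrib_left ac_simps)
  qed (use xc in auto)
  moreover have "omega g (w 3) = 0" "omega h (w 3) = 0"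
    unfolding g_def h_def omega_linear_comb gram by simp_all
  then have "omega (w 3) g = 0" "omega (w 3) h = 0"
    using omega_skew[of "w 3" g] omega_skew[of "w 3" h] by simp_all
  moreover have "\<exists>k<4. w 3 k \<noteq> 0"
  proof (rule ccontr)
    assume "\<not> (\<exists>k<4. w 3 k \<noteq> 0)"
    then have "qq = 0" by (simp add: qq_def omega_def)
    then show False using qq0 by simp
  qed
  ultimately show ?thesis by blast
qed

text \<open>
  The form \<open>b u v = omega u (x\<^sup>3 v)\<close> is symmetric and nonzero, so it is nonzero on the diagonal, at a vector
  \<open>e\<^sub>j\<close> or \<open>e\<^sub>j + e\<^sub>k\<close>.
\<close>

lemma cyclic_vector_exists:
  fixes x :: "'k::field mat"
  assumes x: "x \<in> sp4" and x4: "(x * x) * (x * x) = 0\<^sub>m 4 4" and x3: "x * (x * x) \<noteq> 0\<^sub>m 4 4"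
    and two: "(2 :: 'k) \<noteq> 0"
  shows "\<exists>B. cyclic_vector x B"
proof -
  have xc: "x \<in> carrier_mat 4 4" using x by (rule sp4_carrier)
  define M where "M = x * (x * x)"
  have Mc: "M \<in> carrier_mat 4 4" using xc by (simp add: M_def)
  \<comment> \<open>every column of \<open>E j k\<close> is \<open>e\<^sub>j\<close> if \<open>j = k\<close>, and \<open>e\<^sub>j + e\<^sub>k\<close> otherwise\<close>
  define E where "E j k = mat 4 4 (\<lambda>(i, _). if i = j \<or> i = k then 1 else 0 :: 'k)" for j k :: nat
  have Ec: "E j k \<in> carrier_mat 4 4" for j k by (simp add: E_def)
  define I where "I = (1\<^sub>m 4 :: 'k mat)"
  have Ic: "I \<in> carrier_mat 4 4" by (simp add: I_def)
  define b where "b j k = omega (column I j) (column M k)" for j k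
  have sym: "b j k = b k j" if "j < 4" "k < 4" for j k
  proof -
    have "b j k = - omega (column x j) (column (x * x) k)"
      using omega_sp4[OF x Ic mult_carrier_mat[OF xc xc] that] xc by (simp add: b_def M_def I_def right_mult_one_mat[OF xc])
    also have "\<dots> = omega (column (x * x) j) (column x k)"
      using omega_sp4[OF x xc xc that] by simp
    also have "\<dots> = - omega (column M j) (column I k)"
      using omega_sp4[OF x mult_carrier_mat[OF xc xc] Ic that] by (simp add: M_def I_def right_mult_one_mat[OF xc])
    also have "\<dots> = b k j" unfolding b_def by (rule omega_skew[symmetric])
    finally show ?thesis .
  qed
  have bval: "b j k = (if j < 2 then M $$ (3 - j, k) else - M $$ (3 - j, k))" if "j < 4" for j k
    using that by (elim less_4_cases) (simp_all add: b_def I_def omega_def column_def)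
  have diag: "omega (column (E j j) 0) (column (M * E j j) 0) = b j j" if "j < 4" for j
    using that Mc Ec[of j j] by (elim less_4_cases)
      (simp_all add: bval omega_def column_def index_mult_mat4 E_def del: index_mult_mat(1))
  have off: "omega (column (E j k) 0) (column (M * E j k) 0) = b j j + b k k + b j k + b k j"
    if "j < 4" "k < 4" "j \<noteq> k" for j k
    using that Mc Ec[of j k] by (elim less_4_cases)
      (simp_all add: bval omega_def column_def index_mult_mat4 E_def algebra_simps del: index_mult_mat(1))
  have "\<exists>j k. omega (column (E j k) 0) (column (M * E j k) 0) \<noteq> 0"
  proof (rule ccontr)
    assume "\<not> ?thesis"
    then have all: "omega (column (E j k) 0) (column (M * E j k) 0) = 0" for j k by blast
    have "b j j = 0" if "j < 4" for j using diag[OF that] all by simp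
    then have "b j k = 0" if "j < 4" "k < 4" for j k
      using off[OF that] sym[OF that] all[of j k] that two
      by (cases "j = k") (auto simp flip: mult_2)
    then have z: "M $$ (3 - j, k) = 0" if "j < 4" "k < 4" for j k
      using bval[OF that(1), of k] that by (auto split: if_splits)
    have "M $$ (i, k) = 0" if "i < 4" "k < 4" for i k
      using z[of "3 - i" k] that by simp
    then show False using x3 mat4_eq_0_iff[OF Mc] by (simp add: M_def)
  qed
  then obtain j k where jk: "omega (column (E j k) 0) (column (M * E j k) 0) \<noteq> 0" by blast
  have M3: "M * E j k = x * (x * (x * E j k))"
    unfolding M_def using xc Ec[of j k] by (simp add: assoc_mult_mat[of _ 4 4 _ 4 _ 4])
  have "x * (x * (x * (x * E j k))) = (x * x) * (x * x) * E j k"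
    using xc Ec[of j k] by (simp add: assoc_mult_mat[of _ 4 4 _ 4 _ 4])
  then have "cyclic_vector x (E j k)"
    using x Ec jk x4 left_mult_zero_mat[OF Ec] by unfold_locales (simp_all add: M3)
  then show ?thesis by blast
qed

section \<open>Coordinates on the nilpotent cone\<close>

definition chart_sign :: "nat \<Rightarrow> 'k::comm_ring_1" where "chart_sign i = (if i < 2 then 1 else - 1)"

text \<open>
  The vector with value \<open>a\<close> at position \<open>k\<close>, \<open>b\<close> at \<open>l\<close>, \<open>c\<close> (up to sign) at the position \<open>3 - l\<close> paired with \<open>l\<close> by the
  form, and \<open>d\<close> at the position \<open>3 - k\<close> paired with \<open>k\<close>. The sign makes the form look the same for all pairs \<open>k, l\<close>
  that span a Lagrangian coordinate plane; these pairs are collected in \<open>charts\<close>.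
\<close>

definition place :: "nat \<Rightarrow> nat \<Rightarrow> 'k::comm_ring_1 \<Rightarrow> 'k \<Rightarrow> 'k \<Rightarrow> 'k \<Rightarrow> nat \<Rightarrow> 'k" where
  "place k l a b c d i = (if i = k then a else if i = l then b else if i = 3 - l then chart_sign k * chart_sign l * c else d)"

definition charts :: "(nat \<times> nat) set" where
  "charts = {(k, l). k < 4 \<and> l < 4 \<and> l \<noteq> k \<and> l \<noteq> 3 - k}"

lemma finite_charts: "finite charts"
  by (rule finite_subset[of _ "{..<4} \<times> {..<4}"]) (auto simp: charts_def)

lemma chart_sign_sq [simp]: "chart_sign i * chart_sign i = 1" "chart_sign i * (chart_sign i * c) = c" "chart_sign i * (c * chart_sign i) = c"
  by (auto simp: chart_sign_def)

lemma charts_cases: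
  assumes "(k, l) \<in> charts"
  obtains "k = 0" "l = 1" | "k = 0" "l = 2" | "k = 1" "l = 0" | "k = 1" "l = 3"
    | "k = 2" "l = 0" | "k = 2" "l = 3" | "k = 3" "l = 1" | "k = 3" "l = 2"
  using assms unfolding charts_def by (auto elim!: less_4_cases)

lemma omega_in_chart:
  assumes "(k, l) \<in> charts"
  shows "chart_sign k * omega u v =
    u k * v (3 - k) + u l * (chart_sign k * chart_sign l * v (3 - l)) - chart_sign k * chart_sign l * u (3 - l) * v l - u (3 - k) * v k"
  using assms by (elim charts_cases) (simp_all add: omega_def chart_sign_def algebra_simps)

lemma place_decomposition:
  assumes "(k, l) \<in> charts" "i < 4"
  shows "u i = place k l (u k) (u l) (chart_sign k * chart_sign l * u (3 - l)) (u (3 - k)) i"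
  using assms by (elim charts_cases; elim less_4_cases) (simp_all add: place_def chart_sign_def)

lemma omega_place:
  assumes "(k, l) \<in> charts"
  shows "omega (place k l a b c d) (place k l a' b' c' d') = chart_sign k * (a * d' + b * c' - c * b' - d * a')"
  using assms by (elim charts_cases) (simp_all add: place_def chart_sign_def omega_def algebra_simps)

text \<open>
  Eight parameters for \<open>sym_nilpotent f g h\<close>: \<open>f\<close> is scaled to \<open>1\<close> at position \<open>k\<close>, \<open>h\<close> is made \<open>0\<close> there by
  subtracting a multiple of \<open>f\<close>, and the last coordinates of \<open>g\<close> and \<open>h\<close> solve the linear equations
  \<open>omega f g = 0\<close> and \<open>omega f h = 0\<close>.
\<close>

definition nilpotent_chart ::
  "nat \<Rightarrow> nat \<Rightarrow> 'k::comm_ring_1 \<Rightarrow> 'k \<Rightarrow> 'k \<Rightarrow> 'k \<Rightarrow> 'k \<Rightarrow> 'k \<Rightarrow> 'k \<Rightarrow> 'k \<Rightarrow> 'k mat" where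
  "nilpotent_chart k l a b c g1 g2 g3 h1 h2 = sym_nilpotent (place k l 1 a b c)
     (place k l g1 g2 g3 (c * g1 + b * g2 - a * g3)) (place k l 0 h1 h2 (b * h1 - a * h2))"

lemma sym_nilpotent_cong:
  assumes "\<And>i. i < 4 \<Longrightarrow> f i = f' i" "\<And>i. i < 4 \<Longrightarrow> g i = g' i" "\<And>i. i < 4 \<Longrightarrow> h i = h' i"
  shows "sym_nilpotent f g h = sym_nilpotent f' g' h'"
  by (rule mat4_eqI) (use assms in \<open>auto simp: sym_nilpotent_entry flat_def\<close>)

text \<open>
  Replacing \<open>h\<close> by \<open>h - h\<^sub>k f\<close> changes \<open>h \<cdot> h\<close> by multiples of \<open>f \<cdot> h\<close> and \<open>f \<cdot> f\<close>, which are absorbed into \<open>g\<close>.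
\<close>

lemma sym_nilpotent_in_chart:
  fixes f g h :: "nat \<Rightarrow> 'k::field"
  assumes kl: "(k, l) \<in> charts" and fk: "f k \<noteq> 0" and fg: "omega f g = 0" and fh: "omega f h = 0"
    and two: "(2 :: 'k) \<noteq> 0"
  shows "\<exists>a b c g1 g2 g3 h1 h2. sym_nilpotent f g h = nilpotent_chart k l a b c g1 g2 g3 h1 h2"
proof -
  define F where "F = linear_comb (1 / f k) f 0 f"
  define H where "H = linear_comb 1 h (- h k) F"
  define G where "G = linear_comb 1 (linear_comb (f k) g (h k) H) ((h k)\<^sup>2 / 2) F"
  have f: "f = linear_comb (f k) F 0 F" using fk by (auto simp: F_def linear_comb_def)
  have h: "h = linear_comb 1 H (h k) F" by (auto simp: H_def linear_comb_def)
  have half: "(h k)\<^sup>2 / 2 + (h k)\<^sup>2 / 2 = h k * h k" using two by (simp add: field_simps power2_eq_square)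
  have "sym_nilpotent f g h = sym_nilpotent F G H"
  proof (rule mat4_eqI)
    fix i m :: nat assume im: "i < 4" "m < 4"
    have "F i * flat G m + G i * flat F m + H i * flat H m =
      f k * (F i * flat g m + g i * flat F m) + h k * (F i * flat H m + H i * flat F m)
        + ((h k)\<^sup>2 / 2 + (h k)\<^sup>2 / 2) * F i * flat F m + H i * flat H m"
      unfolding G_def flat_linear_comb linear_comb_def by (simp add: algebra_simps)
    also have "\<dots> = f k * (F i * flat g m + g i * flat F m) + (H i + h k * F i) * (flat H m + h k * flat F m)"
      unfolding half by (simp add: algebra_simps)
    also have "\<dots> = f i * flat g m + g i * flat f m + h i * flat h m"
      using fk by (subst (1 2) f, subst (1 2) h) (simp add: flat_linear_comb, simp add: linear_comb_def algebra_simps)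
    finally show "sym_nilpotent f g h $$ (i, m) = sym_nilpotent F G H $$ (i, m)"
      by (simp add: sym_nilpotent_entry im)
  qed auto
  have FH: "omega F H = 0" and FG: "omega F G = 0"
  proof -
    have "omega F h = 0" by (simp add: F_def omega_linear_comb fh)
    then have "omega h F = 0" using omega_skew[of h F] by simp
    then have HF: "omega H F = 0" by (simp add: H_def omega_linear_comb)
    then show "omega F H = 0" using omega_skew[of F H] by simp
    have "omega F g = 0" by (simp add: F_def omega_linear_comb fg)
    then have "omega g F = 0" using omega_skew[of g F] by simp
    then have "omega G F = 0" using HF by (simp add: G_def omega_linear_comb)
    then show "omega F G = 0" using omega_skew[of F G] by simp
  qed
  have Fk: "F k = 1" and Hk: "H k = 0" using fk by (simp_all add: F_def H_def linear_comb_def)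
  define a b c where "a = F l" and "b = chart_sign k * chart_sign l * F (3 - l)" and "c = F (3 - k)"
  have last: "u (3 - k) = c * u k + b * u l - a * (chart_sign k * chart_sign l * u (3 - l))" if "omega F u = 0" for u
    using omega_in_chart[OF kl, of F u] unfolding that Fk a_def b_def c_def by (simp add: algebra_simps)
  have "sym_nilpotent F G H =
    nilpotent_chart k l a b c (G k) (G l) (chart_sign k * chart_sign l * G (3 - l)) (H l) (chart_sign k * chart_sign l * H (3 - l))"
    unfolding nilpotent_chart_def
  proof (rule sym_nilpotent_cong)
    fix i :: nat assume i: "i < 4"
    show "F i = place k l 1 a b c i"
      using place_decomposition[OF kl i, of F] unfolding Fk a_def b_def c_def .
    show "G i = place k l (G k) (G l) (chart_sign k * chart_sign l * G (3 - l)) (c * G k + b * G l - a * (chart_sign k * chart_sign l * G (3 - l))) i"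
      unfolding last[OF FG, symmetric] by (rule place_decomposition[OF kl i])
    have e: "b * H l - a * (chart_sign k * chart_sign l * H (3 - l)) = H (3 - k)" using last[OF FH] Hk by simp
    show "H i = place k l 0 (H l) (chart_sign k * chart_sign l * H (3 - l)) (b * H l - a * (chart_sign k * chart_sign l * H (3 - l))) i"
      using place_decomposition[OF kl i, of H] unfolding e Hk .
  qed
  with \<open>sym_nilpotent f g h = sym_nilpotent F G H\<close> show ?thesis by metis
qed

lemma regular_nilpotent_in_chart:
  fixes x :: "'k::alg_closed_field mat"
  assumes x: "x \<in> sp4" and x4: "(x * x) * (x * x) = 0\<^sub>m 4 4" and x3: "x * (x * x) \<noteq> 0\<^sub>m 4 4"
    and two: "(2 :: 'k) \<noteq> 0"
  shows "\<exists>k l a b c g1 g2 g3 h1 h2. (k, l) \<in> charts \<and> x = nilpotent_chart k l a b c g1 g2 g3 h1 h2"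
proof -
  obtain B where "cyclic_vector x B" using cyclic_vector_exists[OF assms] by blast
  then interpret cyclic_vector x B .
  have "\<exists>\<rho> :: 'k. \<rho> ^ 2 = 1 / qq" by (rule nth_root_exists) simp
  then obtain f g h k where fgh: "x = sym_nilpotent f g h" "omega f g = 0" "omega f h = 0" "k < 4" "f k \<noteq> 0"
    using symmetric_form[OF two] by blast
  define l :: nat where "l = (if k = 0 \<or> k = 3 then 1 else 0)"
  have kl: "(k, l) \<in> charts" using fgh(4) by (auto simp: charts_def l_def)
  show ?thesis
    using sym_nilpotent_in_chart[OF kl fgh(5,2,3) two] kl unfolding fgh(1) by blast
qed

lemma regular_nilpotent_centralizer:
  fixes x y :: "'k::field mat"
  assumes x: "x \<in> sp4" and x4: "(x * x) * (x * x) = 0\<^sub>m 4 4" and x3: "x * (x * x) \<noteq> 0\<^sub>m 4 4"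
    and two: "(2 :: 'k) \<noteq> 0" and y: "y \<in> sp4" and comm: "x * y = y * x"
  shows "\<exists>s t. y = s \<cdot>\<^sub>m x + t \<cdot>\<^sub>m (x * (x * x))"
proof -
  obtain B where "cyclic_vector x B" using cyclic_vector_exists[OF x x4 x3 two] by blast
  then interpret cyclic_vector x B .
  show ?thesis by (rule centralizer[OF y comm two])
qed


section \<open>Tuples with vanishing products\<close>

text \<open>
  The Lagrangian planes that are graphs over the coordinate plane \<open>k, l\<close> are given by symmetric \<open>2 \<times> 2\<close> matrices, here with
  entries \<open>a, b, c\<close>. If two vectors of \<open>R\<close> have a nonzero minor in such positions \<open>k, l\<close>, they
  span such a plane, and being orthogonal to both puts the other vectors into it, by
  Cramer's rule. Otherwise the Pluecker relation shows that the two remaining minors vanish too, so \<open>R\<close> lies on a line,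
  and a graph through this line is easy to write down.
\<close>

lemma isotropic_set_in_lagrangian_chart:
  fixes R :: "(nat \<Rightarrow> 'k::field) set"
  assumes iso: "\<And>u v. u \<in> R \<Longrightarrow> v \<in> R \<Longrightarrow> omega u v = 0"
  shows "\<exists>k l a b c. (k, l) \<in> charts \<and> (\<forall>u\<in>R.
    chart_sign k * chart_sign l * u (3 - l) = a * u k + c * u l \<and> u (3 - k) = b * u k + a * u l)"
proof (cases "\<exists>(k, l)\<in>charts. \<exists>u\<in>R. \<exists>v\<in>R. u k * v l - u l * v k \<noteq> 0")
  case True
  then obtain k l u v where kl: "(k, l) \<in> charts" and u: "u \<in> R" and v: "v \<in> R"
    and nz: "u k * v l - u l * v k \<noteq> 0" by blast
  define D where "D = u k * v l - u l * v k"
  define C where "C w = chart_sign k * chart_sign l * w (3 - l)" for w :: "nat \<Rightarrow> 'k"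
  define E where "E w = w (3 - k)" for w :: "nat \<Rightarrow> 'k"
  have om: "w k * E z + w l * C z - C w * z l - E w * z k = 0" if "w \<in> R" "z \<in> R" for w z
    using omega_in_chart[OF kl, of w z] iso[OF that] by (simp add: C_def E_def)
  define a b c where "a = (C u * v l - C v * u l) / D" and "b = (E u * v l - E v * u l) / D"
    and "c = (u k * C v - v k * C u) / D"
  have "C w = a * w k + c * w l \<and> E w = b * w k + a * w l" if w: "w \<in> R" for w
  proof -
    note uv = om[OF u v] and uw = om[OF u w] and vw = om[OF v w]
    have aD: "a * D = C u * v l - C v * u l" "b * D = E u * v l - E v * u l" "c * D = u k * C v - v k * C u"
      using nz by (simp_all add: a_def b_def c_def D_def)
    have "C w * D = (C u * v l - C v * u l) * w k + (u k * C v - v k * C u) * w l"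
    proof -
      have "C w * D - ((C u * v l - C v * u l) * w k + (u k * C v - v k * C u) * w l) =
        u k * (v k * E w + v l * C w - C v * w l - E v * w k)
        - v k * (u k * E w + u l * C w - C u * w l - E u * w k)
        + w k * (u k * E v + u l * C v - C u * v l - E u * v k)"
        unfolding D_def by (simp add: algebra_simps)
      then show ?thesis unfolding uv uw vw by simp
    qed
    then have "C w * D = (a * w k + c * w l) * D"
      unfolding aD[symmetric] by (simp add: algebra_simps)
    moreover have "E w * D = (E u * v l - E v * u l) * w k + (C u * v l - C v * u l) * w l"
    proof -
      have "E w * D - ((E u * v l - E v * u l) * w k + (C u * v l - C v * u l) * w l) =
        v l * (u k * E w + u l * C w - C u * w l - E u * w k)
        - u l * (v k * E w + v l * C w - C v * w l - E v * w k)"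
        unfolding D_def by (simp add: algebra_simps)
      then show ?thesis unfolding uw vw by simp
    qed
    then have "E w * D = (b * w k + a * w l) * D"
      unfolding aD[symmetric] by (simp add: algebra_simps)
    ultimately show ?thesis using nz by (simp add: D_def)
  qed
  then show ?thesis using kl unfolding C_def E_def
    by - (rule exI[of _ k], rule exI[of _ l], rule exI[of _ a], rule exI[of _ b], rule exI[of _ c], blast)
next
  case False
  then have minor: "u k * v l = u l * v k" if "(k, l) \<in> charts" "u \<in> R" "v \<in> R" for k l u v
    using that by fastforce
  show ?thesis
  proof (cases "\<exists>v\<in>R. \<exists>k<4. v k \<noteq> 0")
    case True
    then obtain v k where v: "v \<in> R" "k < 4" "v k \<noteq> 0" by blast
    define l :: nat where "l = (if k = 0 \<or> k = 3 then 1 else 0)"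
    have kl: "(k, l) \<in> charts" using v(2) by (auto simp: charts_def l_def)
    have ratio: "u i * v k = v i * u k" if u: "u \<in> R" and i: "i < 4" for u i
    proof -
      have ch: "(0, 1) \<in> charts" "(0, 2) \<in> charts" "(1, 3) \<in> charts" "(2, 3) \<in> charts"
        by (auto simp: charts_def)
      note m = minor[OF ch(1) u v(1)] minor[OF ch(2) u v(1)] minor[OF ch(3) u v(1)] minor[OF ch(4) u v(1)]
      have iso_uv: "u 0 * v 3 + u 1 * v 2 - u 2 * v 1 - u 3 * v 0 = 0"
        using iso[OF u v(1)] by (simp add: omega_def)
      \<comment> \<open>isotropy identifies the two minors outside the charts up to sign; the Pluecker relation then makes their square zero\<close>
      have "(u 0 * v 3 - u 3 * v 0) * (u 0 * v 3 - u 3 * v 0) = 0"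
      proof -
        have "(u 0 * v 3 - u 3 * v 0) * (u 0 * v 3 - u 3 * v 0) =
          (u 0 * v 3 - u 3 * v 0) * (u 0 * v 3 + u 1 * v 2 - u 2 * v 1 - u 3 * v 0)
          + (u 0 * v 1 - u 1 * v 0) * (u 2 * v 3 - u 3 * v 2) - (u 0 * v 2 - u 2 * v 0) * (u 1 * v 3 - u 3 * v 1)"
          by (simp add: algebra_simps)
        then show ?thesis unfolding iso_uv m by simp
      qed
      then have m03: "u 0 * v 3 = u 3 * v 0" by simp
      then have m12: "u 1 * v 2 = u 2 * v 1" using iso_uv by simp
      show ?thesis
        using i v(2) m m03 m12 by (elim less_4_cases) (simp_all add: mult.commute)
    qed
    define a where "a = chart_sign k * chart_sign l * v (3 - l) / v k"
    define b where "b = (v (3 - k) - a * v l) / v k"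
    have "chart_sign k * chart_sign l * u (3 - l) = a * u k + 0 * u l \<and> u (3 - k) = b * u k + a * u l" if u: "u \<in> R" for u
    proof -
      have lk: "l < 4" "3 - l < 4" "3 - k < 4" using kl by (auto simp: charts_def)
      have e: "u i = v i * u k / v k" if "i < 4" for i
        using ratio[OF u that] v(3) by (simp add: field_simps)
      show ?thesis
        unfolding e[OF lk(1)] e[OF lk(2)] e[OF lk(3)] a_def b_def using v(3) by (simp add: field_simps)
    qed
    then show ?thesis using kl
      by - (rule exI[of _ k], rule exI[of _ l], rule exI[of _ a], rule exI[of _ b], rule exI[of _ 0], blast)
  next
    case False
    then have "u i = 0" if "u \<in> R" "i < 4" for u i using that by blast
    then have "chart_sign 0 * chart_sign 1 * u (3 - 1) = 0 * u 0 + 0 * u 1 \<and> u (3 - 0) = 0 * u 0 + 0 * u 1" if "u \<in> R" for u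
      using that by simp
    moreover have "(0, 1) \<in> charts" by (simp add: charts_def)
    ultimately show ?thesis by - (rule exI[of _ 0], rule exI[of _ 1], rule exI[of _ 0], rule exI[of _ 0], rule exI[of _ 0], blast)
  qed
qed

text \<open>
  In the symmetric square this is \<open>s f \<cdot> f + 2 t f \<cdot> g + u g \<cdot> g\<close>, a quadratic form on the plane spanned by \<open>f\<close> and \<open>g\<close>.
\<close>

definition sym_lagrangian ::
  "(nat \<Rightarrow> 'k::comm_ring_1) \<Rightarrow> (nat \<Rightarrow> 'k) \<Rightarrow> 'k \<Rightarrow> 'k \<Rightarrow> 'k \<Rightarrow> 'k mat" where
  "sym_lagrangian f g s t u = mat 4 4 (\<lambda>(i, m). s * f i * flat f m
     + t * (f i * flat g m + g i * flat f m) + u * g i * flat g m)"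

lemma sym_lagrangian_carrier [simp]: "sym_lagrangian f g s t u \<in> carrier_mat 4 4"
  by (simp add: sym_lagrangian_def)

lemma sym_lagrangian_entry:
  "i < 4 \<Longrightarrow> m < 4 \<Longrightarrow> sym_lagrangian f g s t u $$ (i, m) =
    s * f i * flat f m + t * (f i * flat g m + g i * flat f m) + u * g i * flat g m"
  by (simp add: sym_lagrangian_def)

definition lagrangian_chart ::
  "nat \<Rightarrow> nat \<Rightarrow> 'k::comm_ring_1 \<Rightarrow> 'k \<Rightarrow> 'k \<Rightarrow> 'k \<Rightarrow> 'k \<Rightarrow> 'k \<Rightarrow> 'k mat" where
  "lagrangian_chart k l a b c = sym_lagrangian (place k l 1 0 a b) (place k l 0 1 c a)"

text \<open>
  Since \<open>f\<close> and \<open>g\<close> restrict to the unit vectors on the positions \<open>k\<close> and \<open>l\<close>, column \<open>m\<close> of \<open>x\<close> is \<open>x\<^sub>k\<^sub>m f + x\<^sub>l\<^sub>m g\<close>. By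
  skewness the rows are combinations of \<open>flat f\<close> and \<open>flat g\<close> as well.
\<close>

lemma sp4_with_columns_in_lagrangian:
  fixes x :: "'k::comm_ring_1 mat"
  assumes x: "x \<in> sp4" and kl: "(k, l) \<in> charts"
    and cols: "\<And>m. m < 4 \<Longrightarrow> chart_sign k * chart_sign l * x $$ (3 - l, m) = a * x $$ (k, m) + c * x $$ (l, m) \<and>
      x $$ (3 - k, m) = b * x $$ (k, m) + a * x $$ (l, m)"
  shows "\<exists>s t u. x = lagrangian_chart k l a b c s t u"
proof -
  have xc: "x \<in> carrier_mat 4 4" using x by (rule sp4_carrier)
  define f g :: "nat \<Rightarrow> 'k" where "f = place k l 1 0 a b" and "g = place k l 0 1 c a"
  have k4: "k < 4" "l < 4" "3 - k < 4" "3 - l < 4" using kl by (auto simp: charts_def)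
  have col: "x $$ (i, m) = x $$ (k, m) * f i + x $$ (l, m) * g i" if im: "i < 4" "m < 4" for i m
  proof -
    let ?u = "column x m"
    have "?u i = place k l (?u k) (?u l) (a * ?u k + c * ?u l) (b * ?u k + a * ?u l) i"
      using place_decomposition[OF kl im(1), of ?u] cols[OF im(2)] by (simp add: column_def)
    also have "\<dots> = ?u k * f i + ?u l * g i"
      by (simp add: f_def g_def place_def algebra_simps)
    finally show ?thesis by (simp add: column_def)
  qed
  have fl: "flat (column x j) m = x $$ (k, j) * flat f m + x $$ (l, j) * flat g m" if "j < 4" "m < 4" for j m
    using that by (simp add: flat_def column_def col[of _ j] algebra_simps)
  have skew: "x $$ (i, m) = chart_sign i * flat (column x (3 - i)) m" if "i < 4" "m < 4" for i m
    using x that unfolding sp4_iff by (elim less_4_cases) (auto simp: flat_def column_def chart_sign_def)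
  define s t u where "s = chart_sign k * x $$ (k, 3 - k)" and "t = chart_sign k * x $$ (l, 3 - k)" and "u = chart_sign l * x $$ (l, 3 - l)"
  have flk: "flat f (3 - l) = 0" "flat g (3 - l) = chart_sign l"
    using kl by (elim charts_cases; simp add: flat_def f_def g_def place_def chart_sign_def)+
  have rk: "x $$ (k, m) = s * flat f m + t * flat g m" if "m < 4" for m
    unfolding skew[OF k4(1) that] fl[OF k4(3) that] s_def t_def by (simp add: algebra_simps)
  have tl: "chart_sign l * x $$ (k, 3 - l) = t"
    unfolding rk[OF k4(4)] flk by simp
  have rl: "x $$ (l, m) = t * flat f m + u * flat g m" if "m < 4" for m
    unfolding skew[OF k4(2) that] fl[OF k4(4) that] u_def tl[symmetric] by (simp add: algebra_simps)
  have "x = lagrangian_chart k l a b c s t u"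
  proof (rule mat4_eqI)
    fix i m :: nat assume im: "i < 4" "m < 4"
    show "x $$ (i, m) = lagrangian_chart k l a b c s t u $$ (i, m)"
      unfolding lagrangian_chart_def sym_lagrangian_entry[OF im] f_def[symmetric] g_def[symmetric]
        col[OF im] rk[OF im(2)] rl[OF im(2)] by (simp add: algebra_simps)
  qed (use xc in \<open>auto simp: lagrangian_chart_def\<close>)
  then show ?thesis by blast
qed

text \<open>
  The columns of all members of \<open>X\<close> form an isotropic set, because \<open>omega (x u) (y v) = - omega u (x (y v)) = 0\<close>.
\<close>

lemma zero_products_in_lagrangian_chart:
  fixes X :: "'k::field mat set"
  assumes X: "X \<subseteq> sp4" and prod: "\<And>x y. x \<in> X \<Longrightarrow> y \<in> X \<Longrightarrow> x * y = 0\<^sub>m 4 4"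
  shows "\<exists>k l a b c. (k, l) \<in> charts \<and> (\<forall>x\<in>X. \<exists>s t u. x = lagrangian_chart k l a b c s t u)"
proof -
  define R where "R = {column x m | x m. x \<in> X \<and> m < 4}"
  have iso: "omega u v = 0" if uv: "u \<in> R" "v \<in> R" for u v
  proof -
    obtain x y m n where u: "u = column x m" "x \<in> X" "m < 4" and v: "v = column y n" "y \<in> X" "n < 4"
      using uv unfolding R_def by blast
    have x: "x \<in> sp4" and y: "y \<in> sp4" using X u v by auto
    have "omega (column (x * 1\<^sub>m 4) m) (column y n) = - omega (column (1\<^sub>m 4) m) (column (x * y) n)"
      by (rule omega_sp4[OF x _ sp4_carrier[OF y] u(3) v(3)]) simp
    then show ?thesis
      using v(3) unfolding prod[OF u(2) v(2)] right_mult_one_mat[OF sp4_carrier[OF x]] u v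
      by (simp add: omega_def column_def)
  qed
  have "\<exists>k l a b c. (k, l) \<in> charts \<and> (\<forall>u\<in>R.
    chart_sign k * chart_sign l * u (3 - l) = a * u k + c * u l \<and> u (3 - k) = b * u k + a * u l)"
    by (rule isotropic_set_in_lagrangian_chart) (rule iso)
  then obtain k l a b c where kl: "(k, l) \<in> charts" and abc: "\<forall>u\<in>R.
    chart_sign k * chart_sign l * u (3 - l) = a * u k + c * u l \<and> u (3 - k) = b * u k + a * u l"
    by (elim exE conjE)
  have "\<exists>s t u. x = lagrangian_chart k l a b c s t u" if x: "x \<in> X" for x
  proof (rule sp4_with_columns_in_lagrangian[OF _ kl])
    show "x \<in> sp4" using x X by blast
    fix m :: nat assume "m < 4"
    then have "column x m \<in> R" using x by (auto simp: R_def)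
    from abc[rule_format, OF this] show "chart_sign k * chart_sign l * x $$ (3 - l, m) = a * x $$ (k, m) + c * x $$ (l, m) \<and>
      x $$ (3 - k, m) = b * x $$ (k, m) + a * x $$ (l, m)" by (simp add: column_def)
  qed
  with kl show ?thesis
    by - (rule exI[of _ k], rule exI[of _ l], rule exI[of _ a], rule exI[of _ b], rule exI[of _ c], blast)
qed

section \<open>Dimension of varieties of matrix tuples\<close>

lemma variety_dimension_lower_bound:
  fixes M :: "nat \<Rightarrow> (nat \<Rightarrow> 'k::alg_closed_field) \<Rightarrow> 'k mat"
  assumes V: "V \<subseteq> {..<r} \<rightarrow>\<^sub>E carrier_mat 4 4" and M: "\<And>t. (\<lambda>j\<in>{..<r}. M j t) \<in> V"
    and poly: "\<And>j i m. j < r \<Longrightarrow> i < 4 \<Longrightarrow> m < 4 \<Longrightarrow> (\<lambda>t. M j t $$ (i, m)) \<in> polynomial_functions (affine_coords d)"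
    and sep: "\<And>n. n < d \<Longrightarrow> \<exists>F\<in>polynomial_functions {\<lambda>x. x l $$ (i, j) | l i j. l < r \<and> i < 4 \<and> j < 4}.
      (\<forall>t. (\<forall>j\<ge>n. t j = 0) \<longrightarrow> F (\<lambda>j\<in>{..<r}. M j t) = 0) \<and>
      (\<exists>t. (\<forall>j>n. t j = 0) \<and> F (\<lambda>j\<in>{..<r}. M j t) \<noteq> 0)"
  shows "enat d \<le> variety_dimension r V"
  unfolding variety_dimension_def matrix_tuples_zariski_def
  by (rule krull_dimension_lower_bound[OF V M _ sep]) (use poly in auto)

lemma variety_dimension_upper_bound:
  fixes M :: "'j \<Rightarrow> nat \<Rightarrow> (nat \<Rightarrow> 'k::field) \<Rightarrow> 'k mat"
  assumes V: "V \<subseteq> {..<r} \<rightarrow>\<^sub>E carrier_mat 4 4" and "finite J"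
    and cover: "\<And>x. x \<in> V \<Longrightarrow> \<exists>a\<in>J. \<exists>t. \<forall>j<r. x j = M a j t"
    and poly: "\<And>a j i m. a \<in> J \<Longrightarrow> j < r \<Longrightarrow> i < 4 \<Longrightarrow> m < 4 \<Longrightarrow>
      (\<lambda>t. M a j t $$ (i, m)) \<in> polynomial_functions (affine_coords d)"
  shows "variety_dimension r V \<le> enat d"
  unfolding variety_dimension_def matrix_tuples_zariski_def
proof (rule krull_dimension_upper_bound[OF V \<open>finite J\<close>, of "\<lambda>a t. \<lambda>j\<in>{..<r}. M a j t"])
  show "V \<subseteq> (\<Union>a\<in>J. range (\<lambda>t. \<lambda>j\<in>{..<r}. M a j t))"
  proof
    fix x assume x: "x \<in> V"
    then obtain a t where a: "a \<in> J" and t: "\<forall>j<r. x j = M a j t" using cover by blast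
    have "x = (\<lambda>j\<in>{..<r}. M a j t)"
      by (rule PiE_ext[of _ "{..<r}" "\<lambda>_. carrier_mat 4 4"]) (use x V t in \<open>auto simp: PiE_iff\<close>)
    then show "x \<in> (\<Union>a\<in>J. range (\<lambda>t. \<lambda>j\<in>{..<r}. M a j t))" using a by blast
  qed
qed (use poly in auto)

lemma matrix_coord:
  assumes "l < r" "i < 4" "m < 4"
  shows "(\<lambda>x. x l $$ (i, m)) \<in> polynomial_functions {\<lambda>x. x l $$ (i, j) | l i j. l < r \<and> i < 4 \<and> j < 4}"
  by (rule polynomial_functions.coord) (use assms in blast)

lemma coordinate_separates:
  fixes \<phi> :: "(nat \<Rightarrow> 'k::field) \<Rightarrow> 'a"
  assumes "F \<in> P" "\<And>t. F (\<phi> t) = t n"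
  shows "\<exists>F\<in>P. (\<forall>t. (\<forall>j\<ge>n. t j = 0) \<longrightarrow> F (\<phi> t) = 0) \<and> (\<exists>t. (\<forall>j>n. t j = 0) \<and> F (\<phi> t) \<noteq> 0)"
  by (rule bexI[OF _ assms(1)]) (auto simp: assms(2) intro!: exI[of _ "\<lambda>i. if i = n then 1 else 0"])

lemma commuting_variety_subset:
  assumes "V \<subseteq> carrier_mat 4 4"
  shows "commuting_variety r V \<subseteq> {..<r} \<rightarrow>\<^sub>E carrier_mat 4 4"
  using assms PiE_mono[of "{..<r}" "\<lambda>_. V" "\<lambda>_. carrier_mat 4 4"] by (auto simp: commuting_variety_def)

lemma lie_bracket_eq_0_iff:
  fixes x y :: "'k::ring mat"
  assumes "x \<in> carrier_mat 4 4" "y \<in> carrier_mat 4 4"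
  shows "lie_bracket x y = 0\<^sub>m 4 4 \<longleftrightarrow> x * y = y * x"
proof
  assume z: "lie_bracket x y = 0\<^sub>m 4 4"
  show "x * y = y * x"
  proof (rule eq_matI)
    fix i j assume ij: "i < dim_row (y * x)" "j < dim_col (y * x)"
    then have "lie_bracket x y $$ (i, j) = 0" unfolding z using assms by simp
    then show "(x * y) $$ (i, j) = (y * x) $$ (i, j)"
      using ij assms by (simp add: lie_bracket_def del: index_mult_mat(1))
  qed (use assms in auto)
next
  assume "x * y = y * x"
  then show "lie_bracket x y = 0\<^sub>m 4 4"
    unfolding lie_bracket_def using assms by (auto intro!: eq_matI simp del: index_mult_mat(1))
qed

lemma commuting_variety_iff:
  fixes V :: "'k::comm_ring_1 mat set"
  assumes V: "V \<subseteq> carrier_mat 4 4"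
  shows "x \<in> commuting_variety r V \<longleftrightarrow>
    x \<in> {..<r} \<rightarrow>\<^sub>E V \<and> (\<forall>i<r. \<forall>j<r. x i * x j = x j * x i)"
proof (cases "x \<in> {..<r} \<rightarrow>\<^sub>E V")
  case True
  then have c: "x i \<in> carrier_mat 4 4" if "i < r" for i using that V by auto
  have "(\<forall>j<r. \<forall>i\<le>j. lie_bracket (x i) (x j) = 0\<^sub>m 4 4) \<longleftrightarrow> (\<forall>j<r. \<forall>i\<le>j. x i * x j = x j * x i)"
    using lie_bracket_eq_0_iff[OF c c] by (meson le_less_trans)
  also have "\<dots> \<longleftrightarrow> (\<forall>i<r. \<forall>j<r. x i * x j = x j * x i)"
    by (metis le_less_trans nat_le_linear)
  finally show ?thesis using True by (simp add: commuting_variety_def)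
qed (simp add: commuting_variety_def)

lemma restrict_in_commuting_variety:
  fixes V :: "'k::comm_ring_1 mat set"
  assumes V: "V \<subseteq> carrier_mat 4 4" and "\<And>j. j < r \<Longrightarrow> M j \<in> V"
    and "\<And>i j. i < r \<Longrightarrow> j < r \<Longrightarrow> M i * M j = M j * M i"
  shows "(\<lambda>j\<in>{..<r}. M j) \<in> commuting_variety r V"
  unfolding commuting_variety_iff[OF V] using assms by auto

lemma polynomial_functions_mult_mat_entry:
  fixes A B :: "'a \<Rightarrow> 'k::comm_ring_1 mat"
  assumes "\<And>t. A t \<in> carrier_mat 4 4" "\<And>t. B t \<in> carrier_mat 4 4"
    and "\<And>i m. i < 4 \<Longrightarrow> m < 4 \<Longrightarrow> (\<lambda>t. A t $$ (i, m)) \<in> polynomial_functions C"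
    and "\<And>i m. i < 4 \<Longrightarrow> m < 4 \<Longrightarrow> (\<lambda>t. B t $$ (i, m)) \<in> polynomial_functions C"
    and im: "i < 4" "m < 4"
  shows "(\<lambda>t. (A t * B t) $$ (i, m)) \<in> polynomial_functions C"
  unfolding index_mult_mat4[OF assms(1,2) im]
  by (intro polynomial_functions.add polynomial_functions.mult assms im less_4_simps)

lemma polynomial_functions_flat:
  assumes "\<And>i. (\<lambda>t. u t i) \<in> polynomial_functions C"
  shows "(\<lambda>t. flat (u t) m) \<in> polynomial_functions C"
  unfolding flat_def
  by (cases "m = 0"; cases "m = 1"; cases "m = 2") (simp_all add: assms polynomial_functions_uminus)

lemma polynomial_functions_place:
  assumes "a \<in> polynomial_functions C" "b \<in> polynomial_functions C"
    "c \<in> polynomial_functions C" "d \<in> polynomial_functions C"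
  shows "(\<lambda>t. place k l (a t) (b t) (c t) (d t) i) \<in> polynomial_functions C"
  unfolding place_def using assms
  by (cases "i = k"; cases "i = l"; cases "i = 3 - l")
    (auto intro: polynomial_functions.mult polynomial_functions.const)

lemma div_mod_3_simps [simp]:
  "Suc (3 * j) div 3 = j" "Suc (Suc (3 * j)) div 3 = j"
  "Suc (3 * j) mod 3 = Suc 0" "Suc (Suc (3 * j)) mod 3 = 2"
  by presburger+

section \<open>Restricted nilpotent matrices\<close>

lemma pow_mat_zero_mono:
  assumes "x \<in> carrier_mat 4 4" "x ^\<^sub>m k = 0\<^sub>m 4 4" "k \<le> n"
  shows "x ^\<^sub>m n = (0\<^sub>m 4 4 :: 'k::comm_ring_1 mat)"
  using assms(3)
proof (induction n rule: dec_induct)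
  case (step n)
  then show ?case using left_mult_zero_mat[OF assms(1)] by simp
qed (rule assms(2))

lemma pow_mat_2_3_4:
  fixes x :: "'k::comm_ring_1 mat"
  assumes x: "x \<in> carrier_mat 4 4"
  shows "x ^\<^sub>m 2 = x * x" "x ^\<^sub>m 3 = x * (x * x)" "x ^\<^sub>m 4 = (x * x) * (x * x)"
proof -
  have 1: "x ^\<^sub>m 1 = x" using x by simp
  show 2: "x ^\<^sub>m 2 = x * x" using 1 by (simp add: numeral_2_eq_2)
  have "x ^\<^sub>m 3 = x * x * x" unfolding 2[symmetric] by (simp add: numeral_3_eq_3 numeral_2_eq_2)
  then show 3: "x ^\<^sub>m 3 = x * (x * x)" using x by simp
  have "x ^\<^sub>m 4 = x ^\<^sub>m 3 * x" by (simp add: eval_nat_numeral)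
  then have "x ^\<^sub>m 4 = x * (x * x) * x" unfolding 3 .
  also have "\<dots> = x * x * (x * x)" using x by (simp add: assoc_mult_mat[of _ 4 4 _ 4 _ 4])
  finally show "x ^\<^sub>m 4 = (x * x) * (x * x)" .
qed

lemma restricted_nullcone_carrier: "restricted_nullcone p \<subseteq> (carrier_mat 4 4 :: 'k::comm_ring_1 mat set)"
  using sp4_carrier by (auto simp: restricted_nullcone_def)

lemma restricted_upper_carrier: "restricted_upper p \<subseteq> (carrier_mat 4 4 :: 'k::comm_ring_1 mat set)"
  using restricted_nullcone_carrier by (auto simp: restricted_upper_def)

lemma restricted_nullcone_iff_fourth_power:
  fixes x :: "'k::field mat"
  assumes "4 \<le> p"
  shows "x \<in> restricted_nullcone p \<longleftrightarrow> x \<in> sp4 \<and> (x * x) * (x * x) = 0\<^sub>m 4 4"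
proof (cases "x \<in> sp4")
  case True
  then show ?thesis
    using sp4_nilpotent_fourth_power[OF True, of p] pow_mat_zero_mono[OF sp4_carrier[OF True] _ assms]
      pow_mat_2_3_4(3)[OF sp4_carrier[OF True]]
    by (auto simp: restricted_nullcone_def)
qed (simp add: restricted_nullcone_def)

lemma restricted_nullcone_iff_cube:
  fixes x :: "'k::field mat"
  shows "x \<in> restricted_nullcone 3 \<longleftrightarrow> x \<in> sp4 \<and> x * (x * x) = 0\<^sub>m 4 4"
proof (cases "x \<in> sp4")
  case True
  show ?thesis
    unfolding restricted_nullcone_def pow_mat_2_3_4(2)[OF sp4_carrier[OF True], symmetric] by simp
qed (simp add: restricted_nullcone_def)

lemma square_zero_in_restricted_nullcone:
  fixes x :: "'k::field mat"
  assumes "x \<in> sp4" "x * x = 0\<^sub>m 4 4" "2 \<le> p"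
  shows "x \<in> restricted_nullcone p"
  using assms pow_mat_zero_mono[OF sp4_carrier[OF assms(1)] _ assms(3)] pow_mat_2_3_4(1)[OF sp4_carrier[OF assms(1)]]
  by (simp add: restricted_nullcone_def)

section \<open>Strictly upper triangular tuples\<close>

text \<open>
  The coordinates belong to the roots \<open>\<alpha>\<close> (short), \<open>\<beta>\<close> (long), \<open>\<alpha> + \<beta>\<close> and \<open>2\<alpha> + \<beta>\<close>, in this order.
\<close>

definition upper_sp4 :: "'k::comm_ring_1 \<Rightarrow> 'k \<Rightarrow> 'k \<Rightarrow> 'k \<Rightarrow> 'k mat" where
  "upper_sp4 a b c d = mat 4 4 (\<lambda>(i, m). if i = 0 \<and> m = 1 then a else if i = 1 \<and> m = 2 then b
     else if i = 0 \<and> m = 2 \<or> i = 1 \<and> m = 3 then c else if i = 0 \<and> m = 3 then d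
     else if i = 2 \<and> m = 3 then - a else 0)"

lemma upper_sp4_carrier [simp]: "upper_sp4 a b c d \<in> carrier_mat 4 4"
  by (simp add: upper_sp4_def)

lemma strictly_upper_sp4_iff: "x \<in> strictly_upper_sp4 \<longleftrightarrow> (\<exists>a b c d. x = upper_sp4 a b c d)"
proof
  assume x: "x \<in> strictly_upper_sp4"
  then have s: "x \<in> sp4" and z: "\<And>i j. i < 4 \<Longrightarrow> j \<le> i \<Longrightarrow> x $$ (i, j) = 0"
    by (auto simp: strictly_upper_sp4_def)
  have "x = upper_sp4 (x $$ (0, 1)) (x $$ (1, 2)) (x $$ (0, 2)) (x $$ (0, 3))"
  proof (rule mat4_eqI)
    fix i m :: nat assume "i < 4" "m < 4"
    then show "x $$ (i, m) = upper_sp4 (x $$ (0, 1)) (x $$ (1, 2)) (x $$ (0, 2)) (x $$ (0, 3)) $$ (i, m)"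
      using s unfolding sp4_iff by (elim less_4_cases) (simp_all add: upper_sp4_def z)
  qed (use sp4_carrier[OF s] in auto)
  then show "\<exists>a b c d. x = upper_sp4 a b c d" by blast
next
  assume "\<exists>a b c d. x = upper_sp4 a b c d"
  then show "x \<in> strictly_upper_sp4"
    by (auto simp: strictly_upper_sp4_def sp4_iff upper_sp4_def all_less_4_iff)
qed

lemma upper_sp4_mult:
  "upper_sp4 a b c d * upper_sp4 a' b' c' d' = mat 4 4 (\<lambda>(i, m). if i = 0 \<and> m = 2 then a * b'
     else if i = 0 \<and> m = 3 then a * c' - c * a' else if i = 1 \<and> m = 3 then - b * a' else 0)"
proof (rule mat4_eqI)
  fix i m :: nat assume "i < 4" "m < 4"
  then show "(upper_sp4 a b c d * upper_sp4 a' b' c' d') $$ (i, m) = mat 4 4 (\<lambda>(i, m). if i = 0 \<and> m = 2 then a * b'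
     else if i = 0 \<and> m = 3 then a * c' - c * a' else if i = 1 \<and> m = 3 then - b * a' else 0) $$ (i, m)"
    by (simp add: index_mult_mat4 del: index_mult_mat(1)) (elim less_4_cases; simp add: upper_sp4_def)
qed (auto intro!: mult_carrier_mat[of _ 4 4] simp: upper_sp4_carrier)

lemma upper_sp4_commute_iff:
  fixes a b c d :: "'k::field"
  assumes two: "(2 :: 'k) \<noteq> 0"
  shows "upper_sp4 a b c d * upper_sp4 a' b' c' d' = upper_sp4 a' b' c' d' * upper_sp4 a b c d \<longleftrightarrow>
    a * b' = a' * b \<and> a * c' = a' * c"
proof
  let ?P = "upper_sp4 a b c d * upper_sp4 a' b' c' d'" and ?Q = "upper_sp4 a' b' c' d' * upper_sp4 a b c d"
  assume "?P = ?Q"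
  then have e: "?P $$ (0, 2) = ?Q $$ (0, 2)" "?P $$ (0, 3) = ?Q $$ (0, 3)" by simp_all
  have "a * b' = a' * b" using e(1) unfolding upper_sp4_mult by simp
  moreover have "2 * (a * c' - a' * c) = 0"
    using e(2) unfolding upper_sp4_mult by (simp add: algebra_simps)
  ultimately show "a * b' = a' * b \<and> a * c' = a' * c" using two by simp
qed (auto simp: upper_sp4_mult mult.commute intro!: eq_matI)

lemma upper_sp4_cube:
  "upper_sp4 a b c d * (upper_sp4 a b c d * upper_sp4 a b c d) =
    mat 4 4 (\<lambda>(i, m). if i = 0 \<and> m = 3 then - a * a * b else 0)"
proof (rule mat4_eqI)
  fix i m :: nat assume "i < 4" "m < 4"
  then show "(upper_sp4 a b c d * (upper_sp4 a b c d * upper_sp4 a b c d)) $$ (i, m) =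
    mat 4 4 (\<lambda>(i, m). if i = 0 \<and> m = 3 then - a * a * b else 0) $$ (i, m)"
    unfolding upper_sp4_mult
    by (simp add: index_mult_mat4 del: index_mult_mat(1)) (elim less_4_cases; simp add: upper_sp4_def)
qed (auto intro!: mult_carrier_mat[of _ 4 4] simp: upper_sp4_carrier)

lemma upper_sp4_fourth_power:
  "(upper_sp4 a b c d * upper_sp4 a b c d) * (upper_sp4 a b c d * upper_sp4 a b c d) = 0\<^sub>m 4 4"
  unfolding upper_sp4_mult
proof (rule mat4_eqI)
  fix i m :: nat assume "i < 4" "m < 4"
  then show "(mat 4 4 (\<lambda>(i, m). if i = 0 \<and> m = 2 then a * b
       else if i = 0 \<and> m = 3 then a * c - c * a else if i = 1 \<and> m = 3 then - b * a else 0) *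
     mat 4 4 (\<lambda>(i, m). if i = 0 \<and> m = 2 then a * b
       else if i = 0 \<and> m = 3 then a * c - c * a else if i = 1 \<and> m = 3 then - b * a else 0)) $$ (i, m) =
     0\<^sub>m 4 4 $$ (i, m)"
    by (simp add: index_mult_mat4 del: index_mult_mat(1))
qed (auto intro!: mult_carrier_mat[of _ 4 4])

lemma upper_sp4_abelian: "upper_sp4 0 b c d * upper_sp4 0 b' c' d' = 0\<^sub>m 4 4"
  unfolding upper_sp4_mult by (intro eq_matI) auto

lemma upper_sp4_in_restricted_upper:
  fixes a b c d :: "'k::field"
  assumes "p = 3 \<and> a * b = 0 \<or> 4 \<le> p"
  shows "upper_sp4 a b c d \<in> restricted_upper p"
proof -
  let ?x = "upper_sp4 a b c d"
  have s: "?x \<in> strictly_upper_sp4" unfolding strictly_upper_sp4_iff by blast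
  then have sp: "?x \<in> sp4" by (simp add: strictly_upper_sp4_def)
  have "?x \<in> restricted_nullcone p"
    using assms
  proof
    assume p: "p = 3 \<and> a * b = 0"
    then have "?x * (?x * ?x) = 0\<^sub>m 4 4"
      unfolding upper_sp4_cube by (intro eq_matI) auto
    then show ?thesis using p restricted_nullcone_iff_cube sp by blast
  next
    assume "4 \<le> p"
    then show ?thesis using restricted_nullcone_iff_fourth_power sp upper_sp4_fourth_power by blast
  qed
  then show ?thesis using s by (simp add: restricted_upper_def)
qed

lemma restricted_upper_commuting_tuple:
  fixes x :: "nat \<Rightarrow> 'k::field mat"
  assumes x: "x \<in> commuting_variety r (restricted_upper p)" and two: "(2 :: 'k) \<noteq> 0"
  obtains a b c d where "\<And>j. j < r \<Longrightarrow> x j = upper_sp4 (a j) (b j) (c j) (d j)"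
    "\<And>i j. i < r \<Longrightarrow> j < r \<Longrightarrow> a i * b j = a j * b i \<and> a i * c j = a j * c i"
proof -
  have x: "\<And>j. j < r \<Longrightarrow> x j \<in> restricted_upper p" and comm: "\<And>i j. i < r \<Longrightarrow> j < r \<Longrightarrow> x i * x j = x j * x i"
    using x unfolding commuting_variety_iff[OF restricted_upper_carrier] by auto
  have "\<forall>j\<in>{..<r}. \<exists>a b c d. x j = upper_sp4 a b c d"
    using x by (auto simp: restricted_upper_def strictly_upper_sp4_iff)
  then obtain a b c d where abcd: "\<And>j. j < r \<Longrightarrow> x j = upper_sp4 (a j) (b j) (c j) (d j)"
    by (metis lessThan_iff)
  have "a i * b j = a j * b i \<and> a i * c j = a j * c i" if "i < r" "j < r" for i j
    using comm[OF that] unfolding abcd[OF that(1)] abcd[OF that(2)] upper_sp4_commute_iff[OF two] .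
  with abcd show ?thesis by (rule that)
qed

lemma polynomial_functions_upper_sp4_entry:
  assumes "a \<in> polynomial_functions C" "b \<in> polynomial_functions C"
    "c \<in> polynomial_functions C" "d \<in> polynomial_functions C" and im: "i < 4" "m < 4"
  shows "(\<lambda>t. upper_sp4 (a t) (b t) (c t) (d t) $$ (i, m)) \<in> polynomial_functions C"
  using im by (elim less_4_cases)
    (simp_all add: upper_sp4_def assms polynomial_functions.const polynomial_functions_uminus)

text \<open>
  The elements with \<open>a = 0\<close> form a three-dimensional abelian subalgebra.
\<close>

lemma dim_commuting_upper_ge:
  assumes "3 \<le> p"
  shows "enat (3 * r) \<le> variety_dimension r (commuting_variety r (restricted_upper p :: 'k::alg_closed_field mat set))"
proof (rule variety_dimension_lower_bound[OF commuting_variety_subset[OF restricted_upper_carrier],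
      of "\<lambda>j t. upper_sp4 0 (t (3 * j)) (t (3 * j + 1)) (t (3 * j + 2))"])
  fix t :: "nat \<Rightarrow> 'k"
  show "(\<lambda>j\<in>{..<r}. upper_sp4 0 (t (3 * j)) (t (3 * j + 1)) (t (3 * j + 2))) \<in> commuting_variety r (restricted_upper p)"
  proof (rule restrict_in_commuting_variety[OF restricted_upper_carrier])
    fix j
    show "upper_sp4 0 (t (3 * j)) (t (3 * j + 1)) (t (3 * j + 2)) \<in> restricted_upper p"
      by (rule upper_sp4_in_restricted_upper) (use assms in auto)
  qed (simp add: upper_sp4_abelian)
next
  fix j i m :: nat assume "j < r" "i < 4" "m < 4"
  then show "(\<lambda>t :: nat \<Rightarrow> 'k. upper_sp4 0 (t (3 * j)) (t (3 * j + 1)) (t (3 * j + 2)) $$ (i, m))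
    \<in> polynomial_functions (affine_coords (3 * r))"
    by (intro polynomial_functions_upper_sp4_entry polynomial_functions.const affine_coord) auto
next
  fix n assume n: "n < 3 * r"
  define j where "j = n div 3"
  define e where "e = n mod 3"
  have je: "n = 3 * j + e" "e < 3" "j < r" using n by (auto simp: j_def e_def)
  define i m :: nat where "i = (if e = 0 then 1 else 0)" and "m = (if e = 2 then 3 else 2)"
  let ?M = "\<lambda>t :: nat \<Rightarrow> 'k. \<lambda>j\<in>{..<r}. upper_sp4 0 (t (3 * j)) (t (3 * j + 1)) (t (3 * j + 2))"
  have val: "?M t j $$ (i, m) = t n" for t
    using je by (auto simp: i_def m_def upper_sp4_def less_Suc_eq numeral_3_eq_3)
  show "\<exists>F\<in>polynomial_functions {\<lambda>x. x l $$ (i, j) | l i j. l < r \<and> i < 4 \<and> j < 4}.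
      (\<forall>t. (\<forall>j\<ge>n. t j = 0) \<longrightarrow> F (?M t) = 0) \<and> (\<exists>t. (\<forall>j>n. t j = 0) \<and> F (?M t) \<noteq> 0)"
    by (rule coordinate_separates[where F = "\<lambda>x. x j $$ (i, m)", OF matrix_coord])
      (use je val in \<open>simp_all add: i_def m_def\<close>)
qed

lemma dim_upper_ge:
  assumes "4 \<le> p"
  shows "enat 4 \<le> variety_dimension (Suc 0) (commuting_variety (Suc 0) (restricted_upper p :: 'k::alg_closed_field mat set))"
proof (rule variety_dimension_lower_bound[OF commuting_variety_subset[OF restricted_upper_carrier],
      of "\<lambda>j t. upper_sp4 (t 0) (t 1) (t 2) (t 3)"])
  fix t :: "nat \<Rightarrow> 'k"
  show "(\<lambda>j\<in>{..<Suc 0}. upper_sp4 (t 0) (t 1) (t 2) (t 3)) \<in> commuting_variety (Suc 0) (restricted_upper p)"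
    by (rule restrict_in_commuting_variety[OF restricted_upper_carrier])
      (use assms in \<open>auto intro!: upper_sp4_in_restricted_upper\<close>)
next
  fix j i m :: nat assume "j < Suc 0" "i < 4" "m < 4"
  then show "(\<lambda>t :: nat \<Rightarrow> 'k. upper_sp4 (t 0) (t 1) (t 2) (t 3) $$ (i, m)) \<in> polynomial_functions (affine_coords 4)"
    by (intro polynomial_functions_upper_sp4_entry affine_coord) auto
next
  fix n :: nat assume n: "n < 4"
  define i m :: nat where "i = (if n = 1 then 1 else 0)" and "m = (if n = 0 then 1 else if n = 3 then 3 else 2)"
  let ?M = "\<lambda>t :: nat \<Rightarrow> 'k. \<lambda>j\<in>{..<Suc 0}. upper_sp4 (t 0) (t 1) (t 2) (t 3)"
  have val: "?M t 0 $$ (i, m) = t n" for t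
    using n by (elim less_4_cases) (auto simp: i_def m_def upper_sp4_def)
  show "\<exists>F\<in>polynomial_functions {\<lambda>x. x l $$ (i, j) | l i j. l < Suc 0 \<and> i < 4 \<and> j < 4}.
      (\<forall>t. (\<forall>j\<ge>n. t j = 0) \<longrightarrow> F (?M t) = 0) \<and> (\<exists>t. (\<forall>j>n. t j = 0) \<and> F (?M t) \<noteq> 0)"
    by (rule coordinate_separates[where F = "\<lambda>x. x 0 $$ (i, m)", OF matrix_coord])
      (use val in \<open>simp_all add: i_def m_def\<close>)
qed

text \<open>
  If all \<open>a\<close>-coordinates vanish, there are \<open>3r\<close> parameters. Otherwise \<open>b\<^sub>j = \<beta> a\<^sub>j\<close> and \<open>c\<^sub>j = \<gamma> a\<^sub>j\<close>, with parameters
  \<open>\<beta>\<close>, \<open>\<gamma>\<close>, \<open>a\<^sub>j\<close> and the coordinate in position \<open>(0, 3)\<close>; for \<open>p = 3\<close> the vanishing of the cube gives \<open>\<beta> = 0\<close>.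
\<close>

lemma dim_commuting_upper_le:
  assumes two: "(2 :: 'k::alg_closed_field) \<noteq> 0" and d: "3 * r \<le> d" "if p = 3 then 2 * r + 1 \<le> d else 2 * r + 2 \<le> d"
  shows "variety_dimension r (commuting_variety r (restricted_upper p :: 'k mat set)) \<le> enat d"
proof -
  define M1 where "M1 j t = upper_sp4 0 (t (3 * j)) (t (3 * j + 1)) (t (3 * j + 2))" for j and t :: "nat \<Rightarrow> 'k"
  \<comment> \<open>\<open>\<gamma>\<close> is parameter \<open>0\<close>, and \<open>\<beta>\<close> comes last, so that it can be dropped when \<open>p = 3\<close>\<close>
  define M2 where "M2 j t = upper_sp4 (t (2 * j + 1)) (if p = 3 then 0 else t (2 * r + 1) * t (2 * j + 1)) (t 0 * t (2 * j + 1)) (t (2 * j + 2))"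
    for j and t :: "nat \<Rightarrow> 'k"
  show ?thesis
  proof (rule variety_dimension_upper_bound[OF commuting_variety_subset[OF restricted_upper_carrier],
        of "{True, False}" _ _ "\<lambda>a. if a then M1 else M2"])
    fix x :: "nat \<Rightarrow> 'k mat" assume x: "x \<in> commuting_variety r (restricted_upper p)"
    obtain a b c e where abcd: "\<And>j. j < r \<Longrightarrow> x j = upper_sp4 (a j) (b j) (c j) (e j)"
      and comm: "\<And>i j. i < r \<Longrightarrow> j < r \<Longrightarrow> a i * b j = a j * b i \<and> a i * c j = a j * c i"
      using restricted_upper_commuting_tuple[OF x two] by metis
    have xu: "x j \<in> restricted_upper p" if "j < r" for j
      using x that unfolding commuting_variety_iff[OF restricted_upper_carrier] by auto
    show "\<exists>aa\<in>{True, False}. \<exists>t. \<forall>j<r. x j = (if aa then M1 else M2) j t"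
    proof (cases "\<forall>j<r. a j = 0")
      case True
      define t where "t n = (if n mod 3 = 0 then b (n div 3) else if n mod 3 = 1 then c (n div 3) else e (n div 3))" for n
      have t: "t (3 * j) = b j" "t (3 * j + 1) = c j" "t (3 * j + 2) = e j" for j
        by (simp_all add: t_def)
      have "\<forall>j<r. x j = M1 j t" unfolding M1_def t using abcd True by simp
      then show ?thesis by auto
    next
      case False
      then obtain i where i: "i < r" "a i \<noteq> 0" by blast
      define \<beta> \<gamma> where "\<beta> = b i / a i" and "\<gamma> = c i / a i"
      have bc: "b j = \<beta> * a j" "c j = \<gamma> * a j" if "j < r" for j
        using comm[OF i(1) that] i(2) by (simp_all add: \<beta>_def \<gamma>_def field_simps)
      have \<beta>3: "\<beta> = 0" if "p = 3"
      proof -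
        have "x i * (x i * x i) = 0\<^sub>m 4 4"
          using xu[OF i(1)] that restricted_nullcone_iff_cube by (auto simp: restricted_upper_def)
        then have "(x i * (x i * x i)) $$ (0, 3) = 0" by simp
        then have "a i * a i * b i = 0" unfolding abcd[OF i(1)] upper_sp4_cube by simp
        then show ?thesis using i(2) by (simp add: \<beta>_def)
      qed
      define t where "t n = (if n = 0 then \<gamma> else if n = 2 * r + 1 then \<beta> else if odd n then a (n div 2) else e ((n - 1) div 2))" for n
      have t: "t 0 = \<gamma>" "t (2 * r + 1) = \<beta>" by (simp_all add: t_def)
      have tj: "t (2 * j + 1) = a j" "t (2 * j + 2) = e j" if "j < r" for j
        using that by (auto simp: t_def)
      have "x j = M2 j t" if "j < r" for j
        unfolding M2_def t tj[OF that] abcd[OF that] bc[OF that] using \<beta>3 by simp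
      then show ?thesis by auto
    qed
  next
    fix aa and j i m :: nat assume "aa \<in> {True, False}" and j: "j < r" and im: "i < 4" "m < 4"
    have 1: "(\<lambda>t. M1 j t $$ (i, m)) \<in> polynomial_functions (affine_coords d)"
      unfolding M1_def using j d
      by (intro polynomial_functions_upper_sp4_entry polynomial_functions.const affine_coord im) auto
    have 2: "(\<lambda>t. M2 j t $$ (i, m)) \<in> polynomial_functions (affine_coords d)"
    proof (cases "p = 3")
      case True
      then show ?thesis
        unfolding M2_def using j d
        by (simp only: if_True) (intro polynomial_functions_upper_sp4_entry
            polynomial_functions.mult affine_coord im; simp add: polynomial_functions.const)
    next
      case False
      then show ?thesis
        unfolding M2_def using j d
        by (simp only: if_False) (intro polynomial_functions_upper_sp4_entry polynomial_functions.const
            polynomial_functions.mult affine_coord im; simp)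
    qed
    show "(\<lambda>t. (if aa then M1 else M2) j t $$ (i, m)) \<in> polynomial_functions (affine_coords d)"
      using 1 2 by (cases aa) simp_all
  qed simp
qed

section \<open>Nilpotent tuples: upper bounds\<close>

text \<open>
  The position of \<open>j\<close> among the indices different from \<open>i\<close>; the regular member \<open>i\<close> of the tuple takes none of the parameters beyond the
  first eight.
\<close>

definition param_position :: "nat \<Rightarrow> nat \<Rightarrow> nat" where
  "param_position i j = (if j < i then j else j - 1)"

text \<open>
  Tuples whose member \<open>i\<close> is \<open>x\<close> and whose other members are combinations of \<open>x\<close> and \<open>x\<^sup>3\<close>. The order of the first eight parameters,
  with those of the vector \<open>f\<close> last, lets each parameter be detected in turn by a polynomial function.
\<close>

definition regular_tuple :: "nat \<Rightarrow> nat \<Rightarrow> nat \<Rightarrow> nat \<Rightarrow> (nat \<Rightarrow> 'k::comm_ring_1) \<Rightarrow> 'k mat" where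
  "regular_tuple k l i j t =
    (let x = nilpotent_chart k l (t 5) (t 6) (t 7) (t 2) (t 3) (t 4) (t 0) (t 1) in
     if j = i then x else t (8 + 2 * param_position i j) \<cdot>\<^sub>m x + t (9 + 2 * param_position i j) \<cdot>\<^sub>m (x * (x * x)))"

text \<open>
  Parameters \<open>3\<close> to \<open>5\<close> describe the Lagrangian plane. The quadratic form of member \<open>0\<close> comes before them, because the plane
  can be read off only from a nondegenerate form; the other members follow.
\<close>

definition lagrangian_tuple :: "nat \<Rightarrow> nat \<Rightarrow> nat \<Rightarrow> (nat \<Rightarrow> 'k::comm_ring_1) \<Rightarrow> 'k mat" where
  "lagrangian_tuple k l j t = (let n = (if j = 0 then 0 else 3 * j + 3) in
     lagrangian_chart k l (t 3) (t 4) (t 5) (t n) (t (n + 1)) (t (n + 2)))"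

lemma nilpotent_chart_carrier [simp]: "nilpotent_chart k l a b c g1 g2 g3 h1 h2 \<in> carrier_mat 4 4"
  by (simp add: nilpotent_chart_def)

lemma lagrangian_chart_carrier [simp]: "lagrangian_chart k l a b c s t u \<in> carrier_mat 4 4"
  by (simp add: lagrangian_chart_def)

lemma polynomial_functions_nilpotent_chart_entry:
  assumes "a \<in> polynomial_functions C" "b \<in> polynomial_functions C" "c \<in> polynomial_functions C"
    "g1 \<in> polynomial_functions C" "g2 \<in> polynomial_functions C" "g3 \<in> polynomial_functions C"
    "h1 \<in> polynomial_functions C" "h2 \<in> polynomial_functions C" and im: "i < 4" "m < 4"
  shows "(\<lambda>t. nilpotent_chart k l (a t) (b t) (c t) (g1 t) (g2 t) (g3 t) (h1 t) (h2 t) $$ (i, m)) \<in> polynomial_functions C"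
  unfolding nilpotent_chart_def sym_nilpotent_entry[OF im]
  by (intro polynomial_functions.add polynomial_functions.mult polynomial_functions_flat polynomial_functions_place
      polynomial_functions_diff polynomial_functions.const assms)

lemma polynomial_functions_lagrangian_chart_entry:
  assumes "a \<in> polynomial_functions C" "b \<in> polynomial_functions C" "c \<in> polynomial_functions C"
    "s \<in> polynomial_functions C" "t \<in> polynomial_functions C" "u \<in> polynomial_functions C" and im: "i < 4" "m < 4"
  shows "(\<lambda>z. lagrangian_chart k l (a z) (b z) (c z) (s z) (t z) (u z) $$ (i, m)) \<in> polynomial_functions C"
  unfolding lagrangian_chart_def sym_lagrangian_entry[OF im]
  by (intro polynomial_functions.add polynomial_functions.mult polynomial_functions_flat polynomial_functions_place
      polynomial_functions_diff polynomial_functions.const assms)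

lemma regular_tuple_polynomial:
  assumes "j < r" "i < r" "2 * r + 6 \<le> d" and im: "i' < 4" "m < 4"
  shows "(\<lambda>t. regular_tuple k l i j t $$ (i', m)) \<in> polynomial_functions (affine_coords d)"
proof -
  let ?x = "\<lambda>t :: nat \<Rightarrow> 'a. nilpotent_chart k l (t 5) (t 6) (t 7) (t 2) (t 3) (t 4) (t 0) (t 1)"
  have x: "(\<lambda>t. ?x t $$ (i', m)) \<in> polynomial_functions (affine_coords d)" if "i' < 4" "m < 4" for i' m
    by (intro polynomial_functions_nilpotent_chart_entry affine_coord that; use assms in linarith)
  have x3: "(\<lambda>t. (?x t * (?x t * ?x t)) $$ (i', m)) \<in> polynomial_functions (affine_coords d)"
    by (intro polynomial_functions_mult_mat_entry x im mult_carrier_mat[of _ 4 4] nilpotent_chart_carrier; assumption)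
  show ?thesis
  proof (cases "j = i")
    case True
    then show ?thesis using x[OF im] by (simp add: regular_tuple_def)
  next
    case False
    then have pos: "9 + 2 * param_position i j < d" using assms by (auto simp: param_position_def)
    have c3: "?x t * (?x t * ?x t) \<in> carrier_mat 4 4" for t
      by (intro mult_carrier_mat[of _ 4 4] nilpotent_chart_carrier)
    have "regular_tuple k l i j t $$ (i', m) =
      t (8 + 2 * param_position i j) * ?x t $$ (i', m) + t (9 + 2 * param_position i j) * (?x t * (?x t * ?x t)) $$ (i', m)" for t
      using False im carrier_matD[OF c3[of t]] carrier_matD[OF nilpotent_chart_carrier]
      by (simp add: regular_tuple_def Let_def del: index_mult_mat(1))
    then show ?thesis
      using x[OF im] x3 pos by (simp only:) (intro polynomial_functions.add polynomial_functions.mult affine_coord; simp)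
  qed
qed

lemma lagrangian_tuple_polynomial:
  assumes "j < r" "3 * r + 3 \<le> d" and im: "i < 4" "m < 4"
  shows "(\<lambda>t. lagrangian_tuple k l j t $$ (i, m)) \<in> polynomial_functions (affine_coords d)"
  unfolding lagrangian_tuple_def Let_def
  by (intro polynomial_functions_lagrangian_chart_entry affine_coord im; use assms in simp)

lemma regular_commuting_tuple_in_chart:
  fixes x :: "nat \<Rightarrow> 'k::alg_closed_field mat"
  assumes two: "(2 :: 'k) \<noteq> 0" and x: "\<And>j. j < r \<Longrightarrow> x j \<in> sp4"
    and x4: "(x i * x i) * (x i * x i) = 0\<^sub>m 4 4" and i: "i < r" "x i * (x i * x i) \<noteq> 0\<^sub>m 4 4"
    and comm: "\<And>i j. i < r \<Longrightarrow> j < r \<Longrightarrow> x i * x j = x j * x i"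
  shows "\<exists>k l. (k, l) \<in> charts \<and> (\<exists>t. \<forall>j<r. x j = regular_tuple k l i j t)"
proof -
  obtain k l a b c g1 g2 g3 h1 h2 where kl: "(k, l) \<in> charts"
    and xi: "x i = nilpotent_chart k l a b c g1 g2 g3 h1 h2"
    using regular_nilpotent_in_chart[OF x[OF i(1)] x4 i(2) two] by blast
  have "\<forall>j\<in>{..<r}. \<exists>s t. x j = s \<cdot>\<^sub>m x i + t \<cdot>\<^sub>m (x i * (x i * x i))"
    using regular_nilpotent_centralizer[OF x[OF i(1)] x4 i(2) two x comm[OF i(1)]] by blast
  then obtain s u where su: "\<And>j. j < r \<Longrightarrow> x j = s j \<cdot>\<^sub>m x i + u j \<cdot>\<^sub>m (x i * (x i * x i))"
    by (metis lessThan_iff)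
  define t where "t n = (if n = 0 then h1 else if n = 1 then h2 else if n = 2 then g1 else if n = 3 then g2
    else if n = 4 then g3 else if n = 5 then a else if n = 6 then b else if n = 7 then c
    else (let m = (n - 8) div 2; j = (if m < i then m else m + 1) in if even n then s j else u j))" for n
  have t: "t 0 = h1" "t 1 = h2" "t 2 = g1" "t 3 = g2" "t 4 = g3" "t 5 = a" "t 6 = b" "t 7 = c"
    by (simp_all add: t_def)
  have tj: "t (8 + 2 * param_position i j) = s j" "t (9 + 2 * param_position i j) = u j" if "j \<noteq> i" for j
    using that by (auto simp: t_def param_position_def Let_def)
  have "x j = regular_tuple k l i j t" if "j < r" for j
  proof (cases "j = i")
    case True
    then show ?thesis unfolding regular_tuple_def Let_def t xi[symmetric] by simp
  next
    case False
    then show ?thesis unfolding regular_tuple_def Let_def t xi[symmetric] tj[OF False] using su[OF that] by simp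
  qed
  then show ?thesis using kl by blast
qed

lemma zero_product_tuple_in_chart:
  fixes x :: "nat \<Rightarrow> 'k::field mat"
  assumes x: "\<And>j. j < r \<Longrightarrow> x j \<in> sp4" and prod: "\<And>i j. i < r \<Longrightarrow> j < r \<Longrightarrow> x i * x j = 0\<^sub>m 4 4"
  shows "\<exists>k l. (k, l) \<in> charts \<and> (\<exists>t. \<forall>j<r. x j = lagrangian_tuple k l j t)"
proof -
  have "\<exists>k l a b c. (k, l) \<in> charts \<and> (\<forall>y\<in>x ` {..<r}. \<exists>s t u. y = lagrangian_chart k l a b c s t u)"
    by (rule zero_products_in_lagrangian_chart) (use x prod in auto)
  then obtain k l a b c where kl: "(k, l) \<in> charts"
    and "\<forall>y\<in>x ` {..<r}. \<exists>s t u. y = lagrangian_chart k l a b c s t u"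
    by (elim exE conjE)
  then have "\<forall>j\<in>{..<r}. \<exists>s t u. x j = lagrangian_chart k l a b c s t u" by blast
  then obtain s v u where sv: "\<And>j. j < r \<Longrightarrow> x j = lagrangian_chart k l a b c (s j) (v j) (u j)"
    by (metis lessThan_iff)
  define t where "t n = (if n = 3 then a else if n = 4 then b else if n = 5 then c else
    (let j = (if n < 3 then 0 else (n - 3) div 3) in if n mod 3 = 0 then s j else if n mod 3 = 1 then v j else u j))" for n
  have t: "t 3 = a" "t 4 = b" "t 5 = c" by (simp_all add: t_def)
  have "x j = lagrangian_tuple k l j t" if "j < r" for j
  proof (cases "j = 0")
    case True
    then show ?thesis using sv[OF that] unfolding lagrangian_tuple_def Let_def t by (simp add: t_def)
  next
    case False
    have "t (3 * j + 3) = s j" "t (3 * j + 3 + 1) = v j" "t (3 * j + 3 + 2) = u j"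
    proof -
      have e: "3 * j + 3 = 3 * Suc j" "3 * j + 3 - 3 = 3 * j" "3 * j + 3 + 1 - 3 = Suc (3 * j)"
        "3 * j + 3 + 2 - 3 = Suc (Suc (3 * j))" by simp_all
      have m: "(3 * j + 3) mod 3 = 0" "(3 * j + 3 + 1) mod 3 = 1" "(3 * j + 3 + 2) mod 3 = 2" by presburger+
      show "t (3 * j + 3) = s j" "t (3 * j + 3 + 1) = v j" "t (3 * j + 3 + 2) = u j"
        unfolding t_def Let_def e(2-4) m using False by simp_all
    qed
    then show ?thesis using sv[OF that] False unfolding lagrangian_tuple_def Let_def t by simp
  qed
  then show ?thesis using kl by blast
qed

text \<open>
  The cover by the two kinds of tuples: with a regular member \<open>i\<close>, indexed by \<open>Some i\<close>, or with vanishing products, indexed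
  by \<open>None\<close>.
\<close>

lemma dim_commuting_nullcone_le:
  assumes two: "(2 :: 'k::alg_closed_field) \<noteq> 0" and p: "3 \<le> p"
    and d: "3 * r + 3 \<le> d" "p \<noteq> 3 \<longrightarrow> 2 * r + 6 \<le> d"
  shows "variety_dimension r (commuting_variety r (restricted_nullcone p :: 'k mat set)) \<le> enat d"
proof -
  define J :: "((nat \<times> nat) \<times> nat option) set" where
    "J = charts \<times> (if p = 3 then {None} else insert None (Some ` {..<r}))"
  define M :: "(nat \<times> nat) \<times> nat option \<Rightarrow> nat \<Rightarrow> (nat \<Rightarrow> 'k) \<Rightarrow> 'k mat" where "M a = (case a of ((k, l), None) \<Rightarrow> lagrangian_tuple k l | ((k, l), Some i) \<Rightarrow> regular_tuple k l i)"
    for a :: "(nat \<times> nat) \<times> nat option"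
  show ?thesis
  proof (rule variety_dimension_upper_bound[OF commuting_variety_subset[OF restricted_nullcone_carrier], of J _ _ M])
    show "finite J" using finite_charts by (auto simp: J_def)
  next
    fix x :: "nat \<Rightarrow> 'k mat" assume "x \<in> commuting_variety r (restricted_nullcone p)"
    then have xn: "\<And>j. j < r \<Longrightarrow> x j \<in> restricted_nullcone p"
      and comm: "\<And>i j. i < r \<Longrightarrow> j < r \<Longrightarrow> x i * x j = x j * x i"
      unfolding commuting_variety_iff[OF restricted_nullcone_carrier] by auto
    have xs: "x j \<in> sp4" if "j < r" for j using xn[OF that] by (simp add: restricted_nullcone_def)
    show "\<exists>a\<in>J. \<exists>t. \<forall>j<r. x j = M a j t"
    proof (cases "\<exists>i<r. x i * (x i * x i) \<noteq> 0\<^sub>m 4 4")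
      case True
      then obtain i where i: "i < r" "x i * (x i * x i) \<noteq> 0\<^sub>m 4 4" by blast
      then have p3: "p \<noteq> 3" using xn restricted_nullcone_iff_cube by blast
      then have "4 \<le> p" using p by simp
      then have "(x i * x i) * (x i * x i) = 0\<^sub>m 4 4"
        using xn[OF i(1)] restricted_nullcone_iff_fourth_power by blast
      from regular_commuting_tuple_in_chart[where x = x and i = i and r = r, OF two xs this i comm]
      obtain k l t where "(k, l) \<in> charts" "\<forall>j<r. x j = regular_tuple k l i j t" by blast
      then show ?thesis using p3 i(1) by (intro bexI[of _ "((k, l), Some i)"]) (auto simp: M_def J_def)
    next
      case False
      then have "x i * x j = 0\<^sub>m 4 4" if "i < r" "j < r" for i j
        using sp4_commuting_cubes_zero_products_zero[OF xs xs comm two] that by blast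
      from zero_product_tuple_in_chart[where x = x and r = r, OF xs this]
      obtain k l t where "(k, l) \<in> charts" "\<forall>j<r. x j = lagrangian_tuple k l j t" by blast
      then show ?thesis by (intro bexI[of _ "((k, l), None)"]) (auto simp: M_def J_def)
    qed
  next
    fix a and j i m :: nat assume a: "a \<in> J" and j: "j < r" and im: "i < 4" "m < 4"
    obtain k l o' where kl: "a = ((k, l), o')" by (metis surj_pair)
    show "(\<lambda>t. M a j t $$ (i, m)) \<in> polynomial_functions (affine_coords d)"
    proof (cases o')
      case None
      then show ?thesis using lagrangian_tuple_polynomial[OF j d(1) im] by (simp add: M_def kl)
    next
      case (Some i')
      then have "i' < r" "p \<noteq> 3" using a by (auto simp: J_def kl split: if_splits)
      then show ?thesis using regular_tuple_polynomial[OF j _ _ im, of i' d] d(2) Some by (simp add: M_def kl)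
    qed
  qed
qed


section \<open>Nilpotent tuples: lower bounds\<close>

lemma sym_lagrangian_mult:
  assumes "omega f g = 0"
  shows "sym_lagrangian f g s t u * sym_lagrangian f g s' t' u' = 0\<^sub>m 4 4"
proof (rule mat4_eqI)
  fix i m :: nat assume im: "i < 4" "m < 4"
  have gf: "omega g f = 0" using assms omega_skew[of g f] by simp
  have "(sym_lagrangian f g s t u * sym_lagrangian f g s' t' u') $$ (i, m) =
    (s * f i + t * g i) * omega f f * (s' * flat f m + t' * flat g m)
    + (s * f i + t * g i) * omega f g * (t' * flat f m + u' * flat g m)
    + (t * f i + u * g i) * omega g f * (s' * flat f m + t' * flat g m)
    + (t * f i + u * g i) * omega g g * (t' * flat f m + u' * flat g m)"
    unfolding index_mult_mat4[OF sym_lagrangian_carrier sym_lagrangian_carrier im]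
      sym_lagrangian_entry[OF im(1) less_4_simps(1)] sym_lagrangian_entry[OF im(1) less_4_simps(2)]
      sym_lagrangian_entry[OF im(1) less_4_simps(3)] sym_lagrangian_entry[OF im(1) less_4_simps(4)]
      sym_lagrangian_entry[OF less_4_simps(1) im(2)] sym_lagrangian_entry[OF less_4_simps(2) im(2)]
      sym_lagrangian_entry[OF less_4_simps(3) im(2)] sym_lagrangian_entry[OF less_4_simps(4) im(2)]
      sum_flat[symmetric]
    by (simp only: algebra_simps)
  then show "(sym_lagrangian f g s t u * sym_lagrangian f g s' t' u') $$ (i, m) = 0\<^sub>m 4 4 $$ (i, m)"
    using im by (simp add: assms gf)
qed (auto intro!: mult_carrier_mat[of _ 4 4])

lemma sym_lagrangian_sp4: "sym_lagrangian f g s t u \<in> sp4"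
  by (simp add: sp4_iff sym_lagrangian_entry algebra_simps)

lemma lagrangian_chart_mult:
  assumes "(k, l) \<in> charts"
  shows "lagrangian_chart k l a b c s t u * lagrangian_chart k l a b c s' t' u' = 0\<^sub>m 4 4"
  unfolding lagrangian_chart_def by (rule sym_lagrangian_mult) (simp add: omega_place[OF assms])

lemma chart_0_1: "(0, 1) \<in> charts" by (simp add: charts_def)

text \<open>
  With the form \<open>(s, t, u)\<close> of member \<open>0\<close> and the plane parameters \<open>(a, b, c)\<close>, the entries at \<open>(0, 3)\<close>, \<open>(0, 2)\<close>,
  \<open>(1, 2)\<close> are \<open>s, t, u\<close>, and those at \<open>(2, 3)\<close>, \<open>(2, 2)\<close>, \<open>(3, 3)\<close> are \<open>s a + t c\<close>, \<open>t a + u c\<close>, \<open>s b + t a\<close>.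
  This gives functions that detect \<open>a\<close> when \<open>b = c = 0\<close>, then \<open>b\<close> when \<open>c = 0\<close>, and finally \<open>c\<close> with factor \<open>u s - t\<^sup>2\<close>.
\<close>

lemma dim_commuting_nullcone_ge_lagrangian:
  assumes p: "3 \<le> p" and r: "1 \<le> r"
  shows "enat (3 * r + 3) \<le> variety_dimension r (commuting_variety r (restricted_nullcone p :: 'k::alg_closed_field mat set))"
proof (rule variety_dimension_lower_bound[OF commuting_variety_subset[OF restricted_nullcone_carrier],
      of "lagrangian_tuple 0 1"])
  fix t :: "nat \<Rightarrow> 'k"
  have mult: "lagrangian_tuple 0 1 i t * lagrangian_tuple 0 1 j t = 0\<^sub>m 4 4" for i j
    unfolding lagrangian_tuple_def Let_def by (rule lagrangian_chart_mult[OF chart_0_1])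
  have sp: "lagrangian_tuple 0 1 j t \<in> sp4" for j
    unfolding lagrangian_tuple_def Let_def lagrangian_chart_def by (rule sym_lagrangian_sp4)
  show "(\<lambda>j\<in>{..<r}. lagrangian_tuple 0 1 j t) \<in> commuting_variety r (restricted_nullcone p)"
    by (rule restrict_in_commuting_variety[OF restricted_nullcone_carrier square_zero_in_restricted_nullcone[OF sp mult]])
      (use p mult in auto)
next
  fix j i m :: nat assume "j < r" "i < 4" "m < 4"
  then show "(\<lambda>t :: nat \<Rightarrow> 'k. lagrangian_tuple 0 1 j t $$ (i, m)) \<in> polynomial_functions (affine_coords (3 * r + 3))"
    by (intro lagrangian_tuple_polynomial[of j r]) auto
next
  fix n assume n: "n < 3 * r + 3"
  let ?M = "\<lambda>t :: nat \<Rightarrow> 'k. \<lambda>j\<in>{..<r}. lagrangian_tuple 0 1 j t"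
  let ?P = "polynomial_functions {\<lambda>x :: nat \<Rightarrow> 'k mat. x l $$ (i, j) | l i j. l < r \<and> i < 4 \<and> j < 4}"
  have sep: "\<exists>F\<in>?P. (\<forall>t. (\<forall>j\<ge>n. t j = 0) \<longrightarrow> F (?M t) = 0) \<and> (\<exists>t. (\<forall>j>n. t j = 0) \<and> F (?M t) \<noteq> 0)"
    if "F \<in> ?P" "\<And>t. \<forall>j\<ge>n. t j = 0 \<Longrightarrow> F (?M t) = 0" "\<forall>j>n. t j = 0" "F (?M t) \<noteq> 0" for F t
    using that by blast
  have entry: "?M t j $$ (i, m) = (let n = if j = 0 then 0 else 3 * j + 3;
      f = place 0 1 1 0 (t 3) (t 4); g = place 0 1 0 1 (t 5) (t 3) in
      t n * f i * flat f m + t (n + 1) * (f i * flat g m + g i * flat f m) + t (n + 2) * g i * flat g m)"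
    if "j < r" "i < 4" "m < 4" for j i m t
    using that by (simp add: lagrangian_tuple_def Let_def lagrangian_chart_def sym_lagrangian_entry)
  have r0: "0 < r" using r by simp
  have pl: "place 0 (Suc 0) a b c d 0 = a" "place 0 (Suc 0) a b c d (Suc 0) = b" "place 0 (Suc 0) a b c d 2 = c"
    "place 0 (Suc 0) a b c d 3 = d" for a b c d :: 'k
    by (simp_all add: place_def chart_sign_def)
  have e0: "?M t 0 $$ (0, 3) = t 0" "?M t 0 $$ (0, 2) = t 1" "?M t 0 $$ (1, 2) = t 2"
    "?M t 0 $$ (2, 3) = t 0 * t 3 + t 1 * t 5" "?M t 0 $$ (2, 2) = t 1 * t 3 + t 2 * t 5"
    "?M t 0 $$ (3, 3) = t 0 * t 4 + t 1 * t 3" for t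
    using entry[of 0] r0 by (simp_all add: Let_def pl algebra_simps del: restrict_apply restrict_apply' flip: numeral_2_eq_2)
  note coord = matrix_coord[where r = r]
  show "\<exists>F\<in>?P. (\<forall>t. (\<forall>j\<ge>n. t j = 0) \<longrightarrow> F (?M t) = 0) \<and> (\<exists>t. (\<forall>j>n. t j = 0) \<and> F (?M t) \<noteq> 0)"
  proof -
    consider "n = 0" | "n = 1" | "n = 2" | "n = 3" | "n = 4" | "n = 5" | "6 \<le> n" by linarith
    then show ?thesis
    proof cases
      case 1
      show ?thesis unfolding 1
        by (rule coordinate_separates[where F = "\<lambda>x. x 0 $$ (0, 3)", OF coord]) (use r0 e0 in simp_all)
    next
      case 2
      show ?thesis unfolding 2
        by (rule coordinate_separates[where F = "\<lambda>x. x 0 $$ (0, 2)", OF coord]) (use r0 e0 in simp_all)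
    next
      case 3
      show ?thesis unfolding 3
        by (rule coordinate_separates[where F = "\<lambda>x. x 0 $$ (1, 2)", OF coord]) (use r0 e0 in simp_all)
    next
      case 4
      show ?thesis
        by (rule sep[of "\<lambda>x. x 0 $$ (2, 3)" "\<lambda>i. if i = 0 \<or> i = 3 then 1 else 0", OF coord])
          (use 4 in \<open>simp_all only: e0 r0, auto\<close>)
    next
      case 5
      show ?thesis
        by (rule sep[of "\<lambda>x. x 0 $$ (3, 3) - x 0 $$ (2, 2)" "\<lambda>i. if i = 0 \<or> i = 4 then 1 else 0",
              OF polynomial_functions_diff[OF coord coord]])
          (use 5 in \<open>simp_all only: e0 r0, auto\<close>)
    next
      case 6
      show ?thesis
        by (rule sep[of "\<lambda>x. x 0 $$ (2, 2) * x 0 $$ (0, 3) - x 0 $$ (2, 3) * x 0 $$ (0, 2)" "\<lambda>i. if i = 0 \<or> i = 2 \<or> i = 5 then 1 else 0",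
              OF polynomial_functions_diff[OF polynomial_functions.mult[OF coord coord] polynomial_functions.mult[OF coord coord]]])
          (use 6 in \<open>simp_all only: e0 r0, auto\<close>)
    next
      case 7
      define j where "j = (n - 3) div 3"
      define e where "e = (n - 3) mod 3"
      have je: "n = 3 * j + 3 + e" "e < 3" "j < r" "j \<noteq> 0" using 7 n by (auto simp: j_def e_def)
      define i m :: nat where "i = (if e = 2 then 1 else 0)" and "m = (if e = 0 then 3 else 2)"
      have "?M t j $$ (i, m) = t n" for t
      proof -
        consider "e = 0" | "e = 1" | "e = 2" using je by linarith
        then show ?thesis
          using entry[of j i m t] je by cases (simp_all add: Let_def pl i_def m_def del: restrict_apply restrict_apply')
      qed
      then show ?thesis
        by (intro coordinate_separates[where F = "\<lambda>x. x j $$ (i, m)", OF coord]) (use je in \<open>simp_all add: i_def m_def\<close>)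
    qed
  qed
qed

lemma sym_nilpotent_sp4: "sym_nilpotent f g h \<in> sp4"
  by (simp add: sp4_iff sym_nilpotent_entry algebra_simps)

text \<open>
  The matrix \<open>x\<close> sends \<open>g\<close> to a multiple of \<open>h\<close>, \<open>h\<close> to a multiple of \<open>f\<close>, and \<open>f\<close> to \<open>0\<close>; both factors are
  \<open>omega h g\<close> up to sign.
\<close>

lemma sym_nilpotent_powers:
  fixes f g h :: "nat \<Rightarrow> 'k::comm_ring_1"
  assumes fg: "omega f g = 0" and fh: "omega f h = 0"
  defines "x \<equiv> sym_nilpotent f g h"
  shows "i < 4 \<Longrightarrow> m < 4 \<Longrightarrow> (x * (x * x)) $$ (i, m) = - (omega h g)\<^sup>2 * (f i * flat f m)"
    and "(x * x) * (x * x) = 0\<^sub>m 4 4"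
proof -
  have sk: "omega g f = 0" "omega h f = 0" "omega g h = - omega h g"
    using fg fh omega_skew[of g f] omega_skew[of h f] omega_skew[of g h] by simp_all
  have xc: "x \<in> carrier_mat 4 4" by (simp add: x_def)
  have xxc: "x * x \<in> carrier_mat 4 4" "x * (x * x) \<in> carrier_mat 4 4" using xc by auto
  have xe: "x $$ (i, m) = f i * flat g m + g i * flat f m + h i * flat h m" if "i < 4" "m < 4" for i m
    unfolding x_def by (rule sym_nilpotent_entry[OF that])
  have left: "(x * y) $$ (i, m) = f i * omega g (column y m) + g i * omega f (column y m) + h i * omega h (column y m)"
    if "y \<in> carrier_mat 4 4" "i < 4" "m < 4" for y i m
    unfolding index_mult_mat4[OF xc that] xe[OF that(2) less_4_simps(1)] xe[OF that(2) less_4_simps(2)]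
      xe[OF that(2) less_4_simps(3)] xe[OF that(2) less_4_simps(4)] sum_flat[symmetric] column_def
    by (simp only: algebra_simps)
  have lin3: "omega u (column y m) = a * omega u f + b * omega u g + c * omega u h"
    if "\<And>i. i < 4 \<Longrightarrow> y $$ (i, m) = f i * a + g i * b + h i * c" for u y m a b c
    using that[OF less_4_simps(1)] that[OF less_4_simps(2)] that[OF less_4_simps(3)] that[OF less_4_simps(4)]
    by (simp add: omega_def column_def algebra_simps)
  have om_x: "omega u (column x m) = flat g m * omega u f + flat f m * omega u g + flat h m * omega u h" if "m < 4" for u m
    by (rule lin3) (simp add: xe that)
  have sq: "(x * x) $$ (i, m) = f i * (- omega h g * flat h m) + g i * 0 + h i * (omega h g * flat f m)"
    if "i < 4" "m < 4" for i m
    unfolding left[OF xc that] om_x[OF that(2)] by (simp add: sk fg fh)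
  have om_sq: "omega u (column (x * x) m) = - omega h g * flat h m * omega u f + 0 * omega u g + omega h g * flat f m * omega u h"
    if "m < 4" for u m
    by (rule lin3) (simp only: sq that)
  show cube: "(x * (x * x)) $$ (i, m) = - (omega h g)\<^sup>2 * (f i * flat f m)" if "i < 4" "m < 4" for i m
    unfolding left[OF xxc(1) that] om_sq[OF that(2)] by (simp add: sk fg fh power2_eq_square algebra_simps)
  have om_cube: "omega u (column (x * (x * x)) m) = (- (omega h g)\<^sup>2 * flat f m) * omega u f + 0 * omega u g + 0 * omega u h"
    if "m < 4" for u m
    by (rule lin3) (simp only: cube that, simp)
  have "x * (x * (x * x)) = 0\<^sub>m 4 4"
  proof (rule mat4_eqI)
    fix i m :: nat assume im: "i < 4" "m < 4"
    then show "(x * (x * (x * x))) $$ (i, m) = 0\<^sub>m 4 4 $$ (i, m)"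
      unfolding left[OF xxc(2) im] om_cube[OF im(2)] by (simp add: sk fh)
  qed (use xc xxc in auto)
  then show "(x * x) * (x * x) = 0\<^sub>m 4 4"
    using assoc_mult_mat[OF xc xc xxc(1)] by simp
qed

lemma nilpotent_chart_sp4: "nilpotent_chart k l a b c g1 g2 g3 h1 h2 \<in> sp4"
  unfolding nilpotent_chart_def by (rule sym_nilpotent_sp4)

lemma nilpotent_chart_powers:
  fixes a b c g1 g2 g3 h1 h2 :: "'k::comm_ring_1"
  assumes "(k, l) \<in> charts"
  defines "x \<equiv> nilpotent_chart k l a b c g1 g2 g3 h1 h2"
  shows "i < 4 \<Longrightarrow> m < 4 \<Longrightarrow> (x * (x * x)) $$ (i, m) =
      - (h1 * g3 - h2 * g2 - (b * h1 - a * h2) * g1)\<^sup>2 * (place k l 1 a b c i * flat (place k l 1 a b c) m)"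
    and "(x * x) * (x * x) = 0\<^sub>m 4 4"
proof -
  let ?f = "place k l 1 a b c" and ?g = "place k l g1 g2 g3 (c * g1 + b * g2 - a * g3)"
    and ?h = "place k l 0 h1 h2 (b * h1 - a * h2)"
  have o: "omega ?f ?g = 0" "omega ?f ?h = 0"
    by (simp_all add: omega_place[OF assms(1)] algebra_simps)
  have hg: "(omega ?h ?g)\<^sup>2 = (h1 * g3 - h2 * g2 - (b * h1 - a * h2) * g1)\<^sup>2"
    by (simp add: omega_place[OF assms(1)] power_mult_distrib power2_eq_square[of "chart_sign k"])
  show "i < 4 \<Longrightarrow> m < 4 \<Longrightarrow> (x * (x * x)) $$ (i, m) =
      - (h1 * g3 - h2 * g2 - (b * h1 - a * h2) * g1)\<^sup>2 * (?f i * flat ?f m)"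
    unfolding hg[symmetric] x_def nilpotent_chart_def by (rule sym_nilpotent_powers(1)[OF o])
  show "(x * x) * (x * x) = 0\<^sub>m 4 4"
    unfolding x_def nilpotent_chart_def by (rule sym_nilpotent_powers(2)[OF o])
qed

lemma polynomial_in_x_commute:
  fixes x :: "'k::comm_ring_1 mat"
  assumes x: "x \<in> carrier_mat 4 4"
  shows "(s \<cdot>\<^sub>m x + t \<cdot>\<^sub>m (x * (x * x))) * (s' \<cdot>\<^sub>m x + t' \<cdot>\<^sub>m (x * (x * x))) =
    (s' \<cdot>\<^sub>m x + t' \<cdot>\<^sub>m (x * (x * x))) * (s \<cdot>\<^sub>m x + t \<cdot>\<^sub>m (x * (x * x)))"
proof -
  define y where "y = x * (x * x)"
  have y: "y \<in> carrier_mat 4 4" using x by (simp add: y_def)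
  have xy: "y * x = x * y" unfolding y_def using x by (simp add: assoc_mult_mat[of _ 4 4 _ 4 _ 4])
  show ?thesis
    unfolding y_def[symmetric] using x y
    by (intro mat4_eqI) (simp_all add: add_mult_distrib_mat[of _ 4 4 _ _ 4] mult_add_distrib_mat[of _ 4 4 _ 4]
        mult_smult_distrib[of _ 4 4 _ 4] mult_smult_assoc_mat[of _ 4 4 _ 4] xy algebra_simps del: index_mult_mat(1))
qed

lemma polynomial_in_x_fourth_power:
  fixes x :: "'k::comm_ring_1 mat"
  assumes x: "x \<in> carrier_mat 4 4" and x4: "(x * x) * (x * x) = 0\<^sub>m 4 4"
  defines "y \<equiv> \<lambda>s t. s \<cdot>\<^sub>m x + t \<cdot>\<^sub>m (x * (x * x))"
  shows "(y s t * y s t) * (y s t * y s t) = 0\<^sub>m 4 4"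
proof -
  define z where "z = x * (x * x)"
  have z: "z \<in> carrier_mat 4 4" using x by (simp add: z_def)
  have xz: "x * z = 0\<^sub>m 4 4"
    unfolding z_def using x x4 by (simp add: assoc_mult_mat[of _ 4 4 _ 4 _ 4])
  have zx: "z * x = 0\<^sub>m 4 4"
    unfolding z_def using x x4 by (simp add: assoc_mult_mat[of _ 4 4 _ 4 _ 4])
  have "z * z = (z * x) * (x * x)"
    unfolding z_def using x by (simp add: assoc_mult_mat[of _ 4 4 _ 4 _ 4])
  then have zz: "z * z = 0\<^sub>m 4 4"
    unfolding zx using left_mult_zero_mat[OF mult_carrier_mat[OF x x], of 4] by simp
  have "y s t * y s t = (s * s) \<cdot>\<^sub>m (x * x)"
    unfolding y_def z_def[symmetric] using x z mult_carrier_mat[OF x x]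
    by (intro mat4_eqI) (simp_all add: add_mult_distrib_mat[of _ 4 4 _ _ 4] mult_add_distrib_mat[of _ 4 4 _ 4]
        mult_smult_distrib[of _ 4 4 _ 4] mult_smult_assoc_mat[of _ 4 4 _ 4] xz zx zz mult.assoc del: index_mult_mat(1))
  then show ?thesis
    using x mult_carrier_mat[OF x x]
    by (intro mat4_eqI) (simp_all add: mult_smult_distrib[of _ 4 4 _ 4] mult_smult_assoc_mat[of _ 4 4 _ 4] x4
        del: index_mult_mat(1))
qed

lemma cube_entry:
  fixes x :: "'k::comm_ring_1 mat"
  assumes "x \<in> carrier_mat 4 4" "i < 4" "m < 4"
  shows "(x * (x * x)) $$ (i, m) = (\<Sum>a<4. x $$ (i, a) * (\<Sum>b<4. x $$ (a, b) * x $$ (b, m)))"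
  unfolding index_mult_mat4[OF assms(1) mult_carrier_mat[OF assms(1,1)] assms(2,3)]
    index_mult_mat4[OF assms(1,1) less_4_simps(1) assms(3)] index_mult_mat4[OF assms(1,1) less_4_simps(2) assms(3)]
    index_mult_mat4[OF assms(1,1) less_4_simps(3) assms(3)] index_mult_mat4[OF assms(1,1) less_4_simps(4) assms(3)]
    sum_less_4 by (simp only: add.assoc)

text \<open>
  While \<open>f\<close> is the unit vector \<open>e\<^sub>0\<close>, the entries of \<open>x\<close> detect \<open>h\<close> and \<open>g\<close>. Since \<open>x\<^sup>3\<close> is a multiple of \<open>f \<cdot> f\<close>,
  its last column is a multiple of \<open>f\<close> and detects the three parameters of \<open>f\<close>. For the further members
  \<open>\<alpha> x + \<beta> x\<^sup>3\<close>, an entry detects \<open>\<alpha>\<close>, and a minor formed with the entries of \<open>x\<close> detects \<open>\<beta>\<close>.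
\<close>

lemma dim_commuting_nullcone_ge_regular:
  assumes p: "4 \<le> p" and r: "1 \<le> r" and two: "(2 :: 'k::alg_closed_field) \<noteq> 0"
  shows "enat (2 * r + 6) \<le> variety_dimension r (commuting_variety r (restricted_nullcone p :: 'k mat set))"
proof (rule variety_dimension_lower_bound[OF commuting_variety_subset[OF restricted_nullcone_carrier],
      of "regular_tuple 0 1 0"])
  fix t :: "nat \<Rightarrow> 'k"
  define x where "x = nilpotent_chart 0 1 (t 5) (t 6) (t 7) (t 2) (t 3) (t 4) (t 0) (t 1)"
  have xc: "x \<in> carrier_mat 4 4" by (simp add: x_def)
  have x4: "(x * x) * (x * x) = 0\<^sub>m 4 4" unfolding x_def by (rule nilpotent_chart_powers(2)[OF chart_0_1])
  have xs: "x \<in> sp4" unfolding x_def by (rule nilpotent_chart_sp4)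
  define s where "s j = (if j = 0 then 1 else t (8 + 2 * param_position 0 j))" for j
  define u where "u j = (if j = 0 then 0 else t (9 + 2 * param_position 0 j))" for j
  have M: "regular_tuple 0 1 0 j t = s j \<cdot>\<^sub>m x + u j \<cdot>\<^sub>m (x * (x * x))" for j
  proof (cases "j = 0")
    case True
    then show ?thesis unfolding regular_tuple_def Let_def x_def[symmetric] s_def u_def using xc
      by (intro eq_matI) (auto simp del: index_mult_mat(1))
  qed (simp add: regular_tuple_def Let_def x_def s_def u_def)
  show "(\<lambda>j\<in>{..<r}. regular_tuple 0 1 0 j t) \<in> commuting_variety r (restricted_nullcone p)"
  proof (rule restrict_in_commuting_variety[OF restricted_nullcone_carrier])
    fix i j
    show "regular_tuple 0 1 0 i t * regular_tuple 0 1 0 j t = regular_tuple 0 1 0 j t * regular_tuple 0 1 0 i t"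
      unfolding M by (rule polynomial_in_x_commute[OF xc])
  next
    fix j
    let ?y = "s j \<cdot>\<^sub>m x + u j \<cdot>\<^sub>m (x * (x * x))"
    have x3c: "x * (x * x) \<in> carrier_mat 4 4" using xc by simp
    have x3: "x * (x * x) \<in> sp4"
      using xs x3c unfolding sp4_iff by (simp add: cube_entry[OF xc] sum_less_4 algebra_simps del: index_mult_mat(1))
    have ys: "?y \<in> sp4"
      using xs x3 carrier_matD[OF x3c] carrier_matD[OF xc] xc x3c unfolding sp4_iff
      by (simp del: index_mult_mat) (simp add: algebra_simps)
    show "regular_tuple 0 1 0 j t \<in> restricted_nullcone p"
      unfolding M restricted_nullcone_iff_fourth_power[OF p]
      using ys polynomial_in_x_fourth_power[OF xc x4] by simp
  qed
next
  fix j i m :: nat assume "j < r" "i < 4" "m < 4"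
  then show "(\<lambda>t :: nat \<Rightarrow> 'k. regular_tuple 0 1 0 j t $$ (i, m)) \<in> polynomial_functions (affine_coords (2 * r + 6))"
    by (intro regular_tuple_polynomial[of j r 0]) auto
next
  fix n assume n: "n < 2 * r + 6"
  let ?M = "\<lambda>t :: nat \<Rightarrow> 'k. \<lambda>j\<in>{..<r}. regular_tuple 0 1 0 j t"
  let ?P = "polynomial_functions {\<lambda>x :: nat \<Rightarrow> 'k mat. x l $$ (i, j) | l i j. l < r \<and> i < 4 \<and> j < 4}"
  have sep: "\<exists>F\<in>?P. (\<forall>t. (\<forall>j\<ge>n. t j = 0) \<longrightarrow> F (?M t) = 0) \<and> (\<exists>t. (\<forall>j>n. t j = 0) \<and> F (?M t) \<noteq> 0)"
    if "F \<in> ?P" "\<And>t. \<forall>j\<ge>n. t j = 0 \<Longrightarrow> F (?M t) = 0" "\<forall>j>n. t j = 0" "F (?M t) \<noteq> 0" for F t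
    using that by blast
  have r0: "0 < r" using r by simp
  note coord = matrix_coord[where r = r]
  define X where "X t = nilpotent_chart 0 1 (t 5) (t 6) (t 7) (t 2) (t 3) (t 4) (t 0) (t 1)" for t :: "nat \<Rightarrow> 'k"
  have Xc: "X t \<in> carrier_mat 4 4" for t by (simp add: X_def)
  have M0: "?M t 0 = X t" for t using r0 by (simp add: regular_tuple_def X_def)
  have Mj: "?M t j $$ (i, m) = t (6 + 2 * j) * X t $$ (i, m) + t (7 + 2 * j) * (X t * (X t * X t)) $$ (i, m)"
    if "j < r" "j \<noteq> 0" "i < 4" "m < 4" for t j i m
  proof -
    have pos: "8 + 2 * param_position 0 j = 6 + 2 * j" "9 + 2 * param_position 0 j = 7 + 2 * j"
      using that by (auto simp: param_position_def)
    have X3c: "X t * (X t * X t) \<in> carrier_mat 4 4" using Xc[of t] by (intro mult_carrier_mat[of _ 4 4])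
    show ?thesis
      using that carrier_matD[OF X3c] carrier_matD[OF Xc[of t]] unfolding regular_tuple_def Let_def X_def[symmetric]
      by (simp add: pos del: index_mult_mat)
  qed
  have pl: "place 0 (Suc 0) a b c d 0 = a" "place 0 (Suc 0) a b c d (Suc 0) = b" "place 0 (Suc 0) a b c d 2 = c"
    "place 0 (Suc 0) a b c d 3 = d" for a b c d :: 'k
    by (simp_all add: place_def chart_sign_def)
  have X0: "X t $$ (1, 2) = t 0 * t 0" "X t $$ (2, 1) = - (t 1 * t 1)" "X t $$ (0, 3) = 2 * t 2"
    "X t $$ (0, 2) = t 3" "X t $$ (0, 1) = - t 4"
    if "t 5 = 0" "t 6 = 0" "t 7 = 0" for t
    using that by (simp_all add: X_def nilpotent_chart_def sym_nilpotent_entry pl)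
  have X3: "(X t * (X t * X t)) $$ (i, m) =
      - (t 0 * t 4 - t 1 * t 3 - (t 6 * t 0 - t 5 * t 1) * t 2)\<^sup>2
      * (place 0 1 1 (t 5) (t 6) (t 7) i * flat (place 0 1 1 (t 5) (t 6) (t 7)) m)"
    if "i < 4" "m < 4" for t i m
    unfolding X_def by (rule nilpotent_chart_powers(1)[OF chart_0_1 that])
  \<comment> \<open>the entry \<open>(i, 3)\<close> of the cube of member \<open>0\<close>, written out so that it is a polynomial in the entries of arbitrary matrices\<close>
  define Q where "Q i x = (\<Sum>a<4. x 0 $$ (i, a) * (\<Sum>b<4. x 0 $$ (a, b) * x 0 $$ (b, 3)))"
    for i and x :: "nat \<Rightarrow> 'k mat"
  have QP: "Q i \<in> ?P" if "i < 4" for i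
    unfolding Q_def using r0 that by (intro polynomial_functions_sum polynomial_functions.mult coord) auto
  have Q: "Q i (?M t) = - (t 0 * t 4 - t 1 * t 3 - (t 6 * t 0 - t 5 * t 1) * t 2)\<^sup>2 * place 0 1 1 (t 5) (t 6) (t 7) i"
    if "i < 4" for i t
    using X3[OF that less_4_simps(4), of t] unfolding Q_def M0 cube_entry[OF Xc that less_4_simps(4)]
    by (simp add: pl)
  consider "n = 0" | "n = 1" | "n = 2" | "n = 3" | "n = 4" | "n = 5" | "n = 6" | "n = 7" | "8 \<le> n" by linarith
  then show "\<exists>F\<in>?P. (\<forall>t. (\<forall>j\<ge>n. t j = 0) \<longrightarrow> F (?M t) = 0) \<and> (\<exists>t. (\<forall>j>n. t j = 0) \<and> F (?M t) \<noteq> 0)"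
  proof cases
    case 1
    show ?thesis
      by (rule sep[of "\<lambda>x. x 0 $$ (1, 2)" "\<lambda>i. if i = n then 1 else 0", OF coord]) (use 1 r0 in \<open>simp_all add: M0[unfolded One_nat_def] X0[unfolded One_nat_def] del: restrict_apply restrict_apply'\<close>)
  next
    case 2
    show ?thesis
      by (rule sep[of "\<lambda>x. x 0 $$ (2, 1)" "\<lambda>i. if i = n then 1 else 0", OF coord]) (use 2 r0 in \<open>simp_all add: M0[unfolded One_nat_def] X0[unfolded One_nat_def] del: restrict_apply restrict_apply'\<close>)
  next
    case 3
    show ?thesis
      by (rule sep[of "\<lambda>x. x 0 $$ (0, 3)" "\<lambda>i. if i = n then 1 else 0", OF coord]) (use 3 r0 two in \<open>simp_all add: M0[unfolded One_nat_def] X0[unfolded One_nat_def] del: restrict_apply restrict_apply'\<close>)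
  next
    case 4
    show ?thesis
      by (rule sep[of "\<lambda>x. x 0 $$ (0, 2)" "\<lambda>i. if i = n then 1 else 0", OF coord]) (use 4 r0 in \<open>simp_all add: M0[unfolded One_nat_def] X0[unfolded One_nat_def] del: restrict_apply restrict_apply'\<close>)
  next
    case 5
    show ?thesis
      by (rule sep[of "\<lambda>x. x 0 $$ (0, 1)" "\<lambda>i. if i = n then 1 else 0", OF coord]) (use 5 r0 in \<open>simp_all add: M0[unfolded One_nat_def] X0[unfolded One_nat_def] del: restrict_apply restrict_apply'\<close>)
  next
    case 6
    show ?thesis
      by (rule sep[of "Q 1" "\<lambda>i. if i = 0 \<or> i = 4 \<or> i = n then 1 else 0", OF QP])
        (use 6 in \<open>simp_all add: Q[unfolded One_nat_def] pl\<close>)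
  next
    case 7
    show ?thesis
      by (rule sep[of "Q 2" "\<lambda>i. if i = 0 \<or> i = 4 \<or> i = n then 1 else 0", OF QP])
        (use 7 in \<open>simp_all add: Q[unfolded One_nat_def] pl\<close>)
  next
    case 8
    show ?thesis
      by (rule sep[of "Q 3" "\<lambda>i. if i = 0 \<or> i = 4 \<or> i = n then 1 else 0", OF QP])
        (use 8 in \<open>simp_all add: Q[unfolded One_nat_def] pl\<close>)
  next
    case 9
    define j where "j = n div 2 - 3"
    have j: "j < r" "j \<noteq> 0" using 9 n by (auto simp: j_def)
    show ?thesis
    proof (cases "even n")
      case True
      then have nj: "n = 6 + 2 * j" using 9 by (auto simp: j_def)
      show ?thesis
        by (rule sep[of "\<lambda>x. x j $$ (1, 2)" "\<lambda>i. if i = 0 \<or> i = n then 1 else 0", OF coord[OF j(1)]])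
          (use nj j in \<open>simp_all add: Mj[unfolded One_nat_def] X0[unfolded One_nat_def] del: restrict_apply restrict_apply'\<close>)
    next
      case False
      then have nj: "n = 7 + 2 * j" using 9 by (auto simp: j_def elim!: oddE)
      let ?t = "\<lambda>i. if i = 0 \<or> i = 4 \<or> i = n then 1 else 0 :: 'k"
      have t: "?t 5 = 0" "?t 6 = 0" "?t 7 = 0" "?t (6 + 2 * j) = 0" "?t (7 + 2 * j) = 1" "?t 0 = 1" "?t 4 = 1" "?t 1 = 0" "?t 2 = 0" "?t 3 = 0"
        using nj 9 by auto
      show ?thesis
      proof (rule sep[of "\<lambda>x. x j $$ (0, 3) * x 0 $$ (1, 2) - x j $$ (1, 2) * x 0 $$ (0, 3)" ?t])
        show "(\<lambda>x. x j $$ (0, 3) * x 0 $$ (1, 2) - x j $$ (1, 2) * x 0 $$ (0, 3)) \<in> ?P"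
          by (intro polynomial_functions_diff polynomial_functions.mult coord j r0) simp_all
        show "\<forall>j>n. ?t j = 0" using 9 by auto
      next
        fix t :: "nat \<Rightarrow> 'k" assume "\<forall>j\<ge>n. t j = 0"
        then have "t (7 + 2 * j) = 0" using nj by simp
        then show "?M t j $$ (0, 3) * ?M t 0 $$ (1, 2) - ?M t j $$ (1, 2) * ?M t 0 $$ (0, 3) = 0"
          unfolding Mj[OF j less_4_simps(1) less_4_simps(4)] Mj[OF j less_4_simps(2) less_4_simps(3)] M0 by simp
      next
        have "?M ?t j $$ (0, 3) * ?M ?t 0 $$ (1, 2) - ?M ?t j $$ (1, 2) * ?M ?t 0 $$ (0, 3) = - 1"
          unfolding Mj[OF j less_4_simps(1) less_4_simps(4)] Mj[OF j less_4_simps(2) less_4_simps(3)] M0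
            X0[of ?t, OF t(1,2,3)] X3[OF less_4_simps(1) less_4_simps(4)] X3[OF less_4_simps(2) less_4_simps(3)] t
          by (simp add: pl)
        then show "?M ?t j $$ (0, 3) * ?M ?t 0 $$ (1, 2) - ?M ?t j $$ (1, 2) * ?M ?t 0 $$ (0, 3) \<noteq> 0" by simp
      qed
    qed
  qed
qed

text \<open>
  For \<open>p \<noteq> 3\<close> each dimension is the larger of two parameter counts: \<open>2r + 2 > 3r\<close> only for \<open>r = 1\<close>, and
  \<open>2r + 6 \<ge> 3r + 3\<close> iff \<open>r \<le> 3\<close>, with equality for \<open>r = 3\<close>.
\<close>

theorem corollary3p4p2:
  fixes p r :: nat
  assumes "CHAR('k::alg_closed_field) = p" and "p \<ge> 3" and "r \<ge> 1"
  shows "variety_dimension r (commuting_variety r (restricted_upper p :: 'k mat set)) =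
           enat (if r = 1 \<and> p \<noteq> 3 then 2 * r + 2 else 3 * r) \<and>
         variety_dimension r (commuting_variety r (restricted_nullcone p :: 'k mat set)) =
           enat (if r \<le> 2 \<and> p \<noteq> 3 then 2 * r + 6 else 3 * r + 3)"
proof
  have two: "(2 :: 'k) \<noteq> 0"
  proof
    assume "(2 :: 'k) = 0"
    then have "of_nat 2 = (0 :: 'k)" by simp
    then have "p dvd 2" using assms(1) of_nat_eq_0_iff_char_dvd by blast
    then show False using assms(2) by (auto dest: dvd_imp_le)
  qed
  let ?du = "if r = 1 \<and> p \<noteq> 3 then 2 * r + 2 else 3 * r"
  show "variety_dimension r (commuting_variety r (restricted_upper p :: 'k mat set)) = enat ?du"
  proof (rule antisym)
    show "variety_dimension r (commuting_variety r (restricted_upper p :: 'k mat set)) \<le> enat ?du"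
      by (rule dim_commuting_upper_le[OF two]) (use assms in auto)
    show "enat ?du \<le> variety_dimension r (commuting_variety r (restricted_upper p :: 'k mat set))"
    proof (cases "r = 1 \<and> p \<noteq> 3")
      case True
      then show ?thesis using dim_upper_ge[of p] assms(2) by simp
    next
      case False
      show ?thesis using dim_commuting_upper_ge[OF assms(2), of r] by (simp only: False if_False)
    qed
  qed
  let ?dn = "if r \<le> 2 \<and> p \<noteq> 3 then 2 * r + 6 else 3 * r + 3"
  show "variety_dimension r (commuting_variety r (restricted_nullcone p :: 'k mat set)) = enat ?dn"
  proof (rule antisym)
    show "variety_dimension r (commuting_variety r (restricted_nullcone p :: 'k mat set)) \<le> enat ?dn"
      by (rule dim_commuting_nullcone_le[OF two assms(2)]) auto
    show "enat ?dn \<le> variety_dimension r (commuting_variety r (restricted_nullcone p :: 'k mat set))"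
    proof (cases "r \<le> 2 \<and> p \<noteq> 3")
      case True
      then show ?thesis using dim_commuting_nullcone_ge_regular[of p r] assms(2,3) two by simp
    next
      case False
      show ?thesis
        using dim_commuting_nullcone_ge_lagrangian[OF assms(2,3)] by (simp only: False if_False)
    qed
  qed
qed

end
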